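(* Let $G$ be an anti-derivative of $F$, i.e. $G'=F$, and let $G(Z)$ denote the composition of $G$ with $Z:S^2\to[-1,1]$. Then $$N=\frac12\,Z\,G(Z),\qquad (X^0)^{(-1)}=\frac12\,G(Z)$$ solve the (leading order) optimal embedding equation for the surfaces $\Sigma_d$: $$\widetilde\Delta(\widetilde\Delta+2)(X^0)^{(-1)}=2\tilde\nabla^a(\alpha_H^{(-1)})_a,$$ $$-(\widetilde\Delta+2)N=\frac12\Big[\tilde\nabla^a\tilde\nabla^b\sigma^{(-1)}_{ab}-\mathrm{tr}_{S^2}\sigma^{(-1)}-\widetilde\Delta(\mathrm{tr}_{S^2}\sigma^{(-1)})\Big].$$
   Context: The Vaidya metric in coordinates $(u,r,\theta,\phi)$ is $-(1-\frac{M(u)}{r})du^2-2\,du\,dr+r^2(d\theta^2+\sin^2\theta\,d\phi^2)$, where the smooth function $M(u)$ is the mass aspect function. Put $t=u+r$, $y^1=r\sin\theta\sin\phi$, $y^2=r\sin\theta\cos\phi$, $y^3=r\cos\theta$. Fix a unit vector $(\tilde d_1,\tilde d_2,\tilde d_3)$ and for $d>0$ let $d_i=d\,\tilde d_i$ and $\Sigma_d=\{t=d,\ \sum_i(y^i-d_i)^2=1\}$. Let $\tilde X^i$ be the standard coordinate functions on the unit sphere $S^2$, with local coordinates $u^a$ ($a=1,2$), round metric $\tilde\sigma_{ab}$, covariant derivative $\tilde\nabla$ and Laplacian $\widetilde\Delta$. Identify $\Sigma_d$ with $S^2$ by $y^i=d_i+\tilde X^i$. Let $Z=\sum_i\tilde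 d_i\tilde X^i$ on $S^2$, and let $F(z)=M(-z)$ on $[-1,1]$, so that $M(u)|_{\Sigma_d}\to F(Z)$ as $d\to\infty$. $\sigma$ is the induced metric on $\Sigma_d$, $H$ its (spacelike) mean curvature vector in the Vaidya spacetime, $J$ the future timelike normal vector obtained by reflecting $H$ through the incoming light cone in the normal bundle, and $\alpha_H(V)=\langle\nabla_V\frac{J}{|H|},\frac{H}{|H|}\rangle$. Explicitly, if $\nu$ is the outward unit normal of $\Sigma_d$ in $\{t=d\}$, $n$ the future unit normal of $\{t=d\}$, $k(X,Y)=\langle\nabla_Xn,Y\rangle$ and $\hat h$ the mean curvature of $\Sigma_d$ in $\{t=d\}$, then $H=-\hat h\nu+(\mathrm{tr}_{\Sigma_d}k)\,n$ and $J=\hat h\,n-(\mathrm{tr}_{\Sigma_d}k)\,\nu$. The tensors $\sigma^{(-1)}$ and $\alpha_H^{(-1)}$ on $S^2$ are the coefficients in the expansions, as $d\to\infty$, $\sigma_{ab}=\tilde\sigma_{ab}+d^{-1}\sigma^{(-1)}_{ab}+O(d^{-2})$ and $(\alpha_H)_a=d^{-1}(\alpha_H^{(-1)})_a+O(d^{-2})$. *)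

theory Defs
  imports "HOL-Analysis.Analysis" "HOL-Library.Landau_Symbols"
begin

section \<open>Calculus in coordinates\<close>

text \<open>Smoothness; only used for open \<open>S\<close>.\<close>

fun Ck_on :: "nat \<Rightarrow> 'a::euclidean_space set \<Rightarrow> ('a \<Rightarrow> 'b::real_normed_vector) \<Rightarrow> bool" where
  "Ck_on 0 S f \<longleftrightarrow> continuous_on S f"
| "Ck_on (Suc k) S f \<longleftrightarrow>
     (\<forall>x\<in>S. f differentiable (at x)) \<and> (\<forall>v. Ck_on k S (\<lambda>x. frechet_derivative f (at x) v))"

definition smooth_on :: "'a::euclidean_space set \<Rightarrow> ('a \<Rightarrow> 'b::real_normed_vector) \<Rightarrow> bool" where
  "smooth_on S f \<longleftrightarrow> (\<forall>k. Ck_on k S f)"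

definition pd :: "'n::finite \<Rightarrow> (real^'n \<Rightarrow> 'b::real_normed_vector) \<Rightarrow> real^'n \<Rightarrow> 'b" where
  "pd i f x = frechet_derivative f (at x) (axis i 1)"

text \<open>A metric is given by its component matrix at each point.\<close>

type_synonym 'n metric = "real^'n \<Rightarrow> real^'n^'n"

definition ip :: "'n::finite metric \<Rightarrow> real^'n \<Rightarrow> real^'n \<Rightarrow> real^'n \<Rightarrow> real" where
  "ip g x v w = v \<bullet> (g x *v w)"

definition christoffel :: "'n::finite metric \<Rightarrow> 'n \<Rightarrow> 'n \<Rightarrow> 'n \<Rightarrow> real^'n \<Rightarrow> real" where
  "christoffel g k i j x = 1/2 * (\<Sum>l\<in>UNIV. matrix_inv (g x) $ k $ l *
     (pd i (\<lambda>y. g y $ j $ l) x + pd j (\<lambda>y. g y $ i $ l) x - pd l (\<lambda>y. g y $ i $ j) x))"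

text \<open>
  \<open>pullback g f\<close> is the metric induced by the parametrization \<open>f\<close>, and \<open>cov_along g f W a u\<close> is
  \<open>\<nabla>\<^bsub>\<partial>\<^sub>a f\<^esub> W\<close> for a vector field \<open>W\<close> along \<open>f\<close>, where \<open>\<nabla>\<close> is the
  Levi-Civita connection of \<open>g\<close>.
\<close>

definition pullback :: "'n::finite metric \<Rightarrow> (real^'m \<Rightarrow> real^'n) \<Rightarrow> 'm::finite metric" where
  "pullback g f u = (\<chi> a b. ip g (f u) (pd a f u) (pd b f u))"

definition cov_along ::
  "'n::finite metric \<Rightarrow> (real^'m \<Rightarrow> real^'n) \<Rightarrow> (real^'m \<Rightarrow> real^'n) \<Rightarrow> 'm::finite \<Rightarrow> real^'m \<Rightarrow> real^'n" where
  "cov_along g f W a u = (\<chi> k. pd a (\<lambda>v. W v $ k) u +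
     (\<Sum>i\<in>UNIV. \<Sum>j\<in>UNIV. christoffel g k i j (f u) * pd a f u $ i * W u $ j))"

text \<open>
  Tensor calculus of a metric \<open>s\<close>: \<open>cov1 s \<alpha> b a = \<nabla>\<^sub>b \<alpha>\<^sub>a\<close>,
  \<open>cov2 s S c a b = \<nabla>\<^sub>c S\<^sub>a\<^sub>b\<close>, \<open>div1 s \<alpha> = \<nabla>\<^sup>a \<alpha>\<^sub>a\<close> and
  \<open>(div2 s S)\<^sub>a = \<nabla>\<^sup>b S\<^sub>a\<^sub>b\<close>.
\<close>

definition cov1 :: "'n::finite metric \<Rightarrow> (real^'n \<Rightarrow> real^'n) \<Rightarrow> 'n \<Rightarrow> 'n \<Rightarrow> real^'n \<Rightarrow> real" where
  "cov1 s \<alpha> b a u = pd b (\<lambda>v. \<alpha> v $ a) u - (\<Sum>c\<in>UNIV. christoffel s c b a u * \<alpha> u $ c)"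

definition cov2 :: "'n::finite metric \<Rightarrow> (real^'n \<Rightarrow> real^'n^'n) \<Rightarrow> 'n \<Rightarrow> 'n \<Rightarrow> 'n \<Rightarrow> real^'n \<Rightarrow> real" where
  "cov2 s S c a b u = pd c (\<lambda>v. S v $ a $ b) u
     - (\<Sum>e\<in>UNIV. christoffel s e c a u * S u $ e $ b)
     - (\<Sum>e\<in>UNIV. christoffel s e c b u * S u $ a $ e)"

definition div1 :: "'n::finite metric \<Rightarrow> (real^'n \<Rightarrow> real^'n) \<Rightarrow> real^'n \<Rightarrow> real" where
  "div1 s \<alpha> u = (\<Sum>a\<in>UNIV. \<Sum>b\<in>UNIV. matrix_inv (s u) $ a $ b * cov1 s \<alpha> b a u)"

definition div2 :: "'n::finite metric \<Rightarrow> (real^'n \<Rightarrow> real^'n^'n) \<Rightarrow> real^'n \<Rightarrow> real^'n" where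
  "div2 s S u = (\<chi> a. \<Sum>b\<in>UNIV. \<Sum>c\<in>UNIV. matrix_inv (s u) $ b $ c * cov2 s S c a b u)"

definition trace_of :: "'n::finite metric \<Rightarrow> (real^'n \<Rightarrow> real^'n^'n) \<Rightarrow> real^'n \<Rightarrow> real" where
  "trace_of s S u = (\<Sum>a\<in>UNIV. \<Sum>b\<in>UNIV. matrix_inv (s u) $ a $ b * S u $ a $ b)"

definition laplacian :: "'n::finite metric \<Rightarrow> (real^'n \<Rightarrow> real) \<Rightarrow> real^'n \<Rightarrow> real" where
  "laplacian s f = div1 s (\<lambda>u. \<chi> a. pd a f u)"


section \<open>The Vaidya metric\<close>

text \<open>Points of the spacetime are \<open>(t, y\<^sup>1, y\<^sup>2, y\<^sup>3) :: real^4\<close>.\<close>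

definition event :: "real \<Rightarrow> real^3 \<Rightarrow> real^4" where
  "event t y = vector [t, y$1, y$2, y$3]"

definition spatial :: "real^4 \<Rightarrow> real^3" where
  "spatial x = vector [x$2, x$3, x$4]"

definition rad :: "real^4 \<Rightarrow> real" where
  "rad x = norm (spatial x)"

definition ret :: "real^4 \<Rightarrow> real" where
  "ret x = x$1 - rad x"

definition dirn :: "real^4 \<Rightarrow> real^3" where
  "dirn x = spatial x /\<^sub>R rad x"

text \<open>
  The metric \<open>-(1 - M(u)/r) du\<^sup>2 - 2 du dr + r\<^sup>2 (d\<theta>\<^sup>2 + sin\<^sup>2 \<theta> d\<phi>\<^sup>2)\<close>, where \<open>u\<close> and \<open>r\<close> are
  the functions \<open>ret\<close> and \<open>rad\<close>. The round metric \<open>d\<theta>\<^sup>2 + sin\<^sup>2 \<theta> d\<phi>\<^sup>2\<close> is written as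
  \<open>d\<omega> \<bullet> d\<omega>\<close> with \<open>\<omega> = (sin \<theta> sin \<phi>, sin \<theta> cos \<phi>, cos \<theta>)\<close>, the function \<open>dirn\<close>, so that the
  formula also makes sense on the polar axis; see \<open>vaidya_polar\<close> below.
\<close>

definition vaidya_form :: "(real \<Rightarrow> real) \<Rightarrow> real^4 \<Rightarrow> real^4 \<Rightarrow> real^4 \<Rightarrow> real" where
  "vaidya_form M x v w =
    (let du = frechet_derivative ret (at x);
         dr = frechet_derivative rad (at x);
         d\<omega> = frechet_derivative dirn (at x)
     in - (1 - M (ret x) / rad x) * du v * du w - (du v * dr w + dr v * du w)
        + (rad x)\<^sup>2 * (d\<omega> v \<bullet> d\<omega> w))"

definition vaidya :: "(real \<Rightarrow> real) \<Rightarrow> 4 metric" where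
  "vaidya M x = (\<chi> \<mu> \<nu>. vaidya_form M x (axis \<mu> 1) (axis \<nu> 1))"

text \<open>The coordinate change from \<open>(u, r, \<theta>, \<phi>)\<close> to \<open>(t, y\<^sup>1, y\<^sup>2, y\<^sup>3)\<close>.\<close>

definition polar :: "real^4 \<Rightarrow> real^4" where
  "polar p = vector [p$1 + p$2, p$2 * sin (p$3) * sin (p$4), p$2 * sin (p$3) * cos (p$4), p$2 * cos (p$3)]"


lemmas vec_nth_has_derivative [derivative_intros] = bounded_linear.has_derivative[OF bounded_linear_vec_nth]

lemma vector4_eq: "(vector [a,b,c,d] :: real^4) = a *\<^sub>R axis 1 1 + b *\<^sub>R axis 2 1 + c *\<^sub>R axis 3 1 + d *\<^sub>R axis 4 1"
  by (simp add: vec_eq_iff forall_4 axis_def vector_def)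

lemma vector3_eq: "(vector [a,b,c] :: real^3) = a *\<^sub>R axis 1 1 + b *\<^sub>R axis 2 1 + c *\<^sub>R axis 3 1"
  by (simp add: vec_eq_iff forall_3 axis_def vector_def)

lemma polar_has_derivative:
  "(polar has_derivative (\<lambda>v. vector [v$1 + v$2,
      v$2 * sin (p$3) * sin (p$4) + p$2 * cos (p$3) * v$3 * sin (p$4) + p$2 * sin (p$3) * cos (p$4) * v$4,
      v$2 * sin (p$3) * cos (p$4) + p$2 * cos (p$3) * v$3 * cos (p$4) - p$2 * sin (p$3) * sin (p$4) * v$4,
      v$2 * cos (p$3) - p$2 * sin (p$3) * v$3])) (at p)"
  unfolding polar_def[abs_def] vector4_eq
  by (auto intro!: derivative_eq_intros simp: algebra_simps fun_eq_iff)

lemma norm_sph: "norm (vector [sin a * sin b, sin a * cos b, cos a] :: real^3) = 1"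
proof -
  have "(sin a * sin b)\<^sup>2 + (sin a * cos b)\<^sup>2 + (cos a)\<^sup>2 = (sin a)\<^sup>2 * ((sin b)\<^sup>2 + (cos b)\<^sup>2) + (cos a)\<^sup>2"
    by (simp only: algebra_simps power_mult_distrib)
  also have "\<dots> = 1" by simp
  finally show ?thesis
    by (simp add: norm_eq_1 inner_vec_def sum_3 power2_eq_square)
qed

lemma spatial_polar: "spatial (polar p) = p$2 *\<^sub>R vector [sin (p$3) * sin (p$4), sin (p$3) * cos (p$4), cos (p$3)]"
  by (simp add: spatial_def polar_def vec_eq_iff forall_3 vector_def)

lemma spatial_has_derivative: "(spatial has_derivative spatial) (at x)"
  unfolding spatial_def[abs_def] vector3_eq
  by (auto intro!: derivative_eq_intros)

lemma rad_polar: "p$2 > 0 \<Longrightarrow> rad (polar p) = p$2"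
  by (simp add: rad_def spatial_polar norm_sph)

lemma differentiable_rad: "spatial x \<noteq> 0 \<Longrightarrow> rad differentiable (at x)"
  unfolding rad_def[abs_def]
  by (rule differentiable_compose[of norm spatial])
     (auto intro: differentiable_norm_at simp: differentiableI[OF spatial_has_derivative])

lemma differentiable_ret: "spatial x \<noteq> 0 \<Longrightarrow> ret differentiable (at x)"
  unfolding ret_def[abs_def]
  by (intro differentiable_diff differentiable_rad)
     (rule differentiableI, rule vec_nth_has_derivative, rule has_derivative_ident)

lemma differentiable_dirn: "spatial x \<noteq> 0 \<Longrightarrow> dirn differentiable (at x)"
  unfolding dirn_def[abs_def]
  by (intro differentiable_scaleR differentiable_inverse differentiable_rad)
     (auto simp: rad_def intro: differentiableI[OF spatial_has_derivative])

lemma ip_vaidya: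
  assumes "spatial x \<noteq> 0"
  shows "ip (vaidya M) x v w = vaidya_form M x v w"
proof -
  let ?D = "\<lambda>f. frechet_derivative f (at x)"
  have lin: "linear (frechet_derivative f (at x))" if "f differentiable (at x)" for f :: "real^4 \<Rightarrow> 'b::real_normed_vector"
    using linear_frechet_derivative that by blast
  have ex: "frechet_derivative f (at x) z = (\<Sum>i\<in>UNIV. z$i *\<^sub>R frechet_derivative f (at x) (axis i 1))"
    if "f differentiable (at x)" for f :: "real^4 \<Rightarrow> 'b::real_normed_vector" and z
  proof -
    have "frechet_derivative f (at x) z = frechet_derivative f (at x) (\<Sum>i\<in>UNIV. z$i *\<^sub>R axis i 1)"
      using basis_expansion[of z] by (simp add: scalar_mult_eq_scaleR)
    then show ?thesis using lin[OF that] by (simp add: linear_sum linear_cmul)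
  qed
  show ?thesis
    unfolding ip_def vaidya_def vaidya_form_def Let_def
    unfolding ex[OF differentiable_rad[OF assms], of v] ex[OF differentiable_rad[OF assms], of w]
      ex[OF differentiable_ret[OF assms], of v] ex[OF differentiable_ret[OF assms], of w]
      ex[OF differentiable_dirn[OF assms], of v] ex[OF differentiable_dirn[OF assms], of w]
    by (simp add: matrix_vector_mult_def inner_vec_def[of v] sum_4 inner_add_left inner_add_right algebra_simps)
qed

lemma vaidya_polar:
  assumes r: "p$2 > 0"
  shows "ip (vaidya M) (polar p) (frechet_derivative polar (at p) v) (frechet_derivative polar (at p) w)
    = - (1 - M (p$1) / p$2) * v$1 * w$1 - (v$1 * w$2 + v$2 * w$1)
      + (p$2)\<^sup>2 * (v$3 * w$3 + (sin (p$3))\<^sup>2 * v$4 * w$4)"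
proof -
  let ?A = "{p :: real^4. p$2 > 0}"
  let ?\<omega> = "\<lambda>p::real^4. vector [sin (p$3) * sin (p$4), sin (p$3) * cos (p$4), cos (p$3)] :: real^3"
  let ?\<omega>' = "\<lambda>v::real^4. vector [cos (p$3) * sin (p$4) * v$3 + sin (p$3) * cos (p$4) * v$4,
     cos (p$3) * cos (p$4) * v$3 - sin (p$3) * sin (p$4) * v$4, - (sin (p$3) * v$3)] :: real^3"
  have nz: "spatial (polar p) \<noteq> 0"
    using r rad_polar[OF r] by (auto simp: rad_def)
  have A: "open ?A" "p \<in> ?A"
    using r by (auto intro!: open_Collect_less continuous_intros)
  have pol: "polar differentiable (at p)"
    using polar_has_derivative differentiable_def by blast
  have chain: "frechet_derivative f (at (polar p)) (frechet_derivative polar (at p) z) = g' z"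
    if f: "f differentiable (at (polar p))" and g: "(g has_derivative g') (at p)"
      and eq: "\<And>q. q \<in> ?A \<Longrightarrow> f (polar q) = g q" for f :: "real^4 \<Rightarrow> 'b::real_normed_vector" and g g' z
  proof -
    have "((f \<circ> polar) has_derivative (frechet_derivative f (at (polar p)) \<circ> frechet_derivative polar (at p))) (at p)"
      by (rule diff_chain_at) (use f pol frechet_derivative_works in blast)+
    moreover have "((f \<circ> polar) has_derivative g') (at p)"
      by (rule has_derivative_transform_within_open[OF g A]) (simp add: eq)
    ultimately show ?thesis
      using has_derivative_unique by (metis comp_apply)
  qed
  have R: "frechet_derivative rad (at (polar p)) (frechet_derivative polar (at p) z) = z$2" for z
    by (rule chain[OF differentiable_rad[OF nz] vec_nth_has_derivative[OF has_derivative_ident]]) (simp add: rad_polar)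
  have T: "frechet_derivative ret (at (polar p)) (frechet_derivative polar (at p) z) = z$1" for z
    by (rule chain[OF differentiable_ret[OF nz] vec_nth_has_derivative[OF has_derivative_ident]])
       (simp add: ret_def rad_polar, simp add: polar_def vector_def)
  have d\<omega>: "(?\<omega> has_derivative ?\<omega>') (at p)"
    unfolding vector3_eq
    by (auto intro!: derivative_eq_intros simp: algebra_simps fun_eq_iff)
  have W: "frechet_derivative dirn (at (polar p)) (frechet_derivative polar (at p) z) = ?\<omega>' z" for z
    by (rule chain[OF differentiable_dirn[OF nz] d\<omega>]) (simp add: dirn_def rad_polar spatial_polar)
  have ret: "ret (polar p) = p$1"
    by (simp add: ret_def rad_polar[OF r]) (simp add: polar_def vector_def)
  have *: "(a*b*x + c*d*y)*(a*b*x' + c*d*y') + (a*d*x - c*b*y)*(a*d*x' - c*b*y') + c*x*(c*x')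
      = x*x' + c\<^sup>2*y*y'" if "a\<^sup>2 + c\<^sup>2 = 1" "b\<^sup>2 + d\<^sup>2 = 1" for a b c d x x' y y' :: real
    using that by algebra
  have "?\<omega>' v \<bullet> ?\<omega>' w = v$3 * w$3 + (sin (p$3))\<^sup>2 * v$4 * w$4"
    using *[of "cos (p$3)" "sin (p$3)" "sin (p$4)" "cos (p$4)" "v$3" "v$4" "w$3" "w$4"]
    by (simp add: inner_vec_def sum_3)
  then show ?thesis
    by (simp add: ip_vaidya[OF nz] vaidya_form_def R T W rad_polar[OF r] ret)
qed


section \<open>The sphere and the surfaces \<open>\<Sigma>\<^sub>d\<close>\<close>

text \<open>
  Local coordinates \<open>u\<^sup>a\<close> on the unit sphere are given by the inverse chart \<open>P\<close>, whose components
  are the coordinate functions \<open>X\<^sup>i\<close>.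
\<close>

definition sphere_chart :: "(real^2) set \<Rightarrow> (real^2 \<Rightarrow> real^3) \<Rightarrow> bool" where
  "sphere_chart U P \<longleftrightarrow> open U \<and> smooth_on U P \<and> inj_on P U \<and> P ` U \<subseteq> sphere 0 1 \<and>
     (\<forall>u\<in>U. inj (frechet_derivative P (at u)))"

definition round_metric :: "(real^2 \<Rightarrow> real^3) \<Rightarrow> 2 metric" where
  "round_metric P u = (\<chi> a b. pd a P u \<bullet> pd b P u)"

text \<open>
  \<open>e\<close> is the fixed unit vector, \<open>\<Sigma>\<^sub>d\<close> is parametrized by \<open>surf e P d\<close> as a surface in the slice
  \<open>{t = d}\<close>, with coordinates \<open>y\<^sup>i\<close>, and by \<open>Surf e P d\<close> as a surface in the spacetime.
\<close>

definition surf :: "real^3 \<Rightarrow> (real^2 \<Rightarrow> real^3) \<Rightarrow> real \<Rightarrow> real^2 \<Rightarrow> real^3" where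
  "surf e P d u = d *\<^sub>R e + P u"

definition Surf :: "real^3 \<Rightarrow> (real^2 \<Rightarrow> real^3) \<Rightarrow> real \<Rightarrow> real^2 \<Rightarrow> real^4" where
  "Surf e P d u = event d (surf e P d u)"

definition induced :: "(real \<Rightarrow> real) \<Rightarrow> real^3 \<Rightarrow> (real^2 \<Rightarrow> real^3) \<Rightarrow> real \<Rightarrow> 2 metric" where
  "induced M e P d = pullback (vaidya M) (Surf e P d)"

definition slice_metric :: "(real \<Rightarrow> real) \<Rightarrow> real \<Rightarrow> 3 metric" where
  "slice_metric M d = pullback (vaidya M) (event d)"

text \<open>
  The future unit normal of the slices \<open>{t = const}\<close> and the outward unit normal of \<open>\<Sigma>\<^sub>d\<close> in
  \<open>{t = d}\<close>; the vector \<open>P u\<close> points from the Euclidean centre of \<open>\<Sigma>\<^sub>d\<close> to the given point.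
  All definitions from here on are meaningful when \<open>d\<close> is large.
\<close>

definition future_normal :: "(real \<Rightarrow> real) \<Rightarrow> real^4 \<Rightarrow> real^4" where
  "future_normal M x = (THE n. ip (vaidya M) x n n = -1 \<and>
     (\<forall>v. v$1 = 0 \<longrightarrow> ip (vaidya M) x n v = 0) \<and> n$1 > 0)"

definition outward_normal ::
  "(real \<Rightarrow> real) \<Rightarrow> real^3 \<Rightarrow> (real^2 \<Rightarrow> real^3) \<Rightarrow> real \<Rightarrow> real^2 \<Rightarrow> real^3" where
  "outward_normal M e P d u = (THE \<nu>. ip (slice_metric M d) (surf e P d u) \<nu> \<nu> = 1 \<and>
     (\<forall>a. ip (slice_metric M d) (surf e P d u) \<nu> (pd a (surf e P d) u) = 0) \<and> \<nu> \<bullet> P u > 0)"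

text \<open>
  \<open>n_along\<close> and \<open>\<nu>_along\<close> are \<open>n\<close> and \<open>\<nu>\<close> as spacetime vector fields along \<open>\<Sigma>\<^sub>d\<close>;
  \<open>event 0\<close> is the inclusion of vectors tangent to the slice.
\<close>

definition n_along :: "(real \<Rightarrow> real) \<Rightarrow> real^3 \<Rightarrow> (real^2 \<Rightarrow> real^3) \<Rightarrow> real \<Rightarrow> real^2 \<Rightarrow> real^4" where
  "n_along M e P d u = future_normal M (Surf e P d u)"

definition \<nu>_along :: "(real \<Rightarrow> real) \<Rightarrow> real^3 \<Rightarrow> (real^2 \<Rightarrow> real^3) \<Rightarrow> real \<Rightarrow> real^2 \<Rightarrow> real^4" where
  "\<nu>_along M e P d u = event 0 (outward_normal M e P d u)"

definition mean_curv :: "(real \<Rightarrow> real) \<Rightarrow> real^3 \<Rightarrow> (real^2 \<Rightarrow> real^3) \<Rightarrow> real \<Rightarrow> real^2 \<Rightarrow> real" where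
  "mean_curv M e P d = trace_of (induced M e P d) (\<lambda>u. \<chi> a b.
     ip (slice_metric M d) (surf e P d u)
       (cov_along (slice_metric M d) (surf e P d) (outward_normal M e P d) a u) (pd b (surf e P d) u))"

definition tr_k :: "(real \<Rightarrow> real) \<Rightarrow> real^3 \<Rightarrow> (real^2 \<Rightarrow> real^3) \<Rightarrow> real \<Rightarrow> real^2 \<Rightarrow> real" where
  "tr_k M e P d = trace_of (induced M e P d) (\<lambda>u. \<chi> a b.
     ip (vaidya M) (Surf e P d u)
       (cov_along (vaidya M) (Surf e P d) (n_along M e P d) a u) (pd b (Surf e P d) u))"

definition H_vec :: "(real \<Rightarrow> real) \<Rightarrow> real^3 \<Rightarrow> (real^2 \<Rightarrow> real^3) \<Rightarrow> real \<Rightarrow> real^2 \<Rightarrow> real^4" where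
  "H_vec M e P d u =
     - (mean_curv M e P d u *\<^sub>R \<nu>_along M e P d u) + tr_k M e P d u *\<^sub>R n_along M e P d u"

definition J_vec :: "(real \<Rightarrow> real) \<Rightarrow> real^3 \<Rightarrow> (real^2 \<Rightarrow> real^3) \<Rightarrow> real \<Rightarrow> real^2 \<Rightarrow> real^4" where
  "J_vec M e P d u =
     mean_curv M e P d u *\<^sub>R n_along M e P d u - tr_k M e P d u *\<^sub>R \<nu>_along M e P d u"

definition H_norm :: "(real \<Rightarrow> real) \<Rightarrow> real^3 \<Rightarrow> (real^2 \<Rightarrow> real^3) \<Rightarrow> real \<Rightarrow> real^2 \<Rightarrow> real" where
  "H_norm M e P d u = sqrt (ip (vaidya M) (Surf e P d u) (H_vec M e P d u) (H_vec M e P d u))"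

definition alpha_H :: "(real \<Rightarrow> real) \<Rightarrow> real^3 \<Rightarrow> (real^2 \<Rightarrow> real^3) \<Rightarrow> real \<Rightarrow> real^2 \<Rightarrow> real^2" where
  "alpha_H M e P d u = (\<chi> a. ip (vaidya M) (Surf e P d u)
     (cov_along (vaidya M) (Surf e P d) (\<lambda>v. J_vec M e P d v /\<^sub>R H_norm M e P d v) a u)
     (H_vec M e P d u /\<^sub>R H_norm M e P d u))"


section \<open>Expansions as \<open>d \<rightarrow> \<infinity>\<close>\<close>

definition expands :: "(real \<Rightarrow> real) \<Rightarrow> real \<Rightarrow> real \<Rightarrow> bool" where
  "expands f c\<^sub>0 c\<^sub>1 \<longleftrightarrow> (\<lambda>d. f d - (c\<^sub>0 + c\<^sub>1 / d)) \<in> O[at_top](\<lambda>d. 1 / d\<^sup>2)"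

definition sigma_1 :: "(real \<Rightarrow> real) \<Rightarrow> real^3 \<Rightarrow> (real^2 \<Rightarrow> real^3) \<Rightarrow> real^2 \<Rightarrow> real^2^2" where
  "sigma_1 M e P u =
     (\<chi> a b. THE c. expands (\<lambda>d. induced M e P d u $ a $ b) (round_metric P u $ a $ b) c)"

definition alpha_1 :: "(real \<Rightarrow> real) \<Rightarrow> real^3 \<Rightarrow> (real^2 \<Rightarrow> real^3) \<Rightarrow> real^2 \<Rightarrow> real^2" where
  "alpha_1 M e P u = (\<chi> a. THE c. expands (\<lambda>d. alpha_H M e P d u $ a) 0 c)"

end

theory Submission
  imports Defs "HOL-Real_Asymp.Real_Asymp"
begin

text \<open>
  In the coordinates \<open>(t, y)\<close> the Vaidya metric is the Kerr--Schild metric \<open>\<eta> + f l \<otimes> l\<close> with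
  \<open>f = M(u) / r\<close> and \<open>l = dt - dr\<close>, where \<open>l\<close> is null. On \<open>\<Sigma>\<^sub>d\<close> every scalar in sight is a function of
  \<open>Z\<close>, \<open>1 / d\<close> and the differential of \<open>Z\<close> that is regular at \<open>1 / d = 0\<close>, because
  \<open>r = d (1 + 2 Z / d + 1 / d\<^sup>2)\<^sup>1\<^sup>/\<^sup>2\<close>. Since \<open>f\<close> is of order \<open>1 / d\<close>, this gives
  \<open>\<sigma>\<^sup>(\<^sup>-\<^sup>1\<^sup>) = F(Z) dZ \<otimes> dZ\<close> and, to leading order, \<open>k = 1/2 F'(Z) dZ \<otimes> dZ\<close> on \<open>\<Sigma>\<^sub>d\<close>.

  Writing \<open>J / |H|\<close> as a boost of \<open>n\<close> with rapidity \<open>artanh (tr k / h)\<close> gives the exact formula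
  \<open>\<alpha>\<^sub>H = (h d(tr k) - (tr k) dh) / (h\<^sup>2 - (tr k)\<^sup>2) - k(\<cdot>, \<nu>)\<close>, where \<open>h\<close> tends to \<open>2\<close>. Hence \<open>\<alpha>\<^sub>H\<close> has the
  leading coefficient \<open>(1/4 F''(Z) (1 - Z\<^sup>2) - Z F'(Z)) dZ\<close>. On functions of \<open>Z\<close> the operators of the
  sphere are ordinary differential operators, because \<open>|dZ|\<^sup>2 = 1 - Z\<^sup>2\<close> and the Hessian of \<open>Z\<close> is
  \<open>- Z\<close> times the round metric, and both equations become identities between polynomials in \<open>Z\<close>,
  \<open>G(Z)\<close> and the derivatives of \<open>F\<close>.
\<close>

section \<open>Asymptotic expansions\<close>

text \<open>\<open>alpha_H\<close> contains derivatives along the surface of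
  \<open>mean_curv\<close> and \<open>tr_k\<close>, and a pointwise O(1 / d^2) bound says nothing
  about derivatives. Quantities that will be differentiated are therefore expanded together with
  their first coordinate derivatives, and identities between families in d are established on all of
  \<open>U\<close> for the same large d. The bookkeeping stays small because f, k and k(., \<nu>)
  carry an explicit factor 1 / r: whatever multiplies it matters only through its limit. The
  retarded time d - r is a difference of two large numbers and must be rationalized before its limit
  -Z is visible; this is where F(z) = M(-z) comes from. Since u varies by O(1) over \<Sigma>,
  differentiating f along the surface does not lower its order, so k is governed by M' rather than
  by M. The given solutions are less of a guess than they look: (\<Delta> + 2) X^0 turns out to be a
  potential of 2 \<alpha>, and (\<Delta> + 2) Z = 0 removes the undifferentiated G from the equation
  for N.\<close>

lemma expands_cong:
  assumes "expands f a b" "\<forall>\<^sub>F d in at_top. g d = f d" shows "expands g a b"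
proof -
  have "(\<lambda>d. f d - (a + b / d)) \<in> O(\<lambda>d. 1 / d\<^sup>2) \<longleftrightarrow> (\<lambda>d. g d - (a + b / d)) \<in> O(\<lambda>d. 1 / d\<^sup>2)"
    by (rule landau_o.big.in_cong) (use assms(2) in eventually_elim, simp)
  then show ?thesis using assms(1) by (simp add: expands_def)
qed

lemma expands_const: "expands (\<lambda>_. c) c 0"
  by (simp add: expands_def)

lemma expands_inverse_arg: "expands (\<lambda>d. 1 / d) 0 1"
  by (simp add: expands_def)

lemma expands_add:
  assumes "expands f a b" "expands g a' b'" shows "expands (\<lambda>d. f d + g d) (a + a') (b + b')"
proof -
  have "(\<lambda>d. (f d - (a + b / d)) + (g d - (a' + b' / d))) \<in> O(\<lambda>d. 1 / d\<^sup>2)"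
    using assms unfolding expands_def by (rule sum_in_bigo)
  then show ?thesis unfolding expands_def by (simp add: add_divide_distrib algebra_simps)
qed

lemma expands_imp_bigo_1:
  assumes "expands f a b" shows "f \<in> O(\<lambda>_. 1)"
proof -
  have "(\<lambda>d. f d - (a + b / d)) \<in> O(\<lambda>_. 1)"
    using assms unfolding expands_def by (rule landau_o.big_trans) real_asymp
  moreover have "(\<lambda>d. a + b / d) \<in> O(\<lambda>_. 1)" by real_asymp
  ultimately have "(\<lambda>d. (f d - (a + b / d)) + (a + b / d)) \<in> O(\<lambda>_. 1)" by (rule sum_in_bigo)
  then show ?thesis by simp
qed

lemma expands_mult:
  assumes f: "expands f a b" and g: "expands g a' b'"
  shows "expands (\<lambda>d. f d * g d) (a * a') (a * b' + b * a')"
proof -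
  have "(\<lambda>d. (f d - (a + b / d)) * g d) \<in> O(\<lambda>d. 1 / d\<^sup>2 * 1)"
    using f expands_imp_bigo_1[OF g] unfolding expands_def by (rule landau_o.big.mult)
  moreover have "(\<lambda>d. (a + b / d) * (g d - (a' + b' / d))) \<in> O(\<lambda>d. 1 * (1 / d\<^sup>2))"
    using g unfolding expands_def by (intro landau_o.big.mult) real_asymp+
  moreover have "(\<lambda>d::real. b * b' / d\<^sup>2) \<in> O(\<lambda>d. 1 / d\<^sup>2)" by real_asymp
  ultimately have "(\<lambda>d. (f d - (a + b / d)) * g d + (a + b / d) * (g d - (a' + b' / d)) + b * b' / d\<^sup>2)
      \<in> O(\<lambda>d. 1 / d\<^sup>2)"
    by (simp add: sum_in_bigo)
  then show ?thesis unfolding expands_def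
    by (simp add: add_divide_distrib algebra_simps power2_eq_square)
qed

lemma expands_imp_bigo:
  assumes "expands f a b" shows "(\<lambda>d. f d - a) \<in> O(\<lambda>d. 1 / d)"
proof -
  have "(\<lambda>d. f d - (a + b / d)) \<in> O(\<lambda>d. 1 / d)"
    using assms unfolding expands_def by (rule landau_o.big_trans) real_asymp
  moreover have "(\<lambda>d. b / d) \<in> O(\<lambda>d. 1 / d)" by real_asymp
  ultimately have "(\<lambda>d. (f d - (a + b / d)) + b / d) \<in> O(\<lambda>d. 1 / d)" by (rule sum_in_bigo)
  then show ?thesis by simp
qed

lemma expands_tendsto:
  assumes "expands f a b" shows "(f \<longlongrightarrow> a) at_top"
proof -
  have "(\<lambda>d. f d - a) \<in> o(\<lambda>_. 1)"
    using expands_imp_bigo[OF assms] by (rule landau_o.big_small_trans) real_asymp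
  then have "((\<lambda>d. f d - a) \<longlongrightarrow> 0) at_top" using smalloD_tendsto by fastforce
  then show ?thesis by (rule LIM_zero_cancel)
qed

text \<open>Two candidates differ by (b' - b) / d; multiplying by d shows that this can be O(1 /
  d^2) only if it vanishes. It leaves the descriptions in \<open>sigma_1\<close> and
  \<open>alpha_1\<close> at most one candidate.\<close>

lemma expands_unique:
  assumes "expands f a b" "expands f a b'" shows "b = b'"
proof -
  have "(\<lambda>d. (f d - (a + b / d)) - (f d - (a + b' / d))) \<in> O(\<lambda>d. 1 / d\<^sup>2)"
    using assms unfolding expands_def by (rule sum_in_bigo)
  then have "(\<lambda>d. (b' - b) / d) \<in> O(\<lambda>d. 1 / d\<^sup>2)"
    by (simp add: diff_divide_distrib)
  moreover have "(\<lambda>d. d) \<in> O(\<lambda>d::real. d)" by simp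
  ultimately have "(\<lambda>d. (b' - b) / d * d) \<in> O(\<lambda>d. 1 / d\<^sup>2 * d)" by (rule landau_o.big.mult)
  then have "(\<lambda>d. (b' - b) / d * d) \<in> o(\<lambda>_. 1)" by (rule landau_o.big_small_trans) real_asymp
  then have "((\<lambda>d. (b' - b) / d * d) \<longlongrightarrow> 0) at_top" using smalloD_tendsto by fastforce
  moreover have "\<forall>\<^sub>F d::real in at_top. (b' - b) / d * d = b' - b"
    using eventually_gt_at_top[of 0] by eventually_elim simp
  ultimately have "((\<lambda>d::real. b' - b) \<longlongrightarrow> 0) at_top" by (simp add: tendsto_cong)
  then have "b' - b = 0" using tendsto_unique[OF _ tendsto_const] by force
  then show ?thesis by simp
qed

text \<open>The mean value theorem turns the remainder into (x - x0) (g1 y - g1 x0) with y no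
  farther from x0 than x, and differentiability of g1 at the single point x0 bounds the second
  factor linearly. The constant |D| + 1 comes from keeping the difference quotient of g1 within 1 of
  its limit D.\<close>

lemma first_order_remainder_bound:
  fixes g g1 :: "real \<Rightarrow> real"
  assumes S: "open S" "x0 \<in> S" and g: "\<And>x. x \<in> S \<Longrightarrow> (g has_real_derivative g1 x) (at x)"
    and g1: "g1 differentiable (at x0)"
  obtains C r where "r > 0" "\<And>x. \<bar>x - x0\<bar> < r \<Longrightarrow> \<bar>g x - g x0 - g1 x0 * (x - x0)\<bar> \<le> C * (x - x0)\<^sup>2"
proof -
  obtain D where D: "(g1 has_real_derivative D) (at x0)"
    using g1 real_differentiable_def by blast
  have "((\<lambda>y. (g1 y - g1 x0) / (y - x0)) \<longlongrightarrow> D) (at x0)"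
    using D by (simp add: has_field_derivative_iff)
  then have "\<forall>\<^sub>F y in at x0. dist ((g1 y - g1 x0) / (y - x0)) D < 1"
    by (rule tendstoD) simp
  then obtain r1 where r1: "r1 > 0" "\<And>y. y \<noteq> x0 \<Longrightarrow> dist y x0 < r1 \<Longrightarrow> dist ((g1 y - g1 x0) / (y - x0)) D < 1"
    by (auto simp: eventually_at)
  obtain r2 where r2: "r2 > 0" "ball x0 r2 \<subseteq> S" using S by (meson open_contains_ball)
  define r where "r = min r1 r2"
  have g1b: "\<bar>g1 y - g1 x0\<bar> \<le> (\<bar>D\<bar> + 1) * \<bar>y - x0\<bar>" if "\<bar>y - x0\<bar> < r" for y
  proof (cases "y = x0")
    case False
    then have "\<bar>(g1 y - g1 x0) / (y - x0)\<bar> \<le> \<bar>D\<bar> + 1"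
      using r1(2)[of y] that False unfolding r_def dist_real_def by linarith
    then show ?thesis using False by (simp add: abs_divide pos_divide_le_eq)
  qed simp
  show ?thesis
  proof (rule that[of r "\<bar>D\<bar> + 1"])
    show "r > 0" using r1 r2 by (simp add: r_def)
    fix x assume x: "\<bar>x - x0\<bar> < r"
    have "\<exists>y. \<bar>y - x0\<bar> \<le> \<bar>x - x0\<bar> \<and> g x - g x0 = (x - x0) * g1 y"
    proof -
      have inS: "y \<in> S" if "\<bar>y - x0\<bar> \<le> \<bar>x - x0\<bar>" for y
        using that x r2 by (auto simp: r_def dist_real_def subset_iff)
      consider "x < x0" | "x = x0" | "x0 < x" by linarith
      then show ?thesis
      proof cases
        case 1
        obtain y where "x < y" "y < x0" "g x0 - g x = (x0 - x) * g1 y"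
          using MVT2[OF 1, of g g1] g inS 1 by force
        then show ?thesis by (intro exI[of _ y]) (auto simp: algebra_simps)
      next
        case 3
        obtain y where "x0 < y" "y < x" "g x - g x0 = (x - x0) * g1 y"
          using MVT2[OF 3, of g g1] g inS 3 by force
        then show ?thesis by (intro exI[of _ y]) auto
      qed auto
    qed
    then obtain y where y: "\<bar>y - x0\<bar> \<le> \<bar>x - x0\<bar>" "g x - g x0 = (x - x0) * g1 y" by blast
    then have "\<bar>g x - g x0 - g1 x0 * (x - x0)\<bar> = \<bar>x - x0\<bar> * \<bar>g1 y - g1 x0\<bar>"
      by (simp add: abs_mult[symmetric] algebra_simps)
    also have "\<dots> \<le> \<bar>x - x0\<bar> * ((\<bar>D\<bar> + 1) * \<bar>y - x0\<bar>)"
      using g1b[of y] x y by (intro mult_left_mono) auto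
    also have "\<dots> \<le> \<bar>x - x0\<bar> * ((\<bar>D\<bar> + 1) * \<bar>x - x0\<bar>)"
      using y by (intro mult_left_mono) auto
    also have "\<dots> = (\<bar>D\<bar> + 1) * (x - x0)\<^sup>2"
      using abs_mult_self_eq[of "x - x0"] by (simp add: power2_eq_square)
    finally show "\<bar>g x - g x0 - g1 x0 * (x - x0)\<bar> \<le> (\<bar>D\<bar> + 1) * (x - x0)\<^sup>2" .
  qed
qed

text \<open>Linearize g at the limit a: f d - a is O(1 / d), so the quadratic remainder is O(1 /
  d^2) and only the slope at a meets the coefficient b.\<close>

lemma expands_compose:
  fixes g g1 :: "real \<Rightarrow> real"
  assumes f: "expands f a b" and S: "open S" "a \<in> S"
    and g: "\<And>x. x \<in> S \<Longrightarrow> (g has_real_derivative g1 x) (at x)" and g1: "g1 differentiable (at a)"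
  shows "expands (\<lambda>d. g (f d)) (g a) (g1 a * b)"
proof -
  obtain C r where r: "r > 0" "\<And>x. \<bar>x - a\<bar> < r \<Longrightarrow> \<bar>g x - g a - g1 a * (x - a)\<bar> \<le> C * (x - a)\<^sup>2"
    using first_order_remainder_bound[OF S g g1] by blast
  have "\<forall>\<^sub>F d in at_top. \<bar>f d - a\<bar> < r"
    using tendstoD[OF expands_tendsto[OF f] r(1)] by (simp add: dist_real_def)
  then have "\<forall>\<^sub>F d in at_top. norm (g (f d) - g a - g1 a * (f d - a)) \<le> C * norm ((f d - a) * (f d - a))"
    by eventually_elim (use r(2) in \<open>simp add: power2_eq_square\<close>)
  then have "(\<lambda>d. g (f d) - g a - g1 a * (f d - a)) \<in> O(\<lambda>d. (f d - a) * (f d - a))"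
    by (rule bigoI)
  also have "(\<lambda>d. (f d - a) * (f d - a)) \<in> O(\<lambda>d. 1 / d * (1 / d))"
    by (intro landau_o.big.mult expands_imp_bigo[OF f])
  finally have "(\<lambda>d. g (f d) - g a - g1 a * (f d - a)) \<in> O(\<lambda>d. 1 / d\<^sup>2)" by (simp add: power2_eq_square)
  moreover have "(\<lambda>d. g1 a * (f d - (a + b / d))) \<in> O(\<lambda>d. 1 / d\<^sup>2)"
    using f by (cases "g1 a = 0") (simp_all add: expands_def)
  ultimately have "(\<lambda>d. (g (f d) - g a - g1 a * (f d - a)) + g1 a * (f d - (a + b / d))) \<in> O(\<lambda>d. 1 / d\<^sup>2)"
    by (rule sum_in_bigo)
  then show ?thesis unfolding expands_def by (simp add: algebra_simps)
qed

lemma expands_diff: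
  assumes "expands f a b" "expands g a' b'" shows "expands (\<lambda>d. f d - g d) (a - a') (b - b')"
proof -
  have "expands (\<lambda>d. - 1 * g d) (- 1 * a') (- 1 * b' + 0 * a')"
    by (intro expands_mult expands_const assms)
  from expands_add[OF assms(1) this] show ?thesis by simp
qed

lemma expands_inverse:
  assumes "expands f a b" "a \<noteq> 0" shows "expands (\<lambda>d. inverse (f d)) (inverse a) (- (inverse a * inverse a) * b)"
proof (rule expands_compose[OF assms(1), of "- {0}"])
  show "(inverse has_real_derivative - (inverse x * inverse x)) (at x)" if "x \<in> - {0}" for x :: real
    using that DERIV_inverse[of x UNIV] by (simp add: power2_eq_square)
  show "(\<lambda>x. - (inverse x * inverse x)) differentiable (at a)"
    using assms(2) by (intro differentiable_minus differentiable_mult differentiable_inverse differentiable_ident) auto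
qed (use assms in auto)

lemma the_expands: "expands f a b \<Longrightarrow> (THE c. expands f a c) = b"
  using expands_unique by blast

section \<open>Calculus of coordinate derivatives\<close>

lemma pd_eqI:
  assumes "(f has_derivative f') (at u)" shows "pd a f u = f' (axis a 1)"
  using frechet_derivative_at[OF assms] by (simp add: pd_def)

text \<open>Holds for arbitrary functions: near u both have the same candidates for a derivative, so
  the choice operator behind \<open>frechet_derivative\<close> picks the same one.\<close>

lemma pd_cong_open:
  assumes "open S" "u \<in> S" "\<And>v. v \<in> S \<Longrightarrow> f v = g v"
  shows "pd a f u = pd a g u"
proof -
  have "(f has_derivative f') (at u) \<longleftrightarrow> (g has_derivative f') (at u)" for f'
    using has_derivative_transform_within_open[of f f' u UNIV S g]
      has_derivative_transform_within_open[of g f' u UNIV S f] assms by auto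
  then show ?thesis by (simp add: pd_def frechet_derivative_def)
qed

lemma differentiable_cong_open:
  assumes "open S" "u \<in> S" "\<And>v. v \<in> S \<Longrightarrow> f v = g v" "f differentiable (at u)"
  shows "g differentiable (at u)"
proof -
  obtain f' where "(f has_derivative f') (at u)" using assms(4) by (auto simp: differentiable_def)
  then have "(g has_derivative f') (at u)"
    by (rule has_derivative_transform_within_open[OF _ assms(1,2)]) (simp add: assms(3))
  then show ?thesis by (auto simp: differentiable_def)
qed

lemma has_derivative_pd:
  "f differentiable (at u) \<Longrightarrow> (f has_derivative frechet_derivative f (at u)) (at u)"
  by (simp add: frechet_derivative_works)

lemma pd_const: "pd a (\<lambda>v. c) u = 0"
  by (rule pd_eqI[where f'="\<lambda>_. 0"]) simp

lemma pd_add: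
  assumes "f differentiable (at u)" "g differentiable (at u)"
  shows "pd a (\<lambda>v. f v + g v) u = pd a f u + pd a g u"
  using pd_eqI[OF has_derivative_add[OF assms[THEN has_derivative_pd]]] by (simp add: pd_def)

lemma pd_diff:
  assumes "f differentiable (at u)" "g differentiable (at u)"
  shows "pd a (\<lambda>v. f v - g v) u = pd a f u - pd a g u"
  using pd_eqI[OF has_derivative_diff[OF assms[THEN has_derivative_pd]]] by (simp add: pd_def)

lemma pd_mult:
  fixes f g :: "real^'n \<Rightarrow> real"
  assumes "f differentiable (at u)" "g differentiable (at u)"
  shows "pd a (\<lambda>v. f v * g v) u = f u * pd a g u + pd a f u * g u"
  using pd_eqI[OF has_derivative_mult[OF assms[THEN has_derivative_pd]]] by (simp add: pd_def)

lemma pd_inner: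
  fixes f g :: "real^'n \<Rightarrow> 'a::real_inner"
  assumes "f differentiable (at u)" "g differentiable (at u)"
  shows "pd a (\<lambda>v. f v \<bullet> g v) u = f u \<bullet> pd a g u + pd a f u \<bullet> g u"
  using pd_eqI[OF has_derivative_inner[OF assms[THEN has_derivative_pd]]] by (simp add: pd_def)

lemma pd_linear:
  assumes "bounded_linear L" "f differentiable (at u)"
  shows "pd a (\<lambda>v. L (f v)) u = L (pd a f u)"
  using pd_eqI[OF bounded_linear.has_derivative[OF assms(1) has_derivative_pd[OF assms(2)]]]
  by (simp add: pd_def)

lemma differentiable_linear:
  assumes "bounded_linear L" "f differentiable (at u)"
  shows "(\<lambda>v. L (f v)) differentiable (at u)"
  using bounded_linear.has_derivative[OF assms(1) has_derivative_pd[OF assms(2)]] differentiableI by blast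

lemma has_derivative_real_compose:
  fixes f :: "'a::real_normed_vector \<Rightarrow> real"
  assumes "(g has_real_derivative g') (at (f u))" "f differentiable (at u)"
  shows "((\<lambda>v. g (f v)) has_derivative (\<lambda>h. g' * frechet_derivative f (at u) h)) (at u)"
  using diff_chain_at[OF has_derivative_pd[OF assms(2)] assms(1)[unfolded has_field_derivative_def]]
  by (simp add: o_def)

lemma pd_real_compose:
  assumes "(g has_real_derivative g') (at (f u))" "f differentiable (at u)"
  shows "pd a (\<lambda>v. g (f v)) u = g' * pd a f u"
  using pd_eqI[OF has_derivative_real_compose[OF assms]] by (simp add: pd_def)

lemma differentiable_real_compose:
  fixes f :: "'a::real_normed_vector \<Rightarrow> real"
  assumes "(g has_real_derivative g') (at (f u))" "f differentiable (at u)"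
  shows "(\<lambda>v. g (f v)) differentiable (at u)"
  using has_derivative_real_compose[OF assms] differentiableI by blast

lemma differentiable_sqrt:
  fixes A :: "'a::real_normed_vector \<Rightarrow> real"
  assumes "A u > 0" "A differentiable (at u)"
  shows "(\<lambda>v. sqrt (A v)) differentiable (at u)"
  using differentiable_real_compose[of sqrt "inverse (sqrt (A u)) / 2" A u] DERIV_real_sqrt assms by blast

text \<open>A first-order expansion in \<open>1 / d\<close> of \<open>A d\<close> at \<open>u\<close> that may be differentiated once in \<open>u\<close>.
  The coefficients are functions of the point because their derivatives enter.\<close>

definition jet :: "real^'n \<Rightarrow> (real \<Rightarrow> real^'n \<Rightarrow> real) \<Rightarrow> (real^'n \<Rightarrow> real) \<Rightarrow> (real^'n \<Rightarrow> real) \<Rightarrow> bool" where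
  "jet u A a b \<longleftrightarrow> (\<forall>\<^sub>F d in at_top. A d differentiable (at u)) \<and>
     a differentiable (at u) \<and> b differentiable (at u) \<and> expands (\<lambda>d. A d u) (a u) (b u) \<and>
     (\<forall>i. expands (\<lambda>d. pd i (A d) u) (pd i a u) (pd i b u))"

lemma jet_const: "a differentiable (at u) \<Longrightarrow> jet u (\<lambda>_. a) a (\<lambda>_. 0)"
  by (simp add: jet_def expands_const pd_const)

lemma jet_inverse_arg: "jet u (\<lambda>d _. 1 / d) (\<lambda>_. 0) (\<lambda>_. 1)"
  by (simp add: jet_def expands_const expands_inverse_arg pd_const)

lemma jet_add:
  assumes "jet u A a b" "jet u A' a' b'"
  shows "jet u (\<lambda>d v. A d v + A' d v) (\<lambda>v. a v + a' v) (\<lambda>v. b v + b' v)"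
proof -
  have d: "\<forall>\<^sub>F d in at_top. A d differentiable (at u) \<and> A' d differentiable (at u)"
    using assms by (simp add: jet_def eventually_conj)
  have "expands (\<lambda>d. pd i (\<lambda>v. A d v + A' d v) u) (pd i a u + pd i a' u) (pd i b u + pd i b' u)" for i
  proof (rule expands_cong)
    show "expands (\<lambda>d. pd i (A d) u + pd i (A' d) u) (pd i a u + pd i a' u) (pd i b u + pd i b' u)"
      using assms by (simp add: jet_def expands_add)
    show "\<forall>\<^sub>F d in at_top. pd i (\<lambda>v. A d v + A' d v) u = pd i (A d) u + pd i (A' d) u"
      using d by eventually_elim (simp add: pd_add)
  qed
  moreover have "\<forall>\<^sub>F d in at_top. (\<lambda>v. A d v + A' d v) differentiable (at u)"
    using d by eventually_elim simp
  ultimately show ?thesis using assms by (simp add: jet_def pd_add expands_add)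
qed

lemma jet_mult:
  assumes "jet u A a b" "jet u A' a' b'"
  shows "jet u (\<lambda>d v. A d v * A' d v) (\<lambda>v. a v * a' v) (\<lambda>v. a v * b' v + b v * a' v)"
proof -
  have d: "\<forall>\<^sub>F d in at_top. A d differentiable (at u) \<and> A' d differentiable (at u)"
    using assms by (simp add: jet_def eventually_conj)
  have "expands (\<lambda>d. pd i (\<lambda>v. A d v * A' d v) u) (pd i (\<lambda>v. a v * a' v) u) (pd i (\<lambda>v. a v * b' v + b v * a' v) u)" for i
  proof (rule expands_cong)
    have "expands (\<lambda>d. A d u * pd i (A' d) u + pd i (A d) u * A' d u)
        (a u * pd i a' u + pd i a u * a' u) ((a u * pd i b' u + b u * pd i a' u) + (pd i a u * b' u + pd i b u * a' u))"
      using assms by (intro expands_add expands_mult) (auto simp: jet_def)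
    then show "expands (\<lambda>d. A d u * pd i (A' d) u + pd i (A d) u * A' d u)
      (pd i (\<lambda>v. a v * a' v) u) (pd i (\<lambda>v. a v * b' v + b v * a' v) u)"
      using assms by (simp add: jet_def pd_add pd_mult algebra_simps)
    show "\<forall>\<^sub>F d in at_top. pd i (\<lambda>v. A d v * A' d v) u = A d u * pd i (A' d) u + pd i (A d) u * A' d u"
      using d by eventually_elim (simp add: pd_mult)
  qed
  moreover have "\<forall>\<^sub>F d in at_top. (\<lambda>v. A d v * A' d v) differentiable (at u)"
    using d by eventually_elim simp
  ultimately show ?thesis using assms by (simp add: jet_def expands_mult)
qed

text \<open>The threshold for d must be uniform over a neighbourhood of u: derivatives are compared
  at a fixed d, and equality at each point from some d on, with a threshold depending on the point,
  would not determine them.\<close>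

lemma jet_cong:
  assumes "jet u A a b" "open S" "u \<in> S"
    "\<forall>\<^sub>F d in at_top. \<forall>v\<in>S. A' d v = A d v" "\<And>v. v \<in> S \<Longrightarrow> a' v = a v" "\<And>v. v \<in> S \<Longrightarrow> b' v = b v"
  shows "jet u A' a' b'"
proof -
  have eq: "\<forall>\<^sub>F d in at_top. pd i (A' d) u = pd i (A d) u" for i
    using assms(4)
  proof eventually_elim
    case (elim d)
    show ?case by (rule pd_cong_open[OF assms(2,3)]) (rule bspec[OF elim])
  qed
  have eq': "\<forall>\<^sub>F d in at_top. A' d u = A d u"
    using assms(4)
  proof eventually_elim
    case (elim d)
    show ?case by (rule bspec[OF elim assms(3)])
  qed
  have "\<forall>\<^sub>F d in at_top. A d differentiable (at u)" using assms(1) by (simp only: jet_def)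
  then have 1: "\<forall>\<^sub>F d in at_top. A' d differentiable (at u)"
    using assms(4)
  proof eventually_elim
    case (elim d)
    show ?case
      by (rule differentiable_cong_open[OF assms(2,3) bspec[OF elim(2), symmetric] elim(1)])
  qed
  have 2: "a' differentiable (at u)"
    by (rule differentiable_cong_open[OF assms(2,3) assms(5)[symmetric]]) (use assms(1) in \<open>simp_all add: jet_def\<close>)
  have b2: "b' differentiable (at u)"
    by (rule differentiable_cong_open[OF assms(2,3) assms(6)[symmetric]]) (use assms(1) in \<open>simp_all add: jet_def\<close>)
  have 3: "pd i a' u = pd i a u" for i by (rule pd_cong_open[OF assms(2,3) assms(5)])
  have b3: "pd i b' u = pd i b u" for i by (rule pd_cong_open[OF assms(2,3) assms(6)])
  have 4: "expands (\<lambda>d. pd i (A' d) u) (pd i a u) (pd i b u)" for i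
    by (rule expands_cong[OF _ eq]) (use assms(1) in \<open>simp add: jet_def\<close>)
  have 5: "expands (\<lambda>d. A' d u) (a u) (b u)"
    by (rule expands_cong[OF _ eq']) (use assms(1) in \<open>simp add: jet_def\<close>)
  show ?thesis unfolding jet_def 3 b3 assms(5)[OF assms(3)] assms(6)[OF assms(3)]
    by (intro conjI allI 1 2 b2 4 5)
qed

text \<open>Needs one derivative more than \<open>expands_compose\<close>, because the chain rule
  produces \<open>g1 (A d u)\<close>, which must itself be expanded to first order.\<close>

lemma jet_compose:
  fixes g g1 g2 :: "real \<Rightarrow> real"
  assumes A: "jet u A a b" and S: "open S" "a u \<in> S"
    and g: "\<And>x. x \<in> S \<Longrightarrow> (g has_real_derivative g1 x) (at x)"
    and g1: "\<And>x. x \<in> S \<Longrightarrow> (g1 has_real_derivative g2 x) (at x)"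
    and g2: "g2 differentiable (at (a u))"
  shows "jet u (\<lambda>d v. g (A d v)) (\<lambda>v. g (a v)) (\<lambda>v. g1 (a v) * b v)"
proof -
  have lim: "((\<lambda>d. A d u) \<longlongrightarrow> a u) at_top" using A by (auto simp: jet_def intro: expands_tendsto)
  have d: "\<forall>\<^sub>F d in at_top. A d differentiable (at u) \<and> A d u \<in> S"
    using A topological_tendstoD[OF lim S] by (simp add: jet_def eventually_conj)
  have da: "a differentiable (at u)" "b differentiable (at u)" using A by (auto simp: jet_def)
  note dga = differentiable_real_compose[of g "g1 (a u)" a u, OF g[OF S(2)] da(1)]
  note dg1a = differentiable_real_compose[of g1 "g2 (a u)" a u, OF g1[OF S(2)] da(1)]
  have g1d: "g1 differentiable (at (a u))" using g1[OF S(2)] real_differentiable_def by blast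
  have "expands (\<lambda>d. pd i (\<lambda>v. g (A d v)) u) (pd i (\<lambda>v. g (a v)) u) (pd i (\<lambda>v. g1 (a v) * b v) u)" for i
  proof (rule expands_cong)
    have "expands (\<lambda>d. g1 (A d u) * pd i (A d) u) (g1 (a u) * pd i a u)
       (g1 (a u) * pd i b u + (g2 (a u) * b u) * pd i a u)"
      using A by (intro expands_mult expands_compose[OF _ S g1 g2]) (auto simp: jet_def)
    then show "expands (\<lambda>d. g1 (A d u) * pd i (A d) u) (pd i (\<lambda>v. g (a v)) u) (pd i (\<lambda>v. g1 (a v) * b v) u)"
      unfolding pd_mult[OF dg1a da(2)] pd_real_compose[of g "g1 (a u)" a u, OF g[OF S(2)] da(1)]
        pd_real_compose[of g1 "g2 (a u)" a u, OF g1[OF S(2)] da(1)]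
      by (simp add: mult.commute mult.left_commute)
    show "\<forall>\<^sub>F d in at_top. pd i (\<lambda>v. g (A d v)) u = g1 (A d u) * pd i (A d) u"
      using d by eventually_elim (use g in \<open>auto intro: pd_real_compose[where g=g]\<close>)
  qed
  moreover have "\<forall>\<^sub>F d in at_top. (\<lambda>v. g (A d v)) differentiable (at u)"
    using d by eventually_elim (use g in \<open>auto intro: differentiable_real_compose[where g=g]\<close>)
  moreover have "expands (\<lambda>d. g (A d u)) (g (a u)) (g1 (a u) * b u)"
    using A by (intro expands_compose[OF _ S g g1d]) (auto simp: jet_def)
  ultimately show ?thesis using dga differentiable_mult[OF dg1a da(2)] by (simp add: jet_def)
qed

lemma jet_inverse:
  assumes "jet u A a b" "a u \<noteq> 0"
  shows "jet u (\<lambda>d v. inverse (A d v)) (\<lambda>v. inverse (a v)) (\<lambda>v. - (inverse (a v) * inverse (a v)) * b v)"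
proof (rule jet_compose[OF assms(1), of "- {0}"])
  show "(inverse has_real_derivative - (inverse x * inverse x)) (at x)" if "x \<in> - {0}" for x :: real
    using that DERIV_inverse[of x UNIV] by (simp add: power2_eq_square)
  show "((\<lambda>x. - (inverse x * inverse x)) has_real_derivative 2 * inverse x * (inverse x * inverse x)) (at x)" if "x \<in> - {0}" for x :: real
    using that by (auto intro!: derivative_eq_intros simp: power2_eq_square)
  show "(\<lambda>x. 2 * inverse x * (inverse x * inverse x)) differentiable (at (a u))"
    using assms(2) by (auto intro!: derivative_intros differentiable_inverse differentiable_mult)
qed (use assms in auto)

lemma jet_sqrt:
  assumes "jet u A a b" "a u > 0"
  shows "jet u (\<lambda>d v. sqrt (A d v)) (\<lambda>v. sqrt (a v)) (\<lambda>v. inverse (2 * sqrt (a v)) * b v)"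
proof (rule jet_compose[OF assms(1), of "{0<..}"])
  show "(sqrt has_real_derivative inverse (2 * sqrt x)) (at x)" if "x \<in> {0<..}" for x :: real
    using that by (auto intro!: derivative_eq_intros simp: field_simps)
  show "((\<lambda>x. inverse (2 * sqrt x)) has_real_derivative - (inverse (4 * (sqrt x * sqrt x * sqrt x)))) (at x)" if "x \<in> {0<..}" for x :: real
    using that by (auto intro!: derivative_eq_intros simp: field_simps power2_eq_square)
  have "sqrt differentiable (at (a u))"
    using assms(2) DERIV_real_sqrt real_differentiable_def by blast
  then have "(\<lambda>x. - (inverse (4 * (sqrt x * sqrt x * sqrt x)))) differentiable (at (a u))"
    by (intro differentiable_minus differentiable_inverse differentiable_mult differentiable_const)
       (use assms in auto)
  then show "(\<lambda>x. - (inverse (4 * (sqrt x * sqrt x * sqrt x)))) differentiable (at (a u))" .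
qed (use assms in auto)

text \<open>Forgets the value of the 1 / d coefficient but keeps its existence, which still controls
  the remainder in products.\<close>

definition jet0 :: "real^'n \<Rightarrow> (real \<Rightarrow> real^'n \<Rightarrow> real) \<Rightarrow> (real^'n \<Rightarrow> real) \<Rightarrow> bool" where
  "jet0 u A a \<longleftrightarrow> (\<exists>b. jet u A a b)"

lemma jet0_add: "jet0 u A a \<Longrightarrow> jet0 u A' a' \<Longrightarrow> jet0 u (\<lambda>d v. A d v + A' d v) (\<lambda>v. a v + a' v)"
  unfolding jet0_def by (elim exE, rule exI, erule (1) jet_add)

lemma jet0_mult: "jet0 u A a \<Longrightarrow> jet0 u A' a' \<Longrightarrow> jet0 u (\<lambda>d v. A d v * A' d v) (\<lambda>v. a v * a' v)"
  unfolding jet0_def by (elim exE, rule exI, erule (1) jet_mult)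

lemma jet0_const: "a differentiable (at u) \<Longrightarrow> jet0 u (\<lambda>_. a) a"
  unfolding jet0_def by (rule exI, erule jet_const)

lemma jet0_uminus: "jet0 u A a \<Longrightarrow> jet0 u (\<lambda>d v. - A d v) (\<lambda>v. - a v)"
  using jet0_mult[OF jet0_const[of "\<lambda>_. -1" u], of A a] by simp

lemma jet0_diff: "jet0 u A a \<Longrightarrow> jet0 u A' a' \<Longrightarrow> jet0 u (\<lambda>d v. A d v - A' d v) (\<lambda>v. a v - a' v)"
  using jet0_add[OF _ jet0_uminus, of u A a A' a'] by simp

lemma jet0_inverse: "jet0 u A a \<Longrightarrow> a u \<noteq> 0 \<Longrightarrow> jet0 u (\<lambda>d v. inverse (A d v)) (\<lambda>v. inverse (a v))"
  unfolding jet0_def by (elim exE, rule exI, erule (1) jet_inverse)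

lemma jet0_divide: "jet0 u A a \<Longrightarrow> jet0 u B b \<Longrightarrow> b u \<noteq> 0 \<Longrightarrow> jet0 u (\<lambda>d v. A d v / B d v) (\<lambda>v. a v / b v)"
  using jet0_mult[OF _ jet0_inverse, of u A a B b] by (simp add: divide_inverse)

lemma jet0_sqrt: "jet0 u A a \<Longrightarrow> a u > 0 \<Longrightarrow> jet0 u (\<lambda>d v. sqrt (A d v)) (\<lambda>v. sqrt (a v))"
  unfolding jet0_def by (elim exE, rule exI, erule (1) jet_sqrt)

lemma jet0_inverse_arg: "jet0 u (\<lambda>d _. 1 / d) (\<lambda>_. 0)"
  unfolding jet0_def by (rule exI, rule jet_inverse_arg)

text \<open>If one factor has no constant term, the 1 / d coefficient of the other enters the
  product only at order 1 / d^2. The leading coefficients of \<open>f\<close>, \<open>tr_k\<close>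
  and \<open>kap\<close> are found this way from limits alone.\<close>

lemma jet_mult_small: "jet u A (\<lambda>_. 0) b \<Longrightarrow> jet0 u A' a' \<Longrightarrow> jet u (\<lambda>d v. A d v * A' d v) (\<lambda>_. 0) (\<lambda>v. b v * a' v)"
  unfolding jet0_def by (elim exE, drule (1) jet_mult) simp

lemma jet_imp_jet0: "jet u A a b \<Longrightarrow> jet0 u A a"
  unfolding jet0_def by (rule exI)

lemma jet0_cong:
  assumes "jet0 u A a" "open S" "u \<in> S"
    "\<forall>\<^sub>F d in at_top. \<forall>v\<in>S. A' d v = A d v" "\<And>v. v \<in> S \<Longrightarrow> a' v = a v"
  shows "jet0 u A' a'"
proof -
  obtain b where "jet u A a b" using assms(1) by (auto simp: jet0_def)
  then have "jet u A' a' b" by (rule jet_cong[OF _ assms(2-5) refl])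
  then show ?thesis by (auto simp: jet0_def)
qed

lemma jet0_compose:
  fixes g g1 g2 :: "real \<Rightarrow> real"
  assumes "jet0 u A a" "open S" "a u \<in> S"
    "\<And>x. x \<in> S \<Longrightarrow> (g has_real_derivative g1 x) (at x)"
    "\<And>x. x \<in> S \<Longrightarrow> (g1 has_real_derivative g2 x) (at x)"
    "g2 differentiable (at (a u))"
  shows "jet0 u (\<lambda>d v. g (A d v)) (\<lambda>v. g (a v))"
proof -
  obtain b where "jet u A a b" using assms(1) by (auto simp: jet0_def)
  then show ?thesis unfolding jet0_def
    by (intro exI, rule jet_compose[where S=S and g=g and ?g1.0=g1 and ?g2.0=g2]) (use assms in auto)
qed

text \<open>The rules for jets produce limits as literal substitution instances such as
  \<open>sqrt (1 + 2 * 0 * Z v + 0 * 0)\<close>; this lets them be simplified afterwards.\<close>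

lemma jet0_eq: "jet0 u A a \<Longrightarrow> (\<And>v. a v = a' v) \<Longrightarrow> jet0 u A a'"
  using ext[of a a'] by simp

section \<open>Metrics in coordinates\<close>

lemma ip_sum: "ip g x v w = (\<Sum>i\<in>UNIV. \<Sum>j\<in>UNIV. v $ i * w $ j * g x $ i $ j)"
  by (simp add: ip_def inner_vec_def matrix_vector_mult_def sum_distrib_left mult_ac)

lemma ip_axis: "ip g x (axis i 1) (axis j 1) = g x $ i $ j"
  by (simp add: ip_def inner_axis' matrix_vector_mult_basis column_def)

lemma ip_add_left: "ip g x (v + v') w = ip g x v w + ip g x v' w"
  and ip_add_right: "ip g x v (w + w') = ip g x v w + ip g x v w'"
  and ip_scale_left: "ip g x (c *\<^sub>R v) w = c * ip g x v w"
  and ip_scale_right: "ip g x v (c *\<^sub>R w) = c * ip g x v w"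
  and ip_minus_left: "ip g x (- v) w = - ip g x v w"
  and ip_minus_right: "ip g x v (- w) = - ip g x v w"
  and ip_diff_left: "ip g x (v - v') w = ip g x v w - ip g x v' w"
  and ip_diff_right: "ip g x v (w - w') = ip g x v w - ip g x v w'"
proof -
  interpret bounded_bilinear "ip g x"
    unfolding ip_def
    by (intro bounded_bilinear.comp[OF bounded_bilinear_inner] bounded_linear_ident matrix_vector_mul_bounded_linear)
  show "ip g x (v + v') w = ip g x v w + ip g x v' w" "ip g x v (w + w') = ip g x v w + ip g x v w'"
    "ip g x (c *\<^sub>R v) w = c * ip g x v w" "ip g x v (c *\<^sub>R w) = c * ip g x v w"
    "ip g x (- v) w = - ip g x v w" "ip g x v (- w) = - ip g x v w"
    "ip g x (v - v') w = ip g x v w - ip g x v' w" "ip g x v (w - w') = ip g x v w - ip g x v w'"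
    by (simp_all add: add_left add_right scaleR_left scaleR_right minus_left minus_right diff_left diff_right)
qed

lemmas ip_linear = ip_add_left ip_add_right ip_scale_left ip_scale_right ip_minus_left ip_minus_right
  ip_diff_left ip_diff_right

lemma invertible_of_nondegenerate:
  fixes g :: "'n::finite metric"
  assumes "\<And>v. (\<And>w. ip g x w v = 0) \<Longrightarrow> v = 0"
  shows "invertible (g x)"
proof -
  have "g x *v v = 0 \<Longrightarrow> v = 0" for v
    by (rule assms) (simp add: ip_def)
  then have "\<exists>B. B ** g x = mat 1" by (simp add: matrix_left_invertible_ker)
  then show ?thesis using invertible_left_inverse by blast
qed

lemma matrix_inv_inv:
  fixes A :: "real^'n^'n"
  assumes "invertible A" shows "A ** matrix_inv A = mat 1" "matrix_inv A ** A = mat 1"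
  using assms unfolding invertible_def matrix_inv_def
  by (metis (mono_tags, lifting) someI_ex)+

text \<open>The first derivative of a metric as a form \<open>dg C A B\<close>: the derivative in
  direction C of the product of the constant vectors A and B. It takes the place of the Christoffel
  symbols, so that the inverse metric has to exist but never has to be computed.\<close>

locale metric_derivative =
  fixes g :: "'n::finite metric" and x :: "real^'n" and dg :: "real^'n \<Rightarrow> real^'n \<Rightarrow> real^'n \<Rightarrow> real"
  assumes has_deriv: "\<And>A B. ((\<lambda>y. ip g y A B) has_derivative (\<lambda>C. dg C A B)) (at x)"
    and dg_sym: "\<And>A B C. dg C A B = dg C B A"
    and ip_sym: "\<And>A B. ip g x A B = ip g x B A"
    and inv: "invertible (g x)"
begin

lemma entry_deriv: "((\<lambda>y. g y $ i $ j) has_derivative (\<lambda>C. dg C (axis i 1) (axis j 1))) (at x)"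
  using has_deriv[of "axis i 1" "axis j 1"] by (simp add: ip_axis)

lemma pd_entry: "pd k (\<lambda>y. g y $ i $ j) x = dg (axis k 1) (axis i 1) (axis j 1)"
  by (rule pd_eqI[OF entry_deriv])

text \<open>Bilinearity of dg in A and B comes from uniqueness of the derivative, the metric itself
  being bilinear.\<close>

lemma dg_sum2: "dg C A B = (\<Sum>i\<in>UNIV. \<Sum>j\<in>UNIV. A $ i * B $ j * dg C (axis i 1) (axis j 1))"
proof -
  have "((\<lambda>y. ip g y A B) has_derivative
    (\<lambda>C. \<Sum>i\<in>UNIV. \<Sum>j\<in>UNIV. A $ i * B $ j * dg C (axis i 1) (axis j 1))) (at x)"
    unfolding ip_sum by (intro has_derivative_sum has_derivative_mult_right entry_deriv)
  from has_derivative_unique[OF has_deriv this] show ?thesis by (rule fun_cong)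
qed

lemma dg_sum1: "dg C A B = (\<Sum>k\<in>UNIV. C $ k * dg (axis k 1) A B)"
proof -
  interpret bounded_linear "\<lambda>C. dg C A B" using has_deriv by (rule has_derivative_bounded_linear)
  have "dg C A B = dg (\<Sum>k\<in>UNIV. C $ k *\<^sub>R axis k 1) A B"
    using basis_expansion[of C] by (simp add: scalar_mult_eq_scaleR)
  then show ?thesis by (simp add: sum scaleR)
qed

lemma dg_sum: "dg C A B = (\<Sum>k\<in>UNIV. \<Sum>i\<in>UNIV. \<Sum>j\<in>UNIV. C $ k * A $ i * B $ j * dg (axis k 1) (axis i 1) (axis j 1))"
  by (subst dg_sum1, subst dg_sum2) (simp add: sum_distrib_left mult_ac)

text \<open>The Koszul formula for a field along a map. Pairing with V lowers the free index, and
  the metric cancels the inverse metric inside the Christoffel symbols.\<close>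

lemma ip_cov_along:
  fixes f W :: "real^'m::finite \<Rightarrow> real^'n"
  assumes x: "x = f u" and W: "W differentiable (at u)"
  shows "ip g (f u) V (cov_along g f W a u) = ip g (f u) V (pd a W u)
    + 1/2 * (dg (pd a f u) (W u) V + dg (W u) (pd a f u) V - dg V (pd a f u) (W u))"
proof -
  define A B where "A = pd a f u" and "B = W u"
  \<comment> \<open>The connection term with its index lowered, as a vector of components.\<close>
  define c :: "real^'n" where "c = (\<chi> l. 1/2 * (\<Sum>i\<in>UNIV. \<Sum>j\<in>UNIV. (dg (axis i 1) (axis j 1) (axis l 1)
     + dg (axis j 1) (axis i 1) (axis l 1) - dg (axis l 1) (axis i 1) (axis j 1)) * A $ i * B $ j))"
  have chr: "christoffel g k i j x = 1/2 * (\<Sum>l\<in>UNIV. matrix_inv (g x) $ k $ l * (dg (axis i 1) (axis j 1) (axis l 1)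
     + dg (axis j 1) (axis i 1) (axis l 1) - dg (axis l 1) (axis i 1) (axis j 1)))" for k i j
    by (simp add: christoffel_def pd_entry)
  have "(\<Sum>i\<in>UNIV. \<Sum>j\<in>UNIV. christoffel g k i j x * A $ i * B $ j) = (matrix_inv (g x) *v c) $ k" for k
  proof -
    have "(\<Sum>i\<in>UNIV. \<Sum>j\<in>UNIV. christoffel g k i j x * A $ i * B $ j) =
      (\<Sum>i\<in>UNIV. \<Sum>j\<in>UNIV. \<Sum>l\<in>UNIV. matrix_inv (g x) $ k $ l * (1/2 * ((dg (axis i 1) (axis j 1) (axis l 1)
     + dg (axis j 1) (axis i 1) (axis l 1) - dg (axis l 1) (axis i 1) (axis j 1)) * A $ i * B $ j)))"
      unfolding chr by (simp add: sum_distrib_left sum_distrib_right mult_ac)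
    also have "\<dots> = (\<Sum>i\<in>UNIV. \<Sum>l\<in>UNIV. \<Sum>j\<in>UNIV. matrix_inv (g x) $ k $ l * (1/2 * ((dg (axis i 1) (axis j 1) (axis l 1)
     + dg (axis j 1) (axis i 1) (axis l 1) - dg (axis l 1) (axis i 1) (axis j 1)) * A $ i * B $ j)))"
      by (intro sum.cong[OF refl] sum.swap)
    also have "\<dots> = (\<Sum>l\<in>UNIV. \<Sum>i\<in>UNIV. \<Sum>j\<in>UNIV. matrix_inv (g x) $ k $ l * (1/2 * ((dg (axis i 1) (axis j 1) (axis l 1)
     + dg (axis j 1) (axis i 1) (axis l 1) - dg (axis l 1) (axis i 1) (axis j 1)) * A $ i * B $ j)))"
      by (rule sum.swap)
    also have "\<dots> = (matrix_inv (g x) *v c) $ k"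
      by (simp add: matrix_vector_mult_def c_def sum_distrib_left)
    finally show ?thesis .
  qed
  moreover have "pd a (\<lambda>v. W v $ k) u = pd a W u $ k" for k
    by (rule pd_linear[OF bounded_linear_vec_nth W])
  ultimately have "cov_along g f W a u = pd a W u + matrix_inv (g x) *v c"
    by (simp add: cov_along_def vec_eq_iff A_def B_def x)
  moreover have "ip g x V (matrix_inv (g x) *v c) = V \<bullet> c"
    by (simp add: ip_def matrix_vector_mul_assoc matrix_inv_inv[OF inv])
  moreover have "V \<bullet> c = 1/2 * (dg A B V + dg B A V - dg V A B)"
  proof -
    let ?D = "\<lambda>k i j. dg (axis k 1) (axis i 1) (axis j 1)"
    have 1: "dg A B V = (\<Sum>l\<in>UNIV. \<Sum>i\<in>UNIV. \<Sum>j\<in>UNIV. A $ i * B $ j * V $ l * ?D i j l)"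
    proof -
      have "dg A B V = (\<Sum>i\<in>UNIV. \<Sum>l\<in>UNIV. \<Sum>j\<in>UNIV. A $ i * B $ j * V $ l * ?D i j l)"
        unfolding dg_sum[of A B V] by (intro sum.cong[OF refl] sum.swap)
      also have "\<dots> = (\<Sum>l\<in>UNIV. \<Sum>i\<in>UNIV. \<Sum>j\<in>UNIV. A $ i * B $ j * V $ l * ?D i j l)" by (rule sum.swap)
      finally show ?thesis .
    qed
    have 2: "dg B A V = (\<Sum>l\<in>UNIV. \<Sum>i\<in>UNIV. \<Sum>j\<in>UNIV. A $ i * B $ j * V $ l * ?D j i l)"
    proof -
      have "dg B A V = (\<Sum>j\<in>UNIV. \<Sum>i\<in>UNIV. \<Sum>l\<in>UNIV. A $ i * B $ j * V $ l * ?D j i l)"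
        unfolding dg_sum[of B A V] by (simp add: mult_ac)
      also have "\<dots> = (\<Sum>i\<in>UNIV. \<Sum>j\<in>UNIV. \<Sum>l\<in>UNIV. A $ i * B $ j * V $ l * ?D j i l)" by (rule sum.swap)
      also have "\<dots> = (\<Sum>i\<in>UNIV. \<Sum>l\<in>UNIV. \<Sum>j\<in>UNIV. A $ i * B $ j * V $ l * ?D j i l)"
        by (intro sum.cong[OF refl] sum.swap)
      also have "\<dots> = (\<Sum>l\<in>UNIV. \<Sum>i\<in>UNIV. \<Sum>j\<in>UNIV. A $ i * B $ j * V $ l * ?D j i l)" by (rule sum.swap)
      finally show ?thesis .
    qed
    have 3: "dg V A B = (\<Sum>l\<in>UNIV. \<Sum>i\<in>UNIV. \<Sum>j\<in>UNIV. A $ i * B $ j * V $ l * ?D l i j)"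
      unfolding dg_sum[of V A B] by (simp add: mult_ac)
    have "V \<bullet> c = (\<Sum>l\<in>UNIV. \<Sum>i\<in>UNIV. \<Sum>j\<in>UNIV. 1/2 * (A $ i * B $ j * V $ l * ?D i j l
      + A $ i * B $ j * V $ l * ?D j i l - A $ i * B $ j * V $ l * ?D l i j))"
      by (simp add: inner_vec_def c_def sum_distrib_left algebra_simps)
    also have "\<dots> = 1/2 * (dg A B V + dg B A V - dg V A B)"
      unfolding 1 2 3 by (simp only: sum_distrib_left[symmetric] sum.distrib sum_subtractf)
    finally show ?thesis .
  qed
  ultimately show ?thesis by (simp add: ip_add_right A_def B_def x)
qed

lemma has_derivative_ip_along:
  fixes f V W :: "real^'m::finite \<Rightarrow> real^'n"
  assumes x: "x = f u" and f: "(f has_derivative f') (at u)"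
    and V: "(V has_derivative V') (at u)" and W: "(W has_derivative W') (at u)"
  shows "((\<lambda>v. ip g (f v) (V v) (W v)) has_derivative
     (\<lambda>h. ip g x (V' h) (W u) + ip g x (V u) (W' h) + dg (f' h) (V u) (W u))) (at u)"
proof -
  have nth: "((\<lambda>v. F v $ i) has_derivative (\<lambda>h. F' h $ i)) (at u)"
    if "(F has_derivative F') (at u)" for F F' i
    using that by (rule vec_nth_has_derivative)
  have gf: "((\<lambda>v. g (f v) $ i $ j) has_derivative (\<lambda>h. dg (f' h) (axis i 1) (axis j 1))) (at u)" for i j
    using diff_chain_at[OF f entry_deriv[of i j, unfolded x]] by (simp add: o_def)
  have "((\<lambda>v. ip g (f v) (V v) (W v)) has_derivative
     (\<lambda>h. \<Sum>i\<in>UNIV. \<Sum>j\<in>UNIV. (V u $ i * W u $ j) * dg (f' h) (axis i 1) (axis j 1)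
        + (V u $ i * W' h $ j + V' h $ i * W u $ j) * g (f u) $ i $ j)) (at u)"
    unfolding ip_sum by (intro has_derivative_sum has_derivative_mult nth V W gf)
  moreover have "(\<Sum>i\<in>UNIV. \<Sum>j\<in>UNIV. (V u $ i * W u $ j) * dg (f' h) (axis i 1) (axis j 1)
        + (V u $ i * W' h $ j + V' h $ i * W u $ j) * g (f u) $ i $ j)
     = ip g x (V' h) (W u) + ip g x (V u) (W' h) + dg (f' h) (V u) (W u)" for h
    unfolding ip_sum dg_sum2[of "f' h" "V u" "W u"]
    by (simp add: x sum.distrib algebra_simps)
  ultimately show ?thesis by simp
qed

text \<open>Metric compatibility: when the Koszul terms for V and for W are added, all cancel except
  the two halves of the derivative of the metric along f.\<close>

lemma pd_ip_along:
  fixes f V W :: "real^'m::finite \<Rightarrow> real^'n"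
  assumes x: "x = f u" and f: "f differentiable (at u)"
    and V: "V differentiable (at u)" and W: "W differentiable (at u)"
  shows "pd a (\<lambda>v. ip g (f v) (V v) (W v)) u =
    ip g (f u) (cov_along g f V a u) (W u) + ip g (f u) (V u) (cov_along g f W a u)"
proof -
  have "pd a (\<lambda>v. ip g (f v) (V v) (W v)) u =
     ip g x (pd a V u) (W u) + ip g x (V u) (pd a W u) + dg (pd a f u) (V u) (W u)"
    using pd_eqI[OF has_derivative_ip_along[OF x f[THEN has_derivative_pd] V[THEN has_derivative_pd]
          W[THEN has_derivative_pd]]] by (simp add: pd_def)
  moreover have "ip g (f u) (cov_along g f V a u) (W u) = ip g (f u) (W u) (cov_along g f V a u)"
    using ip_sym x by simp
  ultimately show ?thesis
    unfolding ip_cov_along[of f u V, OF x V] ip_cov_along[of f u W, OF x W]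
    using ip_sym[of "W u" "pd a V u"] x dg_sym by (simp add: algebra_simps)
qed

end

lemma cov_along_scaleR:
  fixes c :: "real^'m::finite \<Rightarrow> real"
  assumes "c differentiable (at u)" "W differentiable (at u)"
  shows "cov_along g f (\<lambda>v. c v *\<^sub>R W v) a u = pd a c u *\<^sub>R W u + c u *\<^sub>R cov_along g f W a u"
proof -
  have "pd a (\<lambda>v. c v * W v $ k) u = c u * pd a (\<lambda>v. W v $ k) u + pd a c u * W u $ k" for k
    by (rule pd_mult[OF assms(1)]) (rule differentiable_linear[OF bounded_linear_vec_nth assms(2)])
  then show ?thesis
    by (simp add: cov_along_def vec_eq_iff sum_distrib_left algebra_simps)
qed

lemma cov_along_diff:
  assumes "V differentiable (at u)" "W differentiable (at u)"
  shows "cov_along g f (\<lambda>v. V v - W v) a u = cov_along g f V a u - cov_along g f W a u"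
proof -
  have "pd a (\<lambda>v. V v $ k - W v $ k) u = pd a (\<lambda>v. V v $ k) u - pd a (\<lambda>v. W v $ k) u" for k
    by (rule pd_diff) (rule differentiable_linear[OF bounded_linear_vec_nth], rule assms)+
  then show ?thesis
    by (simp add: cov_along_def vec_eq_iff sum_subtractf algebra_simps)
qed

lemma cov_along_cong_open:
  assumes "open S" "u \<in> S" "\<And>v. v \<in> S \<Longrightarrow> V v = W v"
  shows "cov_along g f V a u = cov_along g f W a u"
proof -
  have "pd a (\<lambda>v. V v $ k) u = pd a (\<lambda>v. W v $ k) u" for k
    by (rule pd_cong_open[OF assms(1,2)]) (simp add: assms(3))
  then show ?thesis using assms(2,3) by (simp add: cov_along_def)
qed

section \<open>Traces and positivity for 2 x 2 matrices\<close>

definition det2 :: "real^2^2 \<Rightarrow> real" where "det2 A = A$1$1 * A$2$2 - A$1$2 * A$2$1"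

lemma matrix_inv_2:
  assumes "det2 A \<noteq> 0"
  shows "matrix_inv A $ 1 $ 1 = A$2$2 / det2 A" "matrix_inv A $ 1 $ 2 = - A$1$2 / det2 A"
    "matrix_inv A $ 2 $ 1 = - A$2$1 / det2 A" "matrix_inv A $ 2 $ 2 = A$1$1 / det2 A"
proof -
  define B :: "real^2^2" where "B = (\<chi> i j. (if i = j then (if i = 1 then A$2$2 else A$1$1) else - A$i$j) / det2 A)"
  have "A ** B = mat 1"
    using assms by (simp add: vec_eq_iff forall_2 matrix_matrix_mult_def sum_2 B_def mat_def det2_def
       diff_divide_distrib[symmetric] mult.commute)
  then have "invertible A" using invertible_right_inverse by blast
  then have "matrix_inv A = matrix_inv A ** (A ** B)" using \<open>A ** B = mat 1\<close> by simp
  also have "\<dots> = B" using \<open>invertible A\<close> by (simp add: matrix_mul_assoc matrix_inv_inv)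
  finally have "matrix_inv A = B" .
  then show "matrix_inv A $ 1 $ 1 = A$2$2 / det2 A" "matrix_inv A $ 1 $ 2 = - A$1$2 / det2 A"
    "matrix_inv A $ 2 $ 1 = - A$2$1 / det2 A" "matrix_inv A $ 2 $ 2 = A$1$1 / det2 A"
    by (simp_all add: B_def)
qed

lemma trace_of_2:
  assumes "det2 (s u) \<noteq> 0"
  shows "trace_of s S u = (s u$2$2 * S u$1$1 - s u$1$2 * S u$1$2 - s u$2$1 * S u$2$1 + s u$1$1 * S u$2$2) / det2 (s u)"
  using assms by (simp add: trace_of_def sum_2 matrix_inv_2 add_divide_distrib diff_divide_distrib)

text \<open>The trace as an explicit rational function of the entries. The rules for jets apply to
  this form, whereas \<open>matrix_inv\<close> is opaque to them.\<close>

definition tr2 :: "(2 \<Rightarrow> 2 \<Rightarrow> real) \<Rightarrow> (2 \<Rightarrow> 2 \<Rightarrow> real) \<Rightarrow> real" where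
  "tr2 g S = (g 2 2 * S 1 1 - g 1 2 * S 1 2 - g 2 1 * S 2 1 + g 1 1 * S 2 2) / (g 1 1 * g 2 2 - g 1 2 * g 2 1)"

lemma trace_of_eq_tr2: "det2 (s u) \<noteq> 0 \<Longrightarrow> trace_of s S u = tr2 (\<lambda>a b. s u $ a $ b) (\<lambda>a b. S u $ a $ b)"
  by (simp add: trace_of_2 tr2_def det2_def)

lemma tr2_scale: "tr2 g (\<lambda>a b. c * S a b) = c * tr2 g S"
  by (simp add: tr2_def algebra_simps)

lemma jet0_tr2:
  assumes "\<And>a b. jet0 u (\<lambda>d v. g d v a b) (\<lambda>v. g0 v a b)" "\<And>a b. jet0 u (\<lambda>d v. S d v a b) (\<lambda>v. S0 v a b)"
    and "g0 u 1 1 * g0 u 2 2 - g0 u 1 2 * g0 u 2 1 \<noteq> 0"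
  shows "jet0 u (\<lambda>d v. tr2 (g d v) (S d v)) (\<lambda>v. tr2 (g0 v) (S0 v))"
  unfolding tr2_def by (intro jet0_divide jet0_add jet0_diff jet0_mult assms)

lemma det2_pos:
  fixes A :: "real^2^2"
  assumes sym: "A $ 1 $ 2 = A $ 2 $ 1"
    and pos: "\<And>v. v \<noteq> 0 \<Longrightarrow> (\<Sum>i\<in>UNIV. \<Sum>j\<in>UNIV. v $ i * v $ j * A $ i $ j) > 0"
  shows "det2 A > 0"
proof -
  have 1: "A $ 1 $ 1 > 0"
    using pos[of "axis 1 1"] by (simp add: sum_2 axis_def vec_eq_iff)
  \<comment> \<open>At this vector the quadratic form takes the value
    \<open>A $ 1 $ 1 * det2 A\<close>.\<close>
  define v :: "real^2" where "v = vector [- A $ 1 $ 2, A $ 1 $ 1]"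
  have "v \<noteq> 0" using 1 by (auto simp: v_def vec_eq_iff forall_2)
  from pos[OF this] have "A $ 1 $ 1 * det2 A > 0"
    using sym by (simp add: sum_2 v_def det2_def algebra_simps)
  then show ?thesis using 1 by (simp add: zero_less_mult_iff)
qed

section \<open>The unit sphere\<close>

lemma smooth_on_differentiable: "smooth_on S f \<Longrightarrow> x \<in> S \<Longrightarrow> f differentiable (at x)"
  unfolding smooth_on_def by (metis Ck_on.simps(2))

lemma smooth_on_continuous: "smooth_on S f \<Longrightarrow> continuous_on S f"
  unfolding smooth_on_def by (metis Ck_on.simps(1))

lemma smooth_on_frechet: "smooth_on S f \<Longrightarrow> smooth_on S (\<lambda>x. frechet_derivative f (at x) v)"
  unfolding smooth_on_def by (metis Ck_on.simps(2))

lemma smooth_on_pd: "smooth_on S f \<Longrightarrow> smooth_on S (pd a f)"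
  using smooth_on_frechet[of S f "axis a 1"] by (simp add: pd_def[abs_def])

lemma smooth_on_has_deriv:
  fixes g :: "real \<Rightarrow> real"
  assumes "smooth_on UNIV g" shows "(g has_real_derivative deriv g y) (at y)"
  using smooth_on_differentiable[OF assms, of y] by (metis DERIV_imp_deriv UNIV_I real_differentiable_def)

lemma smooth_on_deriv:
  fixes g :: "real \<Rightarrow> real"
  assumes "smooth_on UNIV g" shows "smooth_on UNIV (deriv g)"
proof -
  have "frechet_derivative g (at y) 1 = deriv g y" for y
    using frechet_derivative_at[OF smooth_on_has_deriv[OF assms, unfolded has_field_derivative_def], of y]
    by (metis mult.right_neutral)
  then show ?thesis using smooth_on_frechet[OF assms, of 1] by simp
qed

lemma has_real_derivative_line:
  fixes f :: "real^'n \<Rightarrow> real"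
  assumes "f differentiable (at (p + s *\<^sub>R axis a 1))"
  shows "((\<lambda>s. f (p + s *\<^sub>R axis a 1)) has_real_derivative pd a f (p + s *\<^sub>R axis a 1)) (at s)"
proof -
  let ?f' = "frechet_derivative f (at (p + s *\<^sub>R axis a 1))"
  have "((\<lambda>s. p + s *\<^sub>R axis a 1) has_derivative (\<lambda>t. t *\<^sub>R axis a 1)) (at s)"
    by (auto intro!: derivative_eq_intros)
  from diff_chain_at[OF this has_derivative_pd[OF assms]]
  have "((\<lambda>s. f (p + s *\<^sub>R axis a 1)) has_derivative (\<lambda>t. ?f' (t *\<^sub>R axis a 1))) (at s)"
    by (simp add: o_def)
  moreover have "?f' (t *\<^sub>R axis a 1) = pd a f (p + s *\<^sub>R axis a 1) * t" for t
    using linear_frechet_derivative[OF assms] by (simp add: pd_def linear_cmul)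
  ultimately show ?thesis by (simp add: has_field_derivative_def)
qed

text \<open>The mean value theorem twice: along a for the difference \<phi> of f on two parallel
  segments, then along b for \<open>pd a f\<close>. The corners of the parallelogram are at most h +
  h away from x, whence the radius 2 h.\<close>

lemma second_difference_mvt:
  fixes f :: "real^'n \<Rightarrow> real"
  assumes h: "0 < h" and B: "cball x (2 * h) \<subseteq> S"
    and f: "\<And>y. y \<in> S \<Longrightarrow> f differentiable (at y)" and fa: "\<And>y. y \<in> S \<Longrightarrow> pd a f differentiable (at y)"
  obtains y where "y \<in> cball x (2 * h)"
    "f (x + h *\<^sub>R axis a 1 + h *\<^sub>R axis b 1) - f (x + h *\<^sub>R axis a 1) - f (x + h *\<^sub>R axis b 1) + f x
      = h * h * pd b (pd a f) y"
proof -
  have mem: "x + s *\<^sub>R axis a 1 + t *\<^sub>R axis b 1 \<in> cball x (2 * h)" if "0 \<le> s" "s \<le> h" "0 \<le> t" "t \<le> h" for s t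
  proof -
    have "norm (s *\<^sub>R axis a 1 + t *\<^sub>R axis b 1 :: real^'n) \<le> s + t"
      using norm_triangle_ineq[of "s *\<^sub>R axis a 1 :: real^'n" "t *\<^sub>R axis b 1"] that by simp
    moreover have "dist (x + s *\<^sub>R axis a 1 + t *\<^sub>R axis b 1) x = norm (s *\<^sub>R axis a 1 + t *\<^sub>R axis b 1 :: real^'n)"
      by (simp add: dist_norm add.assoc)
    ultimately show ?thesis unfolding mem_cball dist_commute[of x] using that by linarith
  qed
  define \<phi> where "\<phi> s = f (x + h *\<^sub>R axis b 1 + s *\<^sub>R axis a 1) - f (x + s *\<^sub>R axis a 1)" for s
  have "(\<phi> has_real_derivative pd a f (x + h *\<^sub>R axis b 1 + s *\<^sub>R axis a 1) - pd a f (x + s *\<^sub>R axis a 1)) (at s)"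
    if "0 \<le> s" "s \<le> h" for s
    unfolding \<phi>_def
    using mem[of s h] mem[of s 0] that h B
    by (intro DERIV_diff has_real_derivative_line f) (auto simp: algebra_simps)
  from MVT2[OF h this] obtain s where s: "0 < s" "s < h" "\<phi> h - \<phi> 0 =
      h * (pd a f (x + h *\<^sub>R axis b 1 + s *\<^sub>R axis a 1) - pd a f (x + s *\<^sub>R axis a 1))"
    by auto
  have "((\<lambda>t. pd a f (x + s *\<^sub>R axis a 1 + t *\<^sub>R axis b 1)) has_real_derivative
      pd b (pd a f) (x + s *\<^sub>R axis a 1 + t *\<^sub>R axis b 1)) (at t)" if "0 \<le> t" "t \<le> h" for t
    using mem[of s t] s that B by (intro has_real_derivative_line fa) auto
  from MVT2[OF h this] obtain t where t: "0 < t" "t < h"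
    "pd a f (x + s *\<^sub>R axis a 1 + h *\<^sub>R axis b 1) - pd a f (x + s *\<^sub>R axis a 1)
      = h * pd b (pd a f) (x + s *\<^sub>R axis a 1 + t *\<^sub>R axis b 1)"
    by auto
  show thesis
  proof (rule that)
    show "x + s *\<^sub>R axis a 1 + t *\<^sub>R axis b 1 \<in> cball x (2 * h)" using s t by (intro mem) auto
    show "f (x + h *\<^sub>R axis a 1 + h *\<^sub>R axis b 1) - f (x + h *\<^sub>R axis a 1) - f (x + h *\<^sub>R axis b 1) + f x
      = h * h * pd b (pd a f) (x + s *\<^sub>R axis a 1 + t *\<^sub>R axis b 1)"
      using s(3) t(3) by (simp add: \<phi>_def algebra_simps)
  qed
qed

text \<open>The second difference is symmetric in a and b, so evaluating it in both orders equates
  the two mixed derivatives at two points near x; continuity moves both points to x.\<close>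

lemma pd_commute:
  fixes f :: "real^'n \<Rightarrow> real"
  assumes S: "open S" "x \<in> S" and f: "\<And>y. y \<in> S \<Longrightarrow> f differentiable (at y)"
    and fa: "\<And>c y. y \<in> S \<Longrightarrow> pd c f differentiable (at y)"
    and cont: "\<And>c d. isCont (pd c (pd d f)) x"
  shows "pd a (pd b f) x = pd b (pd a f) x"
proof (rule ccontr)
  assume neq: "pd a (pd b f) x \<noteq> pd b (pd a f) x"
  define \<epsilon> where "\<epsilon> = \<bar>pd a (pd b f) x - pd b (pd a f) x\<bar> / 2"
  have \<epsilon>: "\<epsilon> > 0" using neq by (simp add: \<epsilon>_def)
  obtain d1 where d1: "d1 > 0" "\<And>y. dist y x < d1 \<Longrightarrow> dist (pd a (pd b f) y) (pd a (pd b f) x) < \<epsilon>"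
    using cont[of a b] \<epsilon> unfolding continuous_at_eps_delta by blast
  obtain d2 where d2: "d2 > 0" "\<And>y. dist y x < d2 \<Longrightarrow> dist (pd b (pd a f) y) (pd b (pd a f) x) < \<epsilon>"
    using cont[of b a] \<epsilon> unfolding continuous_at_eps_delta by blast
  obtain r where r: "r > 0" "cball x r \<subseteq> S" using S open_contains_cball by blast
  define h where "h = min r (min d1 d2) / 3"
  have h: "h > 0" "2 * h < d1" "2 * h < d2" "2 * h \<le> r" using r d1 d2 by (auto simp: h_def)
  have hS: "cball x (2 * h) \<subseteq> S" using r h by auto
  obtain y where y: "y \<in> cball x (2 * h)"
    "f (x + h *\<^sub>R axis a 1 + h *\<^sub>R axis b 1) - f (x + h *\<^sub>R axis a 1) - f (x + h *\<^sub>R axis b 1) + f x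
      = h * h * pd b (pd a f) y"
    using second_difference_mvt[OF h(1) hS f fa] by blast
  obtain z where z: "z \<in> cball x (2 * h)"
    "f (x + h *\<^sub>R axis b 1 + h *\<^sub>R axis a 1) - f (x + h *\<^sub>R axis b 1) - f (x + h *\<^sub>R axis a 1) + f x
      = h * h * pd a (pd b f) z"
    using second_difference_mvt[OF h(1) hS f fa] by blast
  have "h * h * pd b (pd a f) y = h * h * pd a (pd b f) z"
    using y(2) z(2) by (simp add: algebra_simps)
  then have "pd b (pd a f) y = pd a (pd b f) z" using h(1) by simp
  moreover have "dist y x < d2" "dist z x < d1" using y(1) z(1) h by (auto simp: dist_commute)
  ultimately have "\<bar>pd a (pd b f) z - pd a (pd b f) x\<bar> + \<bar>pd a (pd b f) z - pd b (pd a f) x\<bar> < \<epsilon> + \<epsilon>"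
    using d1(2)[of z] d2(2)[of y] by (intro add_strict_mono) (simp_all add: dist_real_def)
  moreover have "\<bar>pd a (pd b f) x - pd b (pd a f) x\<bar>
      \<le> \<bar>pd a (pd b f) z - pd a (pd b f) x\<bar> + \<bar>pd a (pd b f) z - pd b (pd a f) x\<bar>" by linarith
  ultimately show False by (simp add: \<epsilon>_def)
qed

section \<open>Geometry of a chart of the unit sphere\<close>

locale unit_sphere_chart =
  fixes U :: "(real^2) set" and P :: "real^2 \<Rightarrow> real^3"
  assumes chart: "sphere_chart U P"
begin

abbreviation "D \<equiv> \<lambda>a. pd a P"
abbreviation "\<sigma> \<equiv> round_metric P"
abbreviation "\<sigma>inv \<equiv> \<lambda>u. matrix_inv (\<sigma> u)"
abbreviation "\<Gamma> \<equiv> christoffel \<sigma>"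

lemma open_U: "open U" and smooth_P: "smooth_on U P"
  using chart by (auto simp: sphere_chart_def)

lemma P_diff: "u \<in> U \<Longrightarrow> P differentiable (at u)"
  and D_diff: "u \<in> U \<Longrightarrow> D a differentiable (at u)"
  and DD_diff: "u \<in> U \<Longrightarrow> pd a (D b) differentiable (at u)"
  by (intro smooth_on_differentiable[of U] smooth_on_pd smooth_P; assumption)+

lemma inner_P: "u \<in> U \<Longrightarrow> P u \<bullet> P u = 1"
  using chart by (auto simp: sphere_chart_def norm_eq_1[symmetric] image_subset_iff)

lemma P_inner_D: assumes "u \<in> U" shows "P u \<bullet> D a u = 0"
proof -
  have "pd a (\<lambda>v. P v \<bullet> P v) u = pd a (\<lambda>v. 1) u"
    by (rule pd_cong_open[OF open_U assms]) (rule inner_P)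
  then show ?thesis using assms by (simp add: pd_inner P_diff pd_const inner_commute)
qed

lemma P_inner_DD: assumes "u \<in> U" shows "P u \<bullet> pd a (D b) u = - \<sigma> u $ a $ b"
proof -
  have "pd a (\<lambda>v. P v \<bullet> D b v) u = pd a (\<lambda>v. 0) u"
    by (rule pd_cong_open[OF open_U assms]) (rule P_inner_D)
  then show ?thesis using assms
    by (simp add: pd_inner P_diff D_diff pd_const round_metric_def)
qed

lemma DD_commute: assumes "u \<in> U" shows "pd a (D b) u = pd b (D a) u"
proof -
  have comp1: "pd c (\<lambda>v. P v $ k) v = D c v $ k" if "v \<in> U" for c k v
    by (rule pd_linear[OF bounded_linear_vec_nth P_diff[OF that]])
  have comp1': "(\<lambda>v. D c v $ k) differentiable (at v)" if "v \<in> U" for c k v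
    by (rule differentiable_linear[OF bounded_linear_vec_nth D_diff[OF that]])
  have comp2: "pd c (pd d (\<lambda>v. P v $ k)) v = pd c (D d) v $ k" if "v \<in> U" for c d k v
  proof -
    have "pd c (pd d (\<lambda>v. P v $ k)) v = pd c (\<lambda>v. D d v $ k) v"
      by (rule pd_cong_open[OF open_U that]) (rule comp1)
    then show ?thesis using pd_linear[OF bounded_linear_vec_nth D_diff[OF that]] by simp
  qed
  have "pd a (pd b (\<lambda>v. P v $ k)) u = pd b (pd a (\<lambda>v. P v $ k)) u" for k
  proof (rule pd_commute[OF open_U assms])
    show "(\<lambda>v. P v $ k) differentiable (at y)" if "y \<in> U" for y
      by (rule differentiable_linear[OF bounded_linear_vec_nth P_diff[OF that]])
    show "pd c (\<lambda>v. P v $ k) differentiable (at y)" if "y \<in> U" for c y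
      by (rule differentiable_cong_open[OF open_U that comp1[symmetric] comp1'[OF that]])
    show "isCont (pd c (pd d (\<lambda>v. P v $ k))) u" for c d
    proof (rule differentiable_imp_continuous_within)
      show "pd c (pd d (\<lambda>v. P v $ k)) differentiable (at u)"
        by (rule differentiable_cong_open[OF open_U assms comp2[symmetric]], assumption)
           (rule differentiable_linear[OF bounded_linear_vec_nth DD_diff[OF assms]])
    qed
  qed
  then show ?thesis using comp2[OF assms] by (simp add: vec_eq_iff)
qed

lemma D_independent:
  assumes u: "u \<in> U" and 0: "c 1 *\<^sub>R D 1 u + c 2 *\<^sub>R D 2 u = 0" shows "c 1 = 0" "c (2::2) = (0::real)"
proof -
  let ?d = "frechet_derivative P (at u)"
  have lin: "linear ?d" using P_diff[OF u] by (rule linear_frechet_derivative)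
  have "?d (c 1 *\<^sub>R axis 1 1 + c 2 *\<^sub>R axis 2 1) = ?d 0"
    using 0 lin by (simp add: linear_add linear_cmul linear_0 pd_def)
  then have "c 1 *\<^sub>R axis 1 1 + c 2 *\<^sub>R axis 2 1 = (0 :: real^2)"
    using chart u by (auto simp: sphere_chart_def inj_def)
  then show "c 1 = 0" "c 2 = 0" by (auto simp: vec_eq_iff forall_2 axis_def)
qed

lemma \<sigma>_nth: "\<sigma> u $ a $ b = D a u \<bullet> D b u"
  by (simp add: round_metric_def)

lemma \<sigma>_sym: "\<sigma> u $ a $ b = \<sigma> u $ b $ a"
  by (simp add: round_metric_def inner_commute)

lemma \<sigma>_quad: "ip \<sigma> u v v = (norm (v $ 1 *\<^sub>R D 1 u + v $ 2 *\<^sub>R D 2 u))\<^sup>2"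
  unfolding ip_sum power2_norm_eq_inner
  by (simp add: sum_2 round_metric_def inner_add_left inner_add_right inner_commute algebra_simps)

lemma \<sigma>_pos: assumes "u \<in> U" "v \<noteq> 0" shows "ip \<sigma> u v v > 0"
proof (rule ccontr)
  assume "\<not> ip \<sigma> u v v > 0"
  then have "v $ 1 *\<^sub>R D 1 u + v $ 2 *\<^sub>R D 2 u = 0" unfolding \<sigma>_quad by simp
  from D_independent[OF assms(1), of "\<lambda>i. v $ i", OF this] have "v = 0" by (simp add: vec_eq_iff forall_2)
  then show False using assms by simp
qed

lemma \<sigma>_inv:
  assumes "u \<in> U"
  shows "(\<Sum>c\<in>UNIV. \<sigma> u $ a $ c * \<sigma>inv u $ c $ b) = (if a = b then 1 else 0)"
    "(\<Sum>c\<in>UNIV. \<sigma>inv u $ a $ c * \<sigma> u $ c $ b) = (if a = b then 1 else 0)"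
proof -
  have "invertible (\<sigma> u)"
  proof (rule invertible_of_nondegenerate)
    fix v assume "\<And>w. ip \<sigma> u w v = 0"
    then show "v = 0" using \<sigma>_pos[OF assms, of v] by force
  qed
  from matrix_inv_inv[OF this] show
    "(\<Sum>c\<in>UNIV. \<sigma> u $ a $ c * \<sigma>inv u $ c $ b) = (if a = b then 1 else 0)"
    "(\<Sum>c\<in>UNIV. \<sigma>inv u $ a $ c * \<sigma> u $ c $ b) = (if a = b then 1 else 0)"
    by (auto simp: matrix_matrix_mult_def mat_def vec_eq_iff)
qed

text \<open>\<open>P u\<close>, \<open>D 1 u\<close> and \<open>D 2 u\<close> form a basis of the
  ambient space: the chart is an immersion, and its tangent vectors are orthogonal to the unit
  vector \<open>P u\<close>.\<close>

lemma orthogonal_frame_eq_0: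
  assumes u: "u \<in> U" and w: "w \<bullet> P u = 0" "\<And>a. w \<bullet> D a u = 0" shows "w = 0"
proof -
  define A :: "real^3^3" where "A = vector [P u, D 1 u, D 2 u]"
  have rows: "row 1 A = P u" "row 2 A = D 1 u" "row 3 A = D 2 u"
    by (simp_all add: A_def row_def vec_eq_iff)
  have "\<forall>i. c i = 0" if "(\<Sum>i\<in>UNIV. c i *s row i A) = 0" for c :: "3 \<Rightarrow> real"
  proof -
    have eq: "c 1 *\<^sub>R P u + c 2 *\<^sub>R D 1 u + c 3 *\<^sub>R D 2 u = 0"
      using that by (simp add: sum_3 rows scalar_mult_eq_scaleR)
    then have "P u \<bullet> (c 1 *\<^sub>R P u + c 2 *\<^sub>R D 1 u + c 3 *\<^sub>R D 2 u) = 0" by simp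
    then have c1: "c 1 = 0" using inner_P[OF u] P_inner_D[OF u] by (simp add: inner_add_right)
    then have "c 2 *\<^sub>R D 1 u + c 3 *\<^sub>R D 2 u = 0" using eq by simp
    with D_independent[OF u, of "\<lambda>i. if i = 1 then c 2 else c 3"] c1 show ?thesis
      by (simp add: forall_3)
  qed
  then have "\<exists>B. A ** B = mat 1" using matrix_right_invertible_independent_rows[of A] by blast
  then have "\<exists>B. B ** A = mat 1" using matrix_left_right_inverse by blast
  then have ker: "A *v w = 0 \<Longrightarrow> w = 0" by (simp add: matrix_left_invertible_ker)
  have "(A *v w) $ i = row i A \<bullet> w" for i
    by (simp add: matrix_vector_mult_def row_def inner_vec_def)
  then have "A *v w = 0" using w by (simp add: vec_eq_iff forall_3 rows inner_commute)
  then show ?thesis by (rule ker)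
qed

text \<open>Both sides have the same products with the frame. Applied to second derivatives of P it
  yields the Gauss formula, applied to e the length of dZ.\<close>

lemma frame_decomposition:
  assumes u: "u \<in> U"
  shows "v = (v \<bullet> P u) *\<^sub>R P u + (\<Sum>c\<in>UNIV. (\<Sum>d\<in>UNIV. \<sigma>inv u $ c $ d * (v \<bullet> D d u)) *\<^sub>R D c u)"
    (is "v = ?r")
proof -
  have "(v - ?r) \<bullet> P u = 0"
    using inner_P[OF u] P_inner_D[OF u]
    by (simp add: inner_diff_left inner_add_left inner_sum_left inner_commute[of "D _ u"])
  moreover have "(v - ?r) \<bullet> D b u = 0" for b
  proof -
    have "?r \<bullet> D b u = (\<Sum>c\<in>UNIV. (\<Sum>d\<in>UNIV. \<sigma>inv u $ c $ d * (v \<bullet> D d u)) * \<sigma> u $ b $ c)"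
      unfolding inner_add_left inner_sum_left inner_scaleR_left
      using P_inner_D[OF u] by (simp add: \<sigma>_nth inner_commute)
    also have "\<dots> = (\<Sum>d\<in>UNIV. (\<Sum>c\<in>UNIV. \<sigma> u $ b $ c * \<sigma>inv u $ c $ d) * (v \<bullet> D d u))"
      by (simp add: sum_2 algebra_simps)
    also have "\<dots> = v \<bullet> D b u"
      unfolding \<sigma>_inv[OF u] by (simp add: if_distrib[of "\<lambda>x. x * _"] cong: if_cong)
    finally show ?thesis by (simp add: inner_diff_left)
  qed
  ultimately have "v - ?r = 0" by (rule orthogonal_frame_eq_0[OF u])
  then show ?thesis by simp
qed

text \<open>Each derivative of the metric contributes two products; by symmetry of second
  derivatives four of the six cancel and the other two agree.\<close>

lemma \<Gamma>_eq:
  assumes u: "u \<in> U"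
  shows "\<Gamma> k i j u = (\<Sum>l\<in>UNIV. \<sigma>inv u $ k $ l * (pd i (D j) u \<bullet> D l u))"
proof -
  have pdm: "pd a (\<lambda>y. \<sigma> y $ b $ c) u = D b u \<bullet> pd a (D c) u + pd a (D b) u \<bullet> D c u" for a b c
    by (simp add: round_metric_def pd_inner D_diff[OF u])
  have "pd i (\<lambda>y. \<sigma> y $ j $ l) u + pd j (\<lambda>y. \<sigma> y $ i $ l) u - pd l (\<lambda>y. \<sigma> y $ i $ j) u
     = 2 * (pd i (D j) u \<bullet> D l u)" for l
    unfolding pdm using DD_commute[OF u, of i j] DD_commute[OF u, of i l] DD_commute[OF u, of j l]
    by (simp add: inner_commute)
  then show ?thesis by (simp add: christoffel_def sum_distrib_left mult_ac)
qed

lemma gauss_formula: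
  assumes u: "u \<in> U"
  shows "pd i (D j) u = - \<sigma> u $ i $ j *\<^sub>R P u + (\<Sum>c\<in>UNIV. \<Gamma> c i j u *\<^sub>R D c u)"
  using frame_decomposition[OF u, of "pd i (D j) u"] P_inner_DD[OF u]
  by (simp add: \<Gamma>_eq[OF u] inner_commute[of "pd i (D j) u" "P u"])

lemma div1_cong:
  assumes "u \<in> U" "\<And>v. v \<in> U \<Longrightarrow> \<alpha> v = \<beta> v" shows "div1 s \<alpha> u = div1 s \<beta> u"
proof -
  have "pd b (\<lambda>v. \<alpha> v $ a) u = pd b (\<lambda>v. \<beta> v $ a) u" for a b
    by (rule pd_cong_open[OF open_U assms(1)]) (simp add: assms(2))
  then show ?thesis using assms by (simp add: div1_def cov1_def)
qed

lemma div2_cong: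
  assumes "u \<in> U" "\<And>v. v \<in> U \<Longrightarrow> S v = T v" shows "div2 s S u = div2 s T u"
proof -
  have "pd c (\<lambda>v. S v $ a $ b) u = pd c (\<lambda>v. T v $ a $ b) u" for a b c
    by (rule pd_cong_open[OF open_U assms(1)]) (simp add: assms(2))
  then show ?thesis using assms by (simp add: div2_def cov2_def)
qed

lemma laplacian_cong:
  assumes "u \<in> U" "\<And>v. v \<in> U \<Longrightarrow> f v = g v" shows "laplacian s f u = laplacian s g u"
  unfolding laplacian_def
  by (rule div1_cong[OF assms(1)]) (simp add: vec_eq_iff pd_cong_open[OF open_U _ assms(2)])

end

section \<open>Functions of the height Z and the operators of the sphere\<close>

locale height_function = unit_sphere_chart +
  fixes e :: "real^3"
  assumes norm_e: "norm e = 1"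
begin

abbreviation "Z \<equiv> \<lambda>u. e \<bullet> P u"
abbreviation "dZ \<equiv> \<lambda>a u. e \<bullet> D a u"

lemma bounded_linear_e: "bounded_linear (\<lambda>x. e \<bullet> x)"
  by (rule bounded_linear_inner_right)

lemma Z_diff: "u \<in> U \<Longrightarrow> Z differentiable (at u)"
  and dZ_diff: "u \<in> U \<Longrightarrow> dZ a differentiable (at u)"
  and pd_Z: "u \<in> U \<Longrightarrow> pd a Z u = dZ a u"
  and pd_dZ: "u \<in> U \<Longrightarrow> pd a (dZ b) u = e \<bullet> pd a (D b) u"
  by (intro differentiable_linear[OF bounded_linear_e] pd_linear[OF bounded_linear_e] P_diff D_diff, assumption)+

lemma Z_bounds: "u \<in> U \<Longrightarrow> Z u \<in> {-1..1}"
proof -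
  assume "u \<in> U"
  then have "norm (P u) = 1" using inner_P norm_eq_1 by blast
  then have "\<bar>Z u\<bar> \<le> 1" using Cauchy_Schwarz_ineq2[of e "P u"] norm_e by simp
  then show ?thesis by auto
qed

text \<open>Parseval for the unit vector e: its normal component is Z and its tangential components
  are those of dZ.\<close>

lemma gradient_norm:
  assumes u: "u \<in> U"
  shows "(\<Sum>a\<in>UNIV. \<Sum>b\<in>UNIV. \<sigma>inv u $ a $ b * (dZ a u * dZ b u)) = 1 - (Z u)\<^sup>2"
proof -
  have "1 = e \<bullet> e" using norm_e by (simp add: norm_eq_1)
  also have "\<dots> = e \<bullet> ((e \<bullet> P u) *\<^sub>R P u + (\<Sum>c\<in>UNIV. (\<Sum>d\<in>UNIV. \<sigma>inv u $ c $ d * (e \<bullet> D d u)) *\<^sub>R D c u))"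
    using frame_decomposition[OF u, of e] by simp
  also have "\<dots> = (Z u)\<^sup>2 + (\<Sum>a\<in>UNIV. \<Sum>b\<in>UNIV. \<sigma>inv u $ a $ b * (dZ a u * dZ b u))"
    by (simp add: inner_add_right inner_sum_right power2_eq_square sum_distrib_left sum_distrib_right mult_ac)
  finally show ?thesis by simp
qed

text \<open>Pair the Gauss formula with e: the tangential part is the Christoffel term being
  subtracted, and the normal part is what remains.\<close>

lemma hessian_Z:
  assumes u: "u \<in> U"
  shows "pd b (dZ a) u - (\<Sum>c\<in>UNIV. \<Gamma> c b a u * dZ c u) = - \<sigma> u $ b $ a * Z u"
  unfolding pd_dZ[OF u] gauss_formula[OF u]
  by (simp add: inner_add_right inner_diff_right inner_sum_right)

text \<open>The factor 2 is the trace of the round metric, which multiplies -Z in the Hessian. The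
  scalar k' stands for the derivative of \<kappa> as a function of Z.\<close>

lemma div1_gradient:
  assumes u: "u \<in> U" and \<kappa>: "\<kappa> differentiable (at u)" "\<And>b. pd b \<kappa> u = k' * dZ b u"
  shows "div1 \<sigma> (\<lambda>v. \<chi> a. \<kappa> v * dZ a v) u = k' * (1 - (Z u)\<^sup>2) - 2 * Z u * \<kappa> u"
proof -
  have cov: "cov1 \<sigma> (\<lambda>v. \<chi> a. \<kappa> v * dZ a v) b a u = k' * (dZ a u * dZ b u) - \<kappa> u * Z u * \<sigma> u $ b $ a" for a b
  proof -
    have cov: "cov1 \<sigma> (\<lambda>v. \<chi> a. \<kappa> v * dZ a v) b a u = k' * (dZ a u * dZ b u)
        + \<kappa> u * (pd b (dZ a) u - (\<Sum>c\<in>UNIV. \<Gamma> c b a u * dZ c u))"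
      by (simp add: cov1_def pd_mult \<kappa> dZ_diff[OF u] sum_distrib_left algebra_simps)
    then show ?thesis unfolding hessian_Z[OF u] by simp
  qed
  have "div1 \<sigma> (\<lambda>v. \<chi> a. \<kappa> v * dZ a v) u
    = k' * (\<Sum>a\<in>UNIV. \<Sum>b\<in>UNIV. \<sigma>inv u $ a $ b * (dZ a u * dZ b u))
      - \<kappa> u * Z u * (\<Sum>a\<in>UNIV. \<Sum>b\<in>UNIV. \<sigma>inv u $ a $ b * \<sigma> u $ b $ a)"
    unfolding div1_def cov sum_2 by (simp add: algebra_simps)
  then show ?thesis unfolding gradient_norm[OF u] \<sigma>_inv[OF u] by simp
qed

lemma laplacian_gradient:
  assumes u: "u \<in> U" and f: "\<And>v a. v \<in> U \<Longrightarrow> pd a f v = \<kappa> v * dZ a v"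
    and \<kappa>: "\<kappa> differentiable (at u)" "\<And>b. pd b \<kappa> u = k' * dZ b u"
  shows "laplacian \<sigma> f u = k' * (1 - (Z u)\<^sup>2) - 2 * Z u * \<kappa> u"
proof -
  have "laplacian \<sigma> f u = div1 \<sigma> (\<lambda>v. \<chi> a. \<kappa> v * dZ a v) u"
    unfolding laplacian_def by (rule div1_cong[OF u]) (simp add: f)
  then show ?thesis using div1_gradient[OF u \<kappa>] by simp
qed

lemma trace_gradient_square:
  assumes u: "u \<in> U" and S: "\<And>a b. S u $ a $ b = k * dZ a u * dZ b u"
  shows "trace_of \<sigma> S u = k * (1 - (Z u)\<^sup>2)"
  unfolding gradient_norm[OF u, symmetric] trace_of_def S by (simp add: sum_distrib_left mult_ac)

text \<open>The factor 3 is 2 + 1: contracting the Hessian on the contracted index gives the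
  dimension, contracting it on the free index gives one more dZ.\<close>

lemma div2_gradient_square:
  assumes u: "u \<in> U" and \<kappa>: "\<kappa> differentiable (at u)" "\<And>b. pd b \<kappa> u = k' * dZ b u"
  shows "div2 \<sigma> (\<lambda>v. \<chi> a b. \<kappa> v * dZ a v * dZ b v) u $ a = (k' * (1 - (Z u)\<^sup>2) - 3 * Z u * \<kappa> u) * dZ a u"
proof -
  let ?S = "\<lambda>v. \<chi> a b. \<kappa> v * dZ a v * dZ b v"
  have cov: "cov2 \<sigma> ?S c a b u = k' * dZ a u * (dZ b u * dZ c u)
      - \<kappa> u * Z u * (\<sigma> u $ c $ a * dZ b u + \<sigma> u $ c $ b * dZ a u)" for a b c
  proof -
    have "pd c (\<lambda>v. \<kappa> v * dZ a v * dZ b v) u = k' * dZ c u * dZ a u * dZ b u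
        + \<kappa> u * pd c (dZ a) u * dZ b u + \<kappa> u * dZ a u * pd c (dZ b) u"
      by (simp add: pd_mult \<kappa> dZ_diff[OF u] differentiable_mult algebra_simps)
    then have "cov2 \<sigma> ?S c a b u = k' * dZ a u * (dZ b u * dZ c u)
      + \<kappa> u * dZ b u * (pd c (dZ a) u - (\<Sum>e\<in>UNIV. \<Gamma> e c a u * dZ e u))
      + \<kappa> u * dZ a u * (pd c (dZ b) u - (\<Sum>e\<in>UNIV. \<Gamma> e c b u * dZ e u))"
      by (simp add: cov2_def sum_2 algebra_simps)
    then show ?thesis unfolding hessian_Z[OF u] by (simp add: algebra_simps)
  qed
  have "div2 \<sigma> ?S u $ a = k' * dZ a u * (\<Sum>b\<in>UNIV. \<Sum>c\<in>UNIV. \<sigma>inv u $ b $ c * (dZ b u * dZ c u))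
      - \<kappa> u * Z u * ((\<Sum>b\<in>UNIV. (\<Sum>c\<in>UNIV. \<sigma>inv u $ b $ c * \<sigma> u $ c $ a) * dZ b u)
        + dZ a u * (\<Sum>b\<in>UNIV. \<Sum>c\<in>UNIV. \<sigma>inv u $ b $ c * \<sigma> u $ c $ b))"
    unfolding div2_def cov sum_2 vec_lambda_beta by (simp add: algebra_simps)
  also have "(\<Sum>b\<in>UNIV. (\<Sum>c\<in>UNIV. \<sigma>inv u $ b $ c * \<sigma> u $ c $ a) * dZ b u) = dZ a u"
    unfolding \<sigma>_inv[OF u] by (simp add: if_distrib[of "\<lambda>x. x * _"] cong: if_cong)
  finally show ?thesis unfolding gradient_norm[OF u] \<sigma>_inv[OF u] by (simp add: algebra_simps)
qed

lemma compose_Z: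
  assumes "u \<in> U" "(g has_real_derivative g') (at (Z u))"
  shows "(\<lambda>v. g (Z v)) differentiable (at u)" "pd a (\<lambda>v. g (Z v)) u = g' * dZ a u"
  using differentiable_real_compose[of g g' Z u, OF assms(2) Z_diff[OF assms(1)]]
    pd_real_compose[of g g' Z u, OF assms(2) Z_diff[OF assms(1)]] pd_Z[OF assms(1)] by simp_all

text \<open>At a pole Z is 1 or -1, where G need only have a one-sided derivative. The chain rule
  within the image of Z suffices, because \<open>U\<close> is open and the derivative on the side of
  \<open>U\<close> is a full one.\<close>

lemma compose_Z_within:
  assumes "u \<in> U" "(g has_real_derivative g') (at (Z u) within {-1..1})"
  shows "(\<lambda>v. g (Z v)) differentiable (at u)" "pd a (\<lambda>v. g (Z v)) u = g' * dZ a u"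
proof -
  have "(Z has_derivative frechet_derivative Z (at u)) (at u within U)"
    using Z_diff[OF assms(1)] has_derivative_pd has_derivative_at_withinI by blast
  moreover have "(g has_derivative (\<lambda>h. g' * h)) (at (Z u) within Z ` U)"
    using assms(2) Z_bounds unfolding has_field_derivative_def
    by (auto intro: has_derivative_subset)
  ultimately have "(g \<circ> Z has_derivative ((\<lambda>h. g' * h) \<circ> frechet_derivative Z (at u))) (at u within U)"
    by (rule diff_chain_within)
  then have "((\<lambda>v. g (Z v)) has_derivative (\<lambda>h. g' * frechet_derivative Z (at u) h)) (at u)"
    by (simp add: o_def at_within_open[OF assms(1) open_U])
  from differentiableI[OF this] pd_eqI[OF this, of a] pd_Z[OF assms(1), of a]
  show "(\<lambda>v. g (Z v)) differentiable (at u)" "pd a (\<lambda>v. g (Z v)) u = g' * dZ a u"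
    by (simp_all add: pd_def)
qed

end

section \<open>The Vaidya metric\<close>

lemma event_nth [simp]: "event t y $ 1 = t" "event t y $ 2 = y $ 1" "event t y $ 3 = y $ 2" "event t y $ 4 = y $ 3"
  by (simp_all add: event_def vector_def)

lemma spatial_event [simp]: "spatial (event t y) = y"
  by (simp add: spatial_def vec_eq_iff forall_3)

lemma event_spatial: "event (x $ 1) (spatial x) = x"
  by (simp add: spatial_def vec_eq_iff forall_4)

lemma bounded_linear_spatial: "bounded_linear spatial"
  using spatial_has_derivative by (rule has_derivative_bounded_linear)

lemma spatial_linear [simp]: "spatial (v + w) = spatial v + spatial w" "spatial (c *\<^sub>R v) = c *\<^sub>R spatial v"
  "spatial 0 = 0" "spatial (- v) = - spatial v" "spatial (v - w) = spatial v - spatial w"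
  using bounded_linear_spatial
  by (simp_all add: linear_simps)

lemma bounded_linear_event: "bounded_linear (event 0)"
  unfolding linear_conv_bounded_linear[symmetric]
  by (rule linearI) (simp_all add: vec_eq_iff forall_4)

lemma event_split: "event d y = event d 0 + event 0 y"
  by (simp add: vec_eq_iff forall_4)

lemma event_has_derivative: "(event d has_derivative event 0) (at y)"
proof -
  have "event d = (\<lambda>y. event d 0 + event 0 y)" by (rule ext) (rule event_split)
  moreover have "((\<lambda>y. event d 0 + event 0 y) has_derivative (\<lambda>h. 0 + event 0 h)) (at y)"
    by (intro has_derivative_add has_derivative_const bounded_linear_imp_has_derivative bounded_linear_event)
  ultimately show ?thesis by simp
qed

lemma ip_pullback:
  assumes "f differentiable (at u)"
  shows "ip (pullback g f) u v w = ip g (f u) (frechet_derivative f (at u) v) (frechet_derivative f (at u) w)"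
proof -
  let ?f' = "frechet_derivative f (at u)"
  have lin: "linear ?f'" using assms by (rule linear_frechet_derivative)
  have ex: "?f' z = (\<Sum>i\<in>UNIV. z $ i *\<^sub>R pd i f u)" for z
  proof -
    have "?f' z = ?f' (\<Sum>i\<in>UNIV. z $ i *\<^sub>R axis i 1)"
      using basis_expansion[of z] by (simp add: scalar_mult_eq_scaleR)
    then show ?thesis using lin by (simp add: linear_sum linear_cmul pd_def)
  qed
  interpret bounded_bilinear "ip g (f u)"
    unfolding ip_def
    by (intro bounded_bilinear.comp[OF bounded_bilinear_inner] bounded_linear_ident matrix_vector_mul_bounded_linear)
  show ?thesis
    unfolding ex[of v] ex[of w]
    by (simp add: ip_sum[of "pullback g f"] pullback_def sum_left sum_right scaleR_left scaleR_right
        sum_distrib_left mult_ac) (rule sum.swap)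
qed

text \<open>The differential of \<open>ret\<close>, which is the covector l of the overview.\<close>

definition null_form :: "real^4 \<Rightarrow> real^4 \<Rightarrow> real" where
  "null_form x v = v $ 1 - dirn x \<bullet> spatial v"

text \<open>The round metric times r^2: the Euclidean product minus its radial part.\<close>

definition angular :: "real^4 \<Rightarrow> real^4 \<Rightarrow> real^4 \<Rightarrow> real" where
  "angular x v w = spatial v \<bullet> spatial w - (dirn x \<bullet> spatial v) * (dirn x \<bullet> spatial w)"

definition potential :: "(real \<Rightarrow> real) \<Rightarrow> real^4 \<Rightarrow> real" where
  "potential M x = M (ret x) / rad x"

lemma rad_pos: "spatial x \<noteq> 0 \<Longrightarrow> rad x > 0"
  by (simp add: rad_def)

lemma dirn_unit: "spatial x \<noteq> 0 \<Longrightarrow> dirn x \<bullet> dirn x = 1"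
  by (simp add: dirn_def rad_def power2_norm_eq_inner[symmetric] power2_eq_square)

lemma rad_has_derivative:
  assumes "spatial x \<noteq> 0" shows "(rad has_derivative (\<lambda>v. dirn x \<bullet> spatial v)) (at x)"
proof -
  have "(norm has_derivative (\<lambda>h. sgn (spatial x) \<bullet> h)) (at (spatial x))"
    using GDERIV_norm[OF assms] by (simp add: gderiv_def inner_commute)
  from diff_chain_at[OF spatial_has_derivative this]
  show ?thesis by (simp add: rad_def[abs_def] o_def dirn_def rad_def sgn_div_norm)
qed

lemma ret_has_derivative:
  assumes "spatial x \<noteq> 0" shows "(ret has_derivative null_form x) (at x)"
  unfolding ret_def[abs_def] null_form_def[abs_def]
  by (intro has_derivative_diff rad_has_derivative assms vec_nth_has_derivative has_derivative_ident)

lemma dirn_has_derivative: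
  assumes "spatial x \<noteq> 0"
  shows "(dirn has_derivative (\<lambda>v. (spatial v - (dirn x \<bullet> spatial v) *\<^sub>R dirn x) /\<^sub>R rad x)) (at x)"
proof -
  have "((\<lambda>x. inverse (rad x) *\<^sub>R spatial x) has_derivative
      (\<lambda>v. inverse (rad x) *\<^sub>R spatial v + (- (inverse (rad x) * (dirn x \<bullet> spatial v) * inverse (rad x))) *\<^sub>R spatial x)) (at x)"
    using rad_pos[OF assms]
    by (intro has_derivative_scaleR Deriv.has_derivative_inverse rad_has_derivative spatial_has_derivative assms) auto
  then show ?thesis
    by (simp add: dirn_def[abs_def] dirn_def algebra_simps)
qed

text \<open>With du = dt - dr, the terms -du^2 - 2 du dr add up to -dt^2 + dr^2, and the radial
  square completes the angular part to the Euclidean product. Only the mass term f l \<otimes> l is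
  left over.\<close>

lemma ip_vaidya_eq:
  assumes x: "spatial x \<noteq> 0"
  shows "ip (vaidya M) x v w = spatial v \<bullet> spatial w - v $ 1 * w $ 1 + potential M x * null_form x v * null_form x w"
proof -
  have D: "frechet_derivative rad (at x) = (\<lambda>v. dirn x \<bullet> spatial v)" "frechet_derivative ret (at x) = null_form x"
    "frechet_derivative dirn (at x) = (\<lambda>v. (spatial v - (dirn x \<bullet> spatial v) *\<^sub>R dirn x) /\<^sub>R rad x)"
    using frechet_derivative_at[OF rad_has_derivative[OF x]] frechet_derivative_at[OF ret_has_derivative[OF x]]
      frechet_derivative_at[OF dirn_has_derivative[OF x]] by simp_all
  have "(rad x)\<^sup>2 * (((spatial v - (dirn x \<bullet> spatial v) *\<^sub>R dirn x) /\<^sub>R rad x)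
       \<bullet> ((spatial w - (dirn x \<bullet> spatial w) *\<^sub>R dirn x) /\<^sub>R rad x)) = angular x v w"
  proof -
    have "(spatial v - (dirn x \<bullet> spatial v) *\<^sub>R dirn x) \<bullet> (spatial w - (dirn x \<bullet> spatial w) *\<^sub>R dirn x) = angular x v w"
      using dirn_unit[OF x] by (simp add: angular_def inner_diff_left inner_diff_right inner_commute)
    moreover have "rad x * (rad x * (inverse (rad x) * inverse (rad x))) = 1"
      using rad_pos[OF x] by (simp add: field_simps)
    ultimately show ?thesis by (simp add: power2_eq_square)
  qed
  then show ?thesis
    unfolding ip_vaidya[OF x] vaidya_form_def Let_def D
    by (simp add: angular_def null_form_def potential_def algebra_simps)
qed

text \<open>The product rule for f l \<otimes> l, with the derivative of f equal to (M' l - f dr) /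
  r and the derivative of l equal to - \<open>angular\<close> / r.\<close>

definition dvaidya :: "(real \<Rightarrow> real) \<Rightarrow> real^4 \<Rightarrow> real^4 \<Rightarrow> real^4 \<Rightarrow> real^4 \<Rightarrow> real" where
  "dvaidya M x C A B = inverse (rad x) *
     ((deriv M (ret x) * null_form x C - potential M x * (dirn x \<bullet> spatial C)) * null_form x A * null_form x B
      - potential M x * (angular x C A * null_form x B + null_form x A * angular x C B))"

lemma null_form_has_derivative:
  assumes "spatial x \<noteq> 0"
  shows "((\<lambda>y. null_form y A) has_derivative (\<lambda>C. - inverse (rad x) * angular x C A)) (at x)"
proof -
  have "((\<lambda>y. A $ 1 - dirn y \<bullet> spatial A) has_derivative
      (\<lambda>C. 0 - (dirn x \<bullet> 0 + ((spatial C - (dirn x \<bullet> spatial C) *\<^sub>R dirn x) /\<^sub>R rad x) \<bullet> spatial A))) (at x)"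
    by (intro has_derivative_diff has_derivative_const has_derivative_inner dirn_has_derivative assms)
  then show ?thesis by (simp add: null_form_def angular_def algebra_simps)
qed

lemma vaidya_has_derivative:
  assumes x: "spatial x \<noteq> 0" and M: "M differentiable (at (ret x))"
  shows "((\<lambda>y. ip (vaidya M) y A B) has_derivative (\<lambda>C. dvaidya M x C A B)) (at x)"
proof -
  have "open {y. spatial y \<noteq> 0}"
    using linear_continuous_on[OF bounded_linear_spatial] by (intro open_Collect_neq continuous_intros) auto
  have M': "(M has_real_derivative deriv M (ret x)) (at (ret x))"
    using M by (metis DERIV_imp_deriv real_differentiable_def)
  from diff_chain_at[OF ret_has_derivative[OF x] this[unfolded has_field_derivative_def]]
  have Mr: "((\<lambda>y. M (ret y)) has_derivative (\<lambda>C. deriv M (ret x) * null_form x C)) (at x)"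
    by (simp add: o_def)
  have "(potential M has_derivative (\<lambda>C. inverse (rad x) *
      (deriv M (ret x) * null_form x C - potential M x * (dirn x \<bullet> spatial C)))) (at x)"
  proof -
    have "((\<lambda>y. M (ret y) * inverse (rad y)) has_derivative (\<lambda>C. M (ret x) * - (inverse (rad x) * (dirn x \<bullet> spatial C) * inverse (rad x))
       + deriv M (ret x) * null_form x C * inverse (rad x))) (at x)"
      using rad_pos[OF x] by (intro has_derivative_mult Deriv.has_derivative_inverse Mr rad_has_derivative x) auto
    then show ?thesis
      by (simp add: potential_def[abs_def] potential_def divide_inverse algebra_simps)
  qed
  then have "((\<lambda>y. spatial A \<bullet> spatial B - A $ 1 * B $ 1 + potential M y * null_form y A * null_form y B) has_derivative
     (\<lambda>C. 0 + (potential M x * null_form x A * (- inverse (rad x) * angular x C B)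
        + (potential M x * (- inverse (rad x) * angular x C A)
        + inverse (rad x) * (deriv M (ret x) * null_form x C - potential M x * (dirn x \<bullet> spatial C)) * null_form x A) * null_form x B))) (at x)"
    by (intro has_derivative_add has_derivative_mult null_form_has_derivative x has_derivative_const)
  then have "((\<lambda>y. spatial A \<bullet> spatial B - A $ 1 * B $ 1 + potential M y * null_form y A * null_form y B) has_derivative
     (\<lambda>C. dvaidya M x C A B)) (at x)"
    by (simp add: dvaidya_def algebra_simps)
  then show ?thesis
    by (rule has_derivative_transform_within_open[OF _ \<open>open {y. spatial y \<noteq> 0}\<close>]) (use x in \<open>simp_all add: ip_vaidya_eq\<close>)
qed

lemma angular_sym: "angular x v w = angular x w v"
  by (simp add: angular_def inner_commute)

lemma dvaidya_sym: "dvaidya M x C A B = dvaidya M x C B A"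
  by (simp add: dvaidya_def algebra_simps)

lemma vaidya_metric_derivative:
  assumes x: "spatial x \<noteq> 0" and M: "M differentiable (at (ret x))"
  shows "metric_derivative (vaidya M) x (dvaidya M x)"
proof
  show "((\<lambda>y. ip (vaidya M) y A B) has_derivative (\<lambda>C. dvaidya M x C A B)) (at x)" for A B
    by (rule vaidya_has_derivative[OF x M])
  show "dvaidya M x C A B = dvaidya M x C B A" for A B C by (rule dvaidya_sym)
  show "ip (vaidya M) x A B = ip (vaidya M) x B A" for A B
    by (simp add: ip_vaidya_eq[OF x] inner_commute mult_ac)
  show "invertible (vaidya M x)"
  proof (rule invertible_of_nondegenerate)
    fix v assume 0: "\<And>w. ip (vaidya M) x w v = 0"
    \<comment> \<open>The test vector is null and annihilated by l, so the mass term disappears and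
      the product is minus the value of l on v.\<close>
    have "null_form x v = 0"
      using 0[of "event 1 (dirn x)"] dirn_unit[OF x] by (simp add: ip_vaidya_eq[OF x] null_form_def)
    then have "spatial w \<bullet> spatial v = w $ 1 * v $ 1" for w
      using 0[of w] by (simp add: ip_vaidya_eq[OF x])
    \<comment> \<open>Reflecting the time component of the test vector turns the Minkowski product
      into the Euclidean one.\<close>
    from this[of "event (- v $ 1) (spatial v)"] have "spatial v \<bullet> spatial v + v $ 1 * v $ 1 = 0" by simp
    moreover have "spatial v \<bullet> spatial v \<ge> 0" "v $ 1 * v $ 1 \<ge> 0" by auto
    ultimately have "spatial v \<bullet> spatial v = 0" "v $ 1 * v $ 1 = 0" by linarith+
    then have "spatial v = 0" "v $ 1 = 0" by auto
    then show "v = 0" using event_spatial[of v] by (simp add: vec_eq_iff forall_4)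
  qed
qed

section \<open>The slices of constant time and their normal\<close>

lemma ip_slice:
  "ip (slice_metric M d) y v w = ip (vaidya M) (event d y) (event 0 v) (event 0 w)"
  using ip_pullback[of "event d" y "vaidya M"] event_has_derivative[of d y]
    frechet_derivative_at[OF event_has_derivative[of d y]]
  by (auto simp: slice_metric_def differentiable_def)

lemma ip_slice_eq:
  assumes "y \<noteq> 0"
  shows "ip (slice_metric M d) y v w =
    v \<bullet> w + potential M (event d y) * (dirn (event d y) \<bullet> v) * (dirn (event d y) \<bullet> w)"
  using assms by (simp add: ip_slice ip_vaidya_eq null_form_def)

lemma slice_metric_derivative:
  assumes y: "y \<noteq> 0" and M: "M differentiable (at (ret (event d y)))"
    and f: "1 + potential M (event d y) > 0"
  shows "metric_derivative (slice_metric M d) y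
    (\<lambda>C A B. dvaidya M (event d y) (event 0 C) (event 0 A) (event 0 B))"
proof
  have x: "spatial (event d y) \<noteq> 0" using y by simp
  interpret V: metric_derivative "vaidya M" "event d y" "dvaidya M (event d y)"
    by (rule vaidya_metric_derivative[OF x M])
  show "((\<lambda>y. ip (slice_metric M d) y A B) has_derivative
      (\<lambda>C. dvaidya M (event d y) (event 0 C) (event 0 A) (event 0 B))) (at y)" for A B
    using diff_chain_at[OF event_has_derivative V.has_deriv] by (simp add: ip_slice[abs_def] o_def)
  show "dvaidya M (event d y) (event 0 C) (event 0 A) (event 0 B)
      = dvaidya M (event d y) (event 0 C) (event 0 B) (event 0 A)" for A B C by (rule dvaidya_sym)
  show "ip (slice_metric M d) y A B = ip (slice_metric M d) y B A" for A B
    unfolding ip_slice by (rule V.ip_sym)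
  show "invertible (slice_metric M d y)"
  proof (rule invertible_of_nondegenerate)
    fix v assume 0: "\<And>w. ip (slice_metric M d) y w v = 0"
    let ?\<omega> = "dirn (event d y)"
    \<comment> \<open>The radial direction is the eigenvector of the slice metric with eigenvalue 1
      + f; orthogonal to it the metric is Euclidean.\<close>
    have "(1 + potential M (event d y)) * (?\<omega> \<bullet> v) = 0"
      using 0[of ?\<omega>] dirn_unit[OF x] by (simp add: ip_slice_eq[OF y] algebra_simps)
    then have "?\<omega> \<bullet> v = 0" using f by simp
    then show "v = 0" using 0[of v] by (simp add: ip_slice_eq[OF y])
  qed
qed

text \<open>Since l is closed, its derivative \<open>angular\<close> is symmetric, and of the six
  angular terms only the two with \<open>angular x A B\<close> survive.\<close>

lemma vaidya_koszul:
  "1/2 * (dvaidya M x A B V + dvaidya M x B A V - dvaidya M x V A B) = inverse (rad x) *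
    (1/2 * deriv M (ret x) * null_form x A * null_form x B * null_form x V
     - 1/2 * potential M x * ((dirn x \<bullet> spatial A) * null_form x B * null_form x V
        + (dirn x \<bullet> spatial B) * null_form x A * null_form x V
        - (dirn x \<bullet> spatial V) * null_form x A * null_form x B)
     - potential M x * angular x A B * null_form x V)"
  unfolding dvaidya_def angular_sym[of x V A] angular_sym[of x V B] angular_sym[of x B A]
  by (simp add: algebra_simps)

lemma future_normal_eq:
  assumes x: "spatial x \<noteq> 0" and f: "1 + potential M x > 0"
  shows "future_normal M x = event (sqrt (1 + potential M x)) ((potential M x / sqrt (1 + potential M x)) *\<^sub>R dirn x)"
    (is "_ = ?n")
  unfolding future_normal_def
proof (rule the_equality)
  let ?f = "potential M x" let ?s = "sqrt (1 + ?f)"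
  have s: "?s > 0" "?s * ?s = 1 + ?f" using f by auto
  have ln: "null_form x ?n = 1 / ?s"
    using s dirn_unit[OF x] by (simp add: null_form_def field_simps)
  have ss: "1 / ?s * (1 / ?s) = 1 / (1 + ?f)" using s by simp
  have "?f / ?s * (?f / ?s) - ?s * ?s + ?f * (1 / ?s) * (1 / ?s)
      = (?f * ?f + ?f) * (1 / ?s * (1 / ?s)) - ?s * ?s" by (simp add: add_divide_distrib algebra_simps)
  also have "\<dots> = -1" unfolding ss s(2) using f by (simp add: field_simps)
  finally have "?f / ?s * (?f / ?s) - ?s * ?s + ?f * (1 / ?s) * (1 / ?s) = -1" .
  then have "ip (vaidya M) x ?n ?n = -1"
    unfolding ip_vaidya_eq[OF x] ln by (simp add: dirn_unit[OF x])
  moreover have "ip (vaidya M) x ?n v = 0" if "v $ 1 = 0" for v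
    unfolding ip_vaidya_eq[OF x] ln using that by (simp add: null_form_def)
  ultimately show "ip (vaidya M) x ?n ?n = -1 \<and> (\<forall>v. v $ 1 = 0 \<longrightarrow> ip (vaidya M) x ?n v = 0) \<and> ?n $ 1 > 0"
    using s by simp
  fix n assume n: "ip (vaidya M) x n n = -1 \<and> (\<forall>v. v $ 1 = 0 \<longrightarrow> ip (vaidya M) x n v = 0) \<and> n $ 1 > 0"
  define \<tau> where "\<tau> = n $ 1"
  define l where "l = null_form x n"
  \<comment> \<open>A normal of the slice has a covector proportional to dt, so its spatial part can
    only compensate the mass term. This leaves the single unknown l, which unit length and the sign
    of the time component determine.\<close>
  have "(spatial n - (?f * l) *\<^sub>R dirn x) \<bullet> w = 0" for w
    using n[THEN conjunct2, THEN conjunct1, rule_format, of "event 0 w"]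
    by (simp add: ip_vaidya_eq[OF x] l_def null_form_def inner_diff_left)
  then have "spatial n - (?f * l) *\<^sub>R dirn x = 0" using inner_eq_zero_iff by blast
  then have sp: "spatial n = (?f * l) *\<^sub>R dirn x" by simp
  have "l = n $ 1 - dirn x \<bullet> spatial n" by (simp only: l_def null_form_def)
  also have "\<dots> = \<tau> - ?f * l" by (simp only: sp inner_scaleR_right dirn_unit[OF x] \<tau>_def mult_1_right)
  finally have "l = \<tau> - ?f * l" .
  then have \<tau>: "\<tau> = (1 + ?f) * l" by (simp add: algebra_simps)
  have "(?f * l) * (?f * l) - \<tau> * \<tau> + ?f * l * l = -1"
  proof -
    have "ip (vaidya M) x n n = -1" using n by blast
    then show ?thesis
      unfolding ip_vaidya_eq[OF x] sp l_def[symmetric] \<tau>_def by (simp add: dirn_unit[OF x])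
  qed
  then have "(1 + ?f) * (l * l) = 1" unfolding \<tau> by (simp add: algebra_simps)
  then have "(?s * l) * (?s * l) = 1" using s by (simp add: algebra_simps)
  moreover have "?s * l > 0" using n f s \<tau> by (auto simp: \<tau>_def zero_less_mult_iff)
  ultimately have "?s * l = 1" unfolding square_eq_1_iff by linarith
  then have l: "l = 1 / ?s" using s by (simp add: field_simps)
  have "\<tau> = ?s * (?s * l)" by (simp only: \<tau> s(2) mult.assoc[symmetric])
  then have "\<tau> = ?s" using \<open>?s * l = 1\<close> by simp
  then show "n = ?n" using event_spatial[of n] sp l by (simp add: \<tau>_def)
qed

section \<open>The surfaces \<open>\<Sigma>\<^sub>d\<close>\<close>

locale vaidya_surfaces = height_function U P e
  for U :: "(real^2) set" and P :: "real^2 \<Rightarrow> real^3" and e :: "real^3" +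
  fixes M :: "real \<Rightarrow> real"
  assumes smooth_M: "smooth_on UNIV M"
begin

abbreviation "x \<equiv> Surf e P"

text \<open>On \<open>\<Sigma>\<^sub>d\<close>, \<open>\<rho> = r / d\<close>, \<open>q = 1 / r\<close> and \<open>w\<close> is the retarded time \<open>d - r\<close>, written so that
  the limit \<open>1 / d \<rightarrow> 0\<close> can be read off; \<open>\<omega>\<close> is the radial direction \<open>y / r\<close>.\<close>

definition "\<rho> d u = sqrt (1 + 2 * (1 / d) * Z u + 1 / d * (1 / d))"
definition "q d u = 1 / d * inverse (\<rho> d u)"
definition "w d u = - (2 * Z u + 1 / d) * inverse (1 + \<rho> d u)"
definition "f d u = q d u * M (w d u)"
definition "\<omega> d u = inverse (\<rho> d u) *\<^sub>R (e + (1 / d) *\<^sub>R P u)"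
text \<open>\<open>\<omega>D\<close> and \<open>\<beta>\<close> are the Euclidean products of
  \<open>\<omega>\<close> with the tangent vectors and with the normal \<open>P u\<close>.
  \<open>lam\<close> and \<open>s\<close> normalize \<nu> and n; \<open>s\<close> is also the value
  of l on n.\<close>

definition "\<omega>D d a u = inverse (\<rho> d u) * dZ a u"
definition "\<beta> d u = inverse (\<rho> d u) * (Z u + 1 / d)"
definition "lam d u = inverse (sqrt (1 - f d u * inverse (1 + f d u) * (\<beta> d u * \<beta> d u)))"
definition "s d u = inverse (sqrt (1 + f d u))"

text \<open>The condition \<open>1 + f > 0\<close> says that the slice \<open>{t = d}\<close> is spacelike along \<open>\<Sigma>\<^sub>d\<close>.\<close>

definition "good d \<longleftrightarrow> d > 1 \<and> (\<forall>u\<in>U. 1 + f d u > 0)"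

lemma e_inner_e: "e \<bullet> e = 1"
  using norm_e by (simp add: norm_eq_1)

lemma \<rho>_arg_pos: assumes "d > 1" "u \<in> U" shows "1 + 2 * (1 / d) * Z u + 1 / d * (1 / d) > 0"
proof -
  have "(1 - 1 / d)\<^sup>2 > 0" using assms by simp
  moreover have "1 / d * (- 1) \<le> 1 / d * Z u"
    using assms Z_bounds[OF assms(2)] by (intro mult_left_mono) auto
  ultimately show ?thesis by (simp add: power2_eq_square algebra_simps)
qed

lemma \<rho>_pos: "d > 1 \<Longrightarrow> u \<in> U \<Longrightarrow> \<rho> d u > 0"
  unfolding \<rho>_def using \<rho>_arg_pos by simp

lemma \<rho>_square: "d > 1 \<Longrightarrow> u \<in> U \<Longrightarrow> \<rho> d u * \<rho> d u = 1 + 2 * (1 / d) * Z u + 1 / d * (1 / d)"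
  unfolding \<rho>_def using \<rho>_arg_pos[of d u] by simp

lemma spatial_x [simp]: "spatial (x d u) = surf e P d u"
  by (simp add: Surf_def)

lemma x_1 [simp]: "x d u $ 1 = d"
  by (simp add: Surf_def)

lemma rad_x: assumes "d > 1" "u \<in> U" shows "rad (x d u) = d * \<rho> d u"
proof -
  have "(norm (surf e P d u))\<^sup>2 = d * d + 2 * d * Z u + 1"
    unfolding power2_norm_eq_inner surf_def
    using e_inner_e inner_P[OF assms(2)] by (simp add: inner_add_left inner_add_right inner_commute)
  also have "\<dots> = d * d * (\<rho> d u * \<rho> d u)"
    unfolding \<rho>_square[OF assms] using assms by (simp add: algebra_simps)
  also have "\<dots> = (d * \<rho> d u)\<^sup>2" by (simp add: power2_eq_square)
  finally show ?thesis using assms \<rho>_pos[OF assms] by (simp add: rad_def)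
qed

lemma surf_nz: "d > 1 \<Longrightarrow> u \<in> U \<Longrightarrow> surf e P d u \<noteq> 0"
  using rad_x[of d u] \<rho>_pos[of d u] by (auto simp: rad_def)

lemma inverse_rad: "d > 1 \<Longrightarrow> u \<in> U \<Longrightarrow> inverse (rad (x d u)) = q d u"
  by (simp add: rad_x q_def divide_inverse)

lemma dirn_x: "d > 1 \<Longrightarrow> u \<in> U \<Longrightarrow> dirn (x d u) = \<omega> d u"
  by (simp add: dirn_def rad_x \<omega>_def surf_def field_simps scaleR_add_right)

text \<open>Rationalize d (1 - \<rho>) with 1 + \<rho>: the numerator becomes d (1 - \<rho>^2), in
  which the large terms cancel exactly.\<close>

lemma ret_x: assumes "d > 1" "u \<in> U" shows "ret (x d u) = w d u"
proof -
  have "(d - d * \<rho> d u) * (1 + \<rho> d u) = d * (1 - \<rho> d u * \<rho> d u)" by (simp add: algebra_simps)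
  also have "\<dots> = - (2 * Z u + 1 / d)"
    unfolding \<rho>_square[OF assms] using assms by (simp add: field_simps)
  finally show ?thesis
    unfolding ret_def rad_x[OF assms] w_def using \<rho>_pos[OF assms] by (simp add: field_simps)
qed

lemma potential_x: "d > 1 \<Longrightarrow> u \<in> U \<Longrightarrow> potential M (x d u) = f d u"
  by (simp add: potential_def f_def ret_x inverse_rad[symmetric] divide_inverse mult.commute)

lemma \<omega>_inner_D: "u \<in> U \<Longrightarrow> \<omega> d u \<bullet> D a u = \<omega>D d a u"
  by (simp add: \<omega>_def \<omega>D_def inner_add_left P_inner_D)

lemma \<omega>_inner_P: "u \<in> U \<Longrightarrow> \<omega> d u \<bullet> P u = \<beta> d u"
  by (simp add: \<omega>_def \<beta>_def inner_add_left inner_P)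

lemma \<omega>_unit: "d > 1 \<Longrightarrow> u \<in> U \<Longrightarrow> \<omega> d u \<bullet> \<omega> d u = 1"
  using dirn_unit[of "x d u"] by (simp add: dirn_x surf_nz)

text \<open>Every point of the surface has r within 1 of d, so the retarded time stays in [-1, 1],
  where M is bounded by some B. Beyond B + 1 this forces |f| < 1, with a threshold independent of
  the point and hence of the extent of \<open>U\<close>.\<close>

lemma eventually_good: "eventually good at_top"
proof -
  have "continuous_on {-1..1} M"
    using smooth_on_continuous[OF smooth_M] continuous_on_subset by blast
  then have "bounded (M ` {-1..1})"
    by (intro compact_imp_bounded compact_continuous_image compact_Icc)
  then obtain B where "B > 0" "\<forall>z\<in>M ` {-1..1}. norm z \<le> B" unfolding bounded_pos by blast
  then have B: "B > 0" "\<And>y. y \<in> {-1..1} \<Longrightarrow> \<bar>M y\<bar> \<le> B" by simp_all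
  have "good d" if d: "d > B + 1" for d
    unfolding good_def
  proof (intro conjI ballI)
    show d1: "d > 1" using d B by simp
    fix u assume u: "u \<in> U"
    have nP: "norm (P u) = 1" using inner_P[OF u] norm_eq_1 by blast
    have r: "\<bar>rad (x d u) - d\<bar> \<le> 1"
      using norm_triangle_ineq3[of "d *\<^sub>R e + P u" "d *\<^sub>R e"] norm_e nP d1
      by (simp add: rad_def surf_def)
    then have "\<bar>M (ret (x d u))\<bar> \<le> B" by (intro B(2)) (auto simp: ret_def)
    also have "\<dots> < rad (x d u)" using r d by linarith
    finally have "\<bar>potential M (x d u)\<bar> < 1" by (simp add: potential_def abs_divide)
    then show "1 + f d u > 0" using potential_x[OF d1 u] by linarith
  qed
  then show ?thesis using eventually_gt_at_top by (rule eventually_mono[rotated])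
qed

lemma M_diff: "M differentiable (at y)"
  using smooth_on_differentiable[OF smooth_M] by blast

lemma surf_diff: "u \<in> U \<Longrightarrow> surf e P d differentiable (at u)"
  unfolding surf_def[abs_def] by (intro differentiable_add differentiable_const P_diff)

lemma pd_surf: "u \<in> U \<Longrightarrow> pd a (surf e P d) u = D a u"
  unfolding surf_def[abs_def] by (simp add: pd_add pd_const P_diff)

lemma x_has_derivative: "u \<in> U \<Longrightarrow> (x d has_derivative (\<lambda>h. event 0 (frechet_derivative P (at u) h))) (at u)"
proof -
  assume u: "u \<in> U"
  have "(surf e P d has_derivative (\<lambda>h. 0 + frechet_derivative P (at u) h)) (at u)"
    unfolding surf_def[abs_def] by (intro has_derivative_add has_derivative_const has_derivative_pd P_diff u)
  from diff_chain_at[OF this event_has_derivative]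
  show ?thesis by (simp add: Surf_def[abs_def] o_def)
qed

lemma x_diff: "u \<in> U \<Longrightarrow> x d differentiable (at u)"
  using x_has_derivative differentiableI by blast

lemma pd_x: "u \<in> U \<Longrightarrow> pd a (x d) u = event 0 (D a u)"
  using pd_eqI[OF x_has_derivative] by (simp add: pd_def)

lemma metric_at_x: "d > 1 \<Longrightarrow> u \<in> U \<Longrightarrow> metric_derivative (vaidya M) (x d u) (dvaidya M (x d u))"
  by (intro vaidya_metric_derivative M_diff) (simp add: surf_nz)

lemma Surf_event: "event d (surf e P d u) = x d u"
  by (simp add: Surf_def)

lemma slice_at_surf:
  assumes "good d" "u \<in> U"
  shows "metric_derivative (slice_metric M d) (surf e P d u)
    (\<lambda>C A B. dvaidya M (x d u) (event 0 C) (event 0 A) (event 0 B))"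
  using slice_metric_derivative[of "surf e P d u" M d] assms
  by (simp add: good_def M_diff surf_nz Surf_event potential_x)

lemma ip_x:
  assumes "d > 1" "u \<in> U"
  shows "ip (vaidya M) (x d u) v v' = spatial v \<bullet> spatial v' - v $ 1 * v' $ 1
    + f d u * (v $ 1 - \<omega> d u \<bullet> spatial v) * (v' $ 1 - \<omega> d u \<bullet> spatial v')"
  using ip_vaidya_eq[of "x d u"] assms by (simp add: surf_nz potential_x dirn_x null_form_def)

lemma ip_surf:
  assumes "d > 1" "u \<in> U"
  shows "ip (slice_metric M d) (surf e P d u) v v' = v \<bullet> v' + f d u * (\<omega> d u \<bullet> v) * (\<omega> d u \<bullet> v')"
  using assms by (simp add: ip_slice Surf_event ip_x)

lemma induced_entry:
  assumes "d > 1" "u \<in> U"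
  shows "induced M e P d u $ a $ b = \<sigma> u $ a $ b + f d u * (\<omega>D d a u * \<omega>D d b u)"
  using assms by (simp add: induced_def pullback_def pd_x ip_x \<omega>_inner_D \<sigma>_nth)

text \<open>On a tangent vector X the induced metric is |X|^2 + f (\<omega> . X)^2. By
  Cauchy-Schwarz a negative f costs at most |f| |X|^2, which leaves (1 + f) |X|^2.\<close>

lemma det2_induced:
  assumes "good d" "u \<in> U"
  shows "det2 (induced M e P d u) > 0"
proof (rule det2_pos)
  have d: "d > 1" and f: "1 + f d u > 0" using assms by (auto simp: good_def)
  show "induced M e P d u $ 1 $ 2 = induced M e P d u $ 2 $ 1"
    by (simp add: induced_entry[OF d assms(2)] \<sigma>_sym[of u 1 2])
  fix v :: "real^2" assume v: "v \<noteq> 0"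
  define X where "X = v $ 1 *\<^sub>R D 1 u + v $ 2 *\<^sub>R D 2 u"
  have X: "X \<bullet> X > 0"
    using \<sigma>_pos[OF assms(2) v] by (simp add: \<sigma>_quad X_def power2_norm_eq_inner)
  have "(\<omega> d u \<bullet> X)\<^sup>2 \<le> X \<bullet> X"
    using Cauchy_Schwarz_ineq[of "\<omega> d u" X] \<omega>_unit[OF d assms(2)] by simp
  then have "X \<bullet> X + f d u * (\<omega> d u \<bullet> X)\<^sup>2 > 0"
  proof (cases "f d u \<ge> 0")
    case False
    have "f d u * (X \<bullet> X) \<le> f d u * (\<omega> d u \<bullet> X)\<^sup>2"
      using False \<open>(\<omega> d u \<bullet> X)\<^sup>2 \<le> X \<bullet> X\<close> by (intro mult_left_mono_neg) auto
    moreover have "(1 + f d u) * (X \<bullet> X) > 0" using f X by simp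
    ultimately show ?thesis by (simp add: algebra_simps)
  qed (use X in \<open>simp add: add_pos_nonneg\<close>)
  moreover have "(\<Sum>i\<in>UNIV. \<Sum>j\<in>UNIV. v $ i * v $ j * induced M e P d u $ i $ j) = X \<bullet> X + f d u * (\<omega> d u \<bullet> X)\<^sup>2"
    unfolding induced_entry[OF d assms(2)] \<omega>_inner_D[OF assms(2), symmetric] \<sigma>_nth X_def power2_eq_square
    by (simp add: sum_2 inner_add_left inner_add_right inner_commute[of "D 2 u" "D 1 u"] algebra_simps)
  ultimately show "(\<Sum>i\<in>UNIV. \<Sum>j\<in>UNIV. v $ i * v $ j * induced M e P d u $ i $ j) > 0" by simp
qed

section \<open>Closed forms of the two unit normals\<close>

definition "nn d u = event (inverse (s d u)) ((f d u * s d u) *\<^sub>R \<omega> d u)"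
text \<open>The conormal is a multiple of \<open>P u\<close>, so \<nu> arises by applying to
  \<open>P u\<close> the inverse id - f / (1 + f) \<omega> \<otimes> \<omega> of the slice metric id
  + f \<omega> \<otimes> \<omega>; \<open>lam\<close> gives it unit length.\<close>

definition "nu d u = lam d u *\<^sub>R (P u - (f d u * inverse (1 + f d u) * \<beta> d u) *\<^sub>R \<omega> d u)"

lemma s_facts:
  assumes "good d" "u \<in> U"
  shows "s d u > 0" "(1 + f d u) * (s d u * s d u) = 1" "inverse (s d u) = (1 + f d u) * s d u"
proof -
  have f: "1 + f d u > 0" using assms by (auto simp: good_def)
  then show "s d u > 0" by (simp add: s_def)
  have "s d u * s d u = inverse (1 + f d u)"
    using f by (simp add: s_def inverse_mult_distrib[symmetric] del: inverse_mult_distrib)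
  then show 1: "(1 + f d u) * (s d u * s d u) = 1" using f by simp
  then have "(1 + f d u) * s d u * s d u = 1" by (simp add: mult.assoc)
  then show "inverse (s d u) = (1 + f d u) * s d u"
    by (rule inverse_unique[OF trans[OF mult.commute]])
qed

lemma n_along_eq: "good d \<Longrightarrow> u \<in> U \<Longrightarrow> n_along M e P d u = nn d u"
  unfolding n_along_def good_def
  by (subst future_normal_eq) (auto simp: surf_nz potential_x dirn_x nn_def s_def divide_inverse)

lemma null_nn:
  assumes "good d" "u \<in> U"
  shows "nn d u $ 1 - \<omega> d u \<bullet> spatial (nn d u) = s d u"
  using assms s_facts[OF assms] \<omega>_unit[of d u] by (simp add: nn_def good_def algebra_simps)

lemma ip_nn:
  assumes "good d" "u \<in> U"
  shows "ip (vaidya M) (x d u) (nn d u) v = - s d u * (1 + f d u) * v $ 1 + f d u * s d u * v $ 1"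
  unfolding ip_x[of d u, OF _ assms(2)] 
  using assms null_nn[OF assms] s_facts[OF assms]
  by (subst ip_x) (auto simp: good_def nn_def algebra_simps)

lemma ip_nn_event: "good d \<Longrightarrow> u \<in> U \<Longrightarrow> ip (vaidya M) (x d u) (nn d u) (event 0 v) = 0"
  by (simp add: ip_nn)

lemma ip_nn_nn:
  assumes "good d" "u \<in> U"
  shows "ip (vaidya M) (x d u) (nn d u) (nn d u) = -1"
proof -
  have "ip (vaidya M) (x d u) (nn d u) (nn d u) = - (s d u * inverse (s d u))"
    unfolding ip_nn[OF assms] by (simp add: nn_def algebra_simps)
  then show ?thesis using s_facts(1)[OF assms] by simp
qed

text \<open>The radicand is (1 + f (1 - \<beta>^2)) / (1 + f) with \<beta>^2 \<le> 1, so its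
  positivity reduces to 1 + f > 0.\<close>

lemma lam_facts:
  assumes "good d" "u \<in> U"
  shows "1 - f d u * inverse (1 + f d u) * (\<beta> d u * \<beta> d u) > 0" "lam d u > 0"
    "lam d u * lam d u * (1 - f d u * inverse (1 + f d u) * (\<beta> d u * \<beta> d u)) = 1"
proof -
  let ?f = "f d u" let ?b = "\<beta> d u * \<beta> d u"
  have d: "d > 1" and f: "1 + ?f > 0" using assms by (auto simp: good_def)
  have b: "?b \<le> 1"
    using Cauchy_Schwarz_ineq[of "\<omega> d u" "P u"] \<omega>_unit[OF d assms(2)] inner_P[OF assms(2)] \<omega>_inner_P[OF assms(2)]
    by (simp add: power2_eq_square)
  have "1 + ?f * (1 - ?b) > 0"
  proof (cases "?f \<ge> 0")
    case False
    have "?f * (1 - ?b) \<ge> ?f * 1" using False by (intro mult_left_mono_neg) auto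
    then show ?thesis using f by simp
  qed (use b in \<open>simp add: add_pos_nonneg\<close>)
  moreover have "1 - ?f * inverse (1 + ?f) * ?b = (1 + ?f * (1 - ?b)) * inverse (1 + ?f)"
    using f by (simp add: field_simps)
  ultimately show p: "1 - ?f * inverse (1 + ?f) * ?b > 0" using f by simp
  then show "lam d u > 0" by (simp add: lam_def)
  show "lam d u * lam d u * (1 - ?f * inverse (1 + ?f) * ?b) = 1"
    using p unfolding lam_def by (simp add: inverse_mult_distrib[symmetric] del: inverse_mult_distrib)
qed

lemma \<omega>_inner_nu:
  assumes "good d" "u \<in> U"
  shows "\<omega> d u \<bullet> nu d u = lam d u * \<beta> d u * inverse (1 + f d u)"
proof -
  have d: "d > 1" and f: "1 + f d u > 0" using assms by (auto simp: good_def)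
  have "\<omega> d u \<bullet> nu d u = lam d u * \<beta> d u * (1 - f d u * inverse (1 + f d u))"
    by (simp add: nu_def inner_diff_right \<omega>_inner_P \<omega>_unit d assms(2) algebra_simps)
  also have "1 - f d u * inverse (1 + f d u) = inverse (1 + f d u)" using f by (simp add: field_simps)
  finally show ?thesis .
qed

text \<open>Lowering the index of \<nu> with the slice metric returns the Euclidean normal up to
  scale, which makes \<nu> orthogonal to the surface.\<close>

lemma nu_flat:
  assumes "good d" "u \<in> U"
  shows "nu d u + (f d u * (\<omega> d u \<bullet> nu d u)) *\<^sub>R \<omega> d u = lam d u *\<^sub>R P u"
  unfolding \<omega>_inner_nu[OF assms] by (simp add: nu_def algebra_simps)

lemma ip_nu:
  assumes "good d" "u \<in> U"
  shows "ip (slice_metric M d) (surf e P d u) (nu d u) v = lam d u * (P u \<bullet> v)"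
proof -
  have "ip (slice_metric M d) (surf e P d u) (nu d u) v = (nu d u + (f d u * (\<omega> d u \<bullet> nu d u)) *\<^sub>R \<omega> d u) \<bullet> v"
    using assms by (simp add: ip_surf good_def inner_add_left)
  then show ?thesis unfolding nu_flat[OF assms] by simp
qed

lemma P_inner_nu:
  assumes "good d" "u \<in> U"
  shows "P u \<bullet> nu d u = lam d u * (1 - f d u * inverse (1 + f d u) * (\<beta> d u * \<beta> d u))"
  using assms by (simp add: nu_def inner_diff_right inner_P \<omega>_inner_P inner_commute[of "P u" "\<omega> d u"])

lemma ip_nu_nu:
  assumes "good d" "u \<in> U"
  shows "ip (slice_metric M d) (surf e P d u) (nu d u) (nu d u) = 1"
  unfolding ip_nu[OF assms] P_inner_nu[OF assms] using lam_facts(3)[OF assms] by (simp add: mult.assoc)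

lemma outward_normal_eq:
  assumes "good d" "u \<in> U"
  shows "outward_normal M e P d u = nu d u"
  unfolding outward_normal_def
proof (rule the_equality)
  have d: "d > 1" and f: "1 + f d u > 0" using assms by (auto simp: good_def)
  show "ip (slice_metric M d) (surf e P d u) (nu d u) (nu d u) = 1 \<and>
    (\<forall>a. ip (slice_metric M d) (surf e P d u) (nu d u) (pd a (surf e P d) u) = 0) \<and> nu d u \<bullet> P u > 0"
    using ip_nu_nu[OF assms] ip_nu[OF assms] lam_facts[OF assms] P_inner_nu[OF assms]
    by (simp add: pd_surf assms P_inner_D inner_commute[of "nu d u"])
  fix v assume v: "ip (slice_metric M d) (surf e P d u) v v = 1 \<and>
    (\<forall>a. ip (slice_metric M d) (surf e P d u) v (pd a (surf e P d) u) = 0) \<and> v \<bullet> P u > 0"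
  \<comment> \<open>v with its index lowered. Being orthogonal to the surface makes N a multiple of
    \<open>P u\<close>; unit length fixes the square of the multiple and the outward condition its
    sign.\<close>
  define N where "N = v + (f d u * (\<omega> d u \<bullet> v)) *\<^sub>R \<omega> d u"
  define l where "l = N \<bullet> P u"
  have ipN: "ip (slice_metric M d) (surf e P d u) v y = N \<bullet> y" for y
    by (simp add: ip_surf[OF d assms(2)] N_def inner_add_left)
  have "N - l *\<^sub>R P u = 0"
  proof (rule orthogonal_frame_eq_0[OF assms(2)])
    show "(N - l *\<^sub>R P u) \<bullet> P u = 0" by (simp add: inner_diff_left inner_P[OF assms(2)] l_def)
    show "(N - l *\<^sub>R P u) \<bullet> D a u = 0" for a
      using v by (simp add: inner_diff_left P_inner_D[OF assms(2)] ipN pd_surf[OF assms(2)])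
  qed
  then have N: "N = l *\<^sub>R P u" by simp
  have "\<omega> d u \<bullet> N = (1 + f d u) * (\<omega> d u \<bullet> v)"
    unfolding N_def by (simp add: inner_add_right \<omega>_unit[OF d assms(2)] algebra_simps)
  then have "(1 + f d u) * (\<omega> d u \<bullet> v) = l * \<beta> d u"
    unfolding N by (simp add: \<omega>_inner_P[OF assms(2)])
  then have wv: "\<omega> d u \<bullet> v = l * \<beta> d u * inverse (1 + f d u)" using f by (simp add: field_simps)
  have "v = N - (f d u * (\<omega> d u \<bullet> v)) *\<^sub>R \<omega> d u" by (simp add: N_def)
  then have vl: "v = l *\<^sub>R (P u - (f d u * inverse (1 + f d u) * \<beta> d u) *\<^sub>R \<omega> d u)"
    unfolding N wv by (simp add: algebra_simps)
  let ?c = "1 - f d u * inverse (1 + f d u) * (\<beta> d u * \<beta> d u)"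
  have Pv: "P u \<bullet> v = l * ?c"
    unfolding vl by (simp add: inner_diff_right inner_P[OF assms(2)] \<omega>_inner_P[OF assms(2)] inner_commute[of "P u" "\<omega> d u"])
  have "l * (P u \<bullet> v) = 1" using v ipN[of v] unfolding N by simp
  then have 1: "l * l * ?c = 1" unfolding Pv by (simp add: mult.assoc)
  have "l * ?c > 0" using v Pv by (simp add: inner_commute)
  then have lpos: "l > 0" using lam_facts(1)[OF assms] by (simp add: zero_less_mult_iff)
  have "l * l * ?c = lam d u * lam d u * ?c" using 1 lam_facts(3)[OF assms] by simp
  then have "l * l = lam d u * lam d u" using lam_facts(1)[OF assms] by simp
  then have "l\<^sup>2 = (lam d u)\<^sup>2" by (simp add: power2_eq_square)
  then have "l = lam d u" using lpos lam_facts(2)[OF assms] by (simp add: power2_eq_iff_nonneg)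
  then show "v = nu d u" unfolding nu_def vl[symmetric] using vl by simp
qed

lemma \<nu>_along_eq: "good d \<Longrightarrow> u \<in> U \<Longrightarrow> \<nu>_along M e P d u = event 0 (nu d u)"
  by (simp add: \<nu>_along_def outward_normal_eq)

section \<open>Second fundamental forms of the surface and of the slice\<close>

definition "m1 d u = deriv M (w d u)"

context
  fixes d u assumes good: "good d" and u: "u \<in> U"
begin

lemma d_gt_1: "d > 1" using good by (simp add: good_def)

lemma f_gt: "1 + f d u > 0" using good u by (simp add: good_def)

lemma \<rho>_diff: "\<rho> d differentiable (at u)"
  unfolding \<rho>_def[abs_def]
  by (rule differentiable_sqrt, rule \<rho>_arg_pos[OF d_gt_1 u])
     (intro differentiable_add differentiable_mult differentiable_const Z_diff u)

lemma inverse_\<rho>_diff: "(\<lambda>v. inverse (\<rho> d v)) differentiable (at u)"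
  using \<rho>_pos[OF d_gt_1 u] by (intro differentiable_inverse \<rho>_diff) auto

lemma w_diff: "w d differentiable (at u)"
  unfolding w_def[abs_def] using \<rho>_pos[OF d_gt_1 u]
  by (intro differentiable_add differentiable_mult differentiable_minus differentiable_inverse
      differentiable_const Z_diff \<rho>_diff u) auto

lemma f_diff: "f d differentiable (at u)"
  unfolding f_def[abs_def] q_def
  by (intro differentiable_mult differentiable_const inverse_\<rho>_diff
      differentiable_real_compose[OF smooth_on_has_deriv[OF smooth_M] w_diff])

lemma \<omega>_diff: "\<omega> d differentiable (at u)"
  unfolding \<omega>_def[abs_def]
  by (intro differentiable_scaleR differentiable_add differentiable_const inverse_\<rho>_diff P_diff u)

lemma \<beta>_diff: "\<beta> d differentiable (at u)"
  unfolding \<beta>_def[abs_def]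
  by (intro differentiable_mult differentiable_add differentiable_const inverse_\<rho>_diff Z_diff u)

lemma sqrt_1f_diff: "(\<lambda>v. sqrt (1 + f d v)) differentiable (at u)"
  by (rule differentiable_sqrt, rule f_gt)
     (intro differentiable_add differentiable_const f_diff)

lemma s_diff: "s d differentiable (at u)" "(\<lambda>v. inverse (s d v)) differentiable (at u)"
  unfolding s_def[abs_def] using f_gt sqrt_1f_diff
  by (auto intro!: differentiable_inverse)

lemma lam_diff: "lam d differentiable (at u)"
  unfolding lam_def[abs_def]
proof (rule differentiable_inverse)
  show "(\<lambda>v. sqrt (1 - f d v * inverse (1 + f d v) * (\<beta> d v * \<beta> d v))) differentiable (at u)"
    using f_gt
    by (intro differentiable_sqrt lam_facts(1)[OF good u]
        differentiable_diff differentiable_mult differentiable_add differentiable_inverse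
        differentiable_const f_diff \<beta>_diff) auto
qed (use lam_facts(1)[OF good u] in auto)

lemma nu_diff: "nu d differentiable (at u)"
  unfolding nu_def[abs_def] using f_gt
  by (intro differentiable_scaleR differentiable_diff differentiable_mult differentiable_inverse
      differentiable_add differentiable_const lam_diff f_diff \<beta>_diff \<omega>_diff P_diff u) auto

lemma event_nu_diff: "(\<lambda>v. event 0 (nu d v)) differentiable (at u)"
  by (rule differentiable_linear[OF bounded_linear_event nu_diff])

lemma nn_diff: "nn d differentiable (at u)"
proof -
  have "nn d = (\<lambda>v. inverse (s d v) *\<^sub>R axis 1 1 + event 0 ((f d v * s d v) *\<^sub>R \<omega> d v))"
    by (rule ext) (simp add: nn_def vec_eq_iff forall_4 axis_def)
  then show ?thesis
    by (simp only:) (intro differentiable_add differentiable_scaleR differentiable_const s_diff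
      differentiable_linear[OF bounded_linear_event] differentiable_mult f_diff \<omega>_diff)
qed

lemma koszul_x:
  "1/2 * (dvaidya M (x d u) A B V + dvaidya M (x d u) B A V - dvaidya M (x d u) V A B) = q d u *
    (1/2 * m1 d u * (A $ 1 - \<omega> d u \<bullet> spatial A) * (B $ 1 - \<omega> d u \<bullet> spatial B) * (V $ 1 - \<omega> d u \<bullet> spatial V)
     - 1/2 * f d u * ((\<omega> d u \<bullet> spatial A) * (B $ 1 - \<omega> d u \<bullet> spatial B) * (V $ 1 - \<omega> d u \<bullet> spatial V)
        + (\<omega> d u \<bullet> spatial B) * (A $ 1 - \<omega> d u \<bullet> spatial A) * (V $ 1 - \<omega> d u \<bullet> spatial V)
        - (\<omega> d u \<bullet> spatial V) * (A $ 1 - \<omega> d u \<bullet> spatial A) * (B $ 1 - \<omega> d u \<bullet> spatial B))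
     - f d u * (spatial A \<bullet> spatial B - (\<omega> d u \<bullet> spatial A) * (\<omega> d u \<bullet> spatial B)) * (V $ 1 - \<omega> d u \<bullet> spatial V))"
  unfolding vaidya_koszul null_form_def angular_def
  by (simp only: inverse_rad[OF d_gt_1 u] dirn_x[OF d_gt_1 u] ret_x[OF d_gt_1 u] potential_x[OF d_gt_1 u] m1_def)

text \<open>Differentiating \<open>\<langle>n, W\<rangle> = 0\<close> along the surface moves the derivative from \<open>n\<close> to \<open>W\<close>, so that no
  derivative of the components of \<open>n\<close> is needed; the same device is used for \<open>\<nu>\<close> below.\<close>

lemma ip_cov_nn_event:
  assumes W: "W differentiable (at u)"
  shows "ip (vaidya M) (x d u) (cov_along (vaidya M) (x d) (nn d) a u) (event 0 (W u)) =
    - (1/2 * (dvaidya M (x d u) (event 0 (D a u)) (event 0 (W u)) (nn d u)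
      + dvaidya M (x d u) (event 0 (W u)) (event 0 (D a u)) (nn d u)
      - dvaidya M (x d u) (nn d u) (event 0 (D a u)) (event 0 (W u))))"
proof -
  interpret V: metric_derivative "vaidya M" "x d u" "dvaidya M (x d u)"
    by (rule metric_at_x[OF d_gt_1 u])
  have W': "(\<lambda>v. event 0 (W v)) differentiable (at u)"
    by (rule differentiable_linear[OF bounded_linear_event W])
  have "pd a (\<lambda>v. ip (vaidya M) (x d v) (nn d v) (event 0 (W v))) u = pd a (\<lambda>v. 0) u"
    by (rule pd_cong_open[OF open_U u]) (rule ip_nn_event[OF good])
  then have "ip (vaidya M) (x d u) (cov_along (vaidya M) (x d) (nn d) a u) (event 0 (W u))
      = - ip (vaidya M) (x d u) (nn d u) (cov_along (vaidya M) (x d) (\<lambda>v. event 0 (W v)) a u)"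
    using V.pd_ip_along[of "x d" u "nn d" "\<lambda>v. event 0 (W v)" a, OF refl x_diff[OF u] nn_diff W']
    by (simp add: pd_const)
  also have "ip (vaidya M) (x d u) (nn d u) (cov_along (vaidya M) (x d) (\<lambda>v. event 0 (W v)) a u)
    = 0 + 1/2 * (dvaidya M (x d u) (event 0 (D a u)) (event 0 (W u)) (nn d u)
      + dvaidya M (x d u) (event 0 (W u)) (event 0 (D a u)) (nn d u)
      - dvaidya M (x d u) (nn d u) (event 0 (D a u)) (event 0 (W u)))"
    unfolding V.ip_cov_along[of "x d" u "\<lambda>v. event 0 (W v)" "nn d u" a, OF refl W'] pd_x[OF u]
      pd_linear[OF bounded_linear_event W] ip_nn_event[OF good u] ..
  finally show ?thesis by simp
qed

lemma nn_facts:
  "nn d u $ 1 = (1 + f d u) * s d u" "\<omega> d u \<bullet> spatial (nn d u) = f d u * s d u"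
  using s_facts(3)[OF good u] \<omega>_unit[OF d_gt_1 u] by (simp_all add: nn_def)

text \<open>The prefactor \<open>q d u\<close> is kept in front because it carries the decay in 1 /
  d; the bracket only has to possess a limit.\<close>

lemma k_entry:
  "ip (vaidya M) (x d u) (cov_along (vaidya M) (x d) (nn d) a u) (event 0 (D b u)) =
    q d u * (s d u * (- (1/2) * (m1 d u + f d u * (2 + f d u)) * (\<omega>D d a u * \<omega>D d b u)
      + f d u * (\<sigma> u $ a $ b - \<omega>D d a u * \<omega>D d b u)))"
  unfolding ip_cov_nn_event[OF D_diff[OF u]] koszul_x nn_facts
  by (simp add: \<omega>_inner_D[OF u] \<sigma>_nth algebra_simps)

definition "kap a = - q d u * (s d u * \<omega>D d a u *
   (1/2 * (m1 d u + f d u * (2 + f d u)) * (lam d u * \<beta> d u * inverse (1 + f d u)) + f d u * lam d u * \<beta> d u))"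

lemma kap_eq:
  "ip (vaidya M) (x d u) (cov_along (vaidya M) (x d) (nn d) a u) (event 0 (nu d u)) = kap a"
proof -
  \<comment> \<open>The angular term of the Koszul formula involves the Euclidean product of
    \<open>D a u\<close> and \<nu>. It need not vanish, since the two are orthogonal for the slice
    metric; \<open>nu_flat\<close> supplies its value.\<close>
  have "nu d u + (f d u * (\<omega> d u \<bullet> nu d u)) *\<^sub>R \<omega> d u = lam d u *\<^sub>R P u" by (rule nu_flat[OF good u])
  then have "D a u \<bullet> (nu d u + (f d u * (\<omega> d u \<bullet> nu d u)) *\<^sub>R \<omega> d u) = 0"
    using P_inner_D[OF u] by (simp add: inner_commute)
  then have "D a u \<bullet> nu d u = \<omega>D d a u * (\<omega> d u \<bullet> nu d u) - ((1 + f d u) * (\<omega> d u \<bullet> nu d u)) * \<omega>D d a u"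
    by (simp add: inner_add_right inner_commute[of "D a u" "\<omega> d u"] \<omega>_inner_D[OF u] algebra_simps)
  also have "(1 + f d u) * (\<omega> d u \<bullet> nu d u) = lam d u * \<beta> d u"
    unfolding \<omega>_inner_nu[OF good u] using f_gt by (simp add: field_simps)
  finally have Dnu: "D a u \<bullet> nu d u = \<omega>D d a u * (\<omega> d u \<bullet> nu d u) - lam d u * \<beta> d u * \<omega>D d a u" .
  show ?thesis
    unfolding ip_cov_nn_event[OF nu_diff] koszul_x nn_facts kap_def spatial_event event_nth Dnu
      \<omega>_inner_D[OF u] \<omega>_inner_nu[OF good u]
    by (simp add: algebra_simps)
qed

text \<open>The term \<open>lam d u * \<sigma> u $ a $ b\<close> is the second fundamental form of
  the Euclidean unit sphere, rescaled; the rest is the connection of the slice metric, on which l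
  restricts to -\<omega>.\<close>

lemma K_entry:
  "ip (slice_metric M d) (surf e P d u) (cov_along (slice_metric M d) (surf e P d) (nu d) a u) (D b u) =
    lam d u * \<sigma> u $ a $ b - q d u * (lam d u * \<beta> d u * inverse (1 + f d u) *
      (- (1/2) * (m1 d u + f d u) * (\<omega>D d a u * \<omega>D d b u) + f d u * (\<sigma> u $ a $ b - \<omega>D d a u * \<omega>D d b u)))"
proof -
  interpret V: metric_derivative "slice_metric M d" "surf e P d u"
      "\<lambda>C A B. dvaidya M (x d u) (event 0 C) (event 0 A) (event 0 B)"
    by (rule slice_at_surf[OF good u])
  let ?ip = "ip (slice_metric M d)"
  have "pd a (\<lambda>v. ?ip (surf e P d v) (nu d v) (D b v)) u = pd a (\<lambda>v. 0) u"
    by (rule pd_cong_open[OF open_U u]) (simp add: ip_nu[OF good] P_inner_D)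
  then have "?ip (surf e P d u) (cov_along (slice_metric M d) (surf e P d) (nu d) a u) (D b u)
      = - ?ip (surf e P d u) (nu d u) (cov_along (slice_metric M d) (surf e P d) (D b) a u)"
    using V.pd_ip_along[of "surf e P d" u "nu d" "D b" a, OF refl surf_diff[OF u] nu_diff D_diff[OF u]]
    by (simp add: pd_const)
  also have "?ip (surf e P d u) (nu d u) (cov_along (slice_metric M d) (surf e P d) (D b) a u)
    = ?ip (surf e P d u) (nu d u) (pd a (D b) u) + 1/2 * (dvaidya M (x d u) (event 0 (D a u)) (event 0 (D b u)) (event 0 (nu d u))
      + dvaidya M (x d u) (event 0 (D b u)) (event 0 (D a u)) (event 0 (nu d u))
      - dvaidya M (x d u) (event 0 (nu d u)) (event 0 (D a u)) (event 0 (D b u)))"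
    unfolding V.ip_cov_along[of "surf e P d" u "D b" "nu d u" a, OF refl D_diff[OF u]] pd_surf[OF u] ..
  also have "?ip (surf e P d u) (nu d u) (pd a (D b) u) = - lam d u * \<sigma> u $ a $ b"
    by (simp add: ip_nu[OF good u] P_inner_DD[OF u])
  finally show ?thesis
    unfolding koszul_x spatial_event event_nth \<omega>_inner_nu[OF good u] \<omega>_inner_D[OF u] \<sigma>_nth[symmetric]
    by (simp add: algebra_simps)
qed

lemma n_along_near: "v \<in> U \<Longrightarrow> n_along M e P d v = nn d v"
  by (rule n_along_eq[OF good])

lemma outward_near: "v \<in> U \<Longrightarrow> outward_normal M e P d v = nu d v"
  by (rule outward_normal_eq[OF good])

text \<open>The normal is a description at each point and can be differentiated only after being
  replaced by its closed form on an open set. \<open>good d\<close> holds over the whole of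
  \<open>U\<close>, so \<open>U\<close> itself serves.\<close>

lemma tr_k_eq:
  "tr_k M e P d u = trace_of (induced M e P d) (\<lambda>u. \<chi> a b.
    q d u * (s d u * (- (1/2) * (m1 d u + f d u * (2 + f d u)) * (\<omega>D d a u * \<omega>D d b u)
      + f d u * (\<sigma> u $ a $ b - \<omega>D d a u * \<omega>D d b u)))) u"
proof -
  have "ip (vaidya M) (x d u) (cov_along (vaidya M) (x d) (n_along M e P d) a u) (pd b (x d) u) =
    q d u * (s d u * (- (1/2) * (m1 d u + f d u * (2 + f d u)) * (\<omega>D d a u * \<omega>D d b u)
      + f d u * (\<sigma> u $ a $ b - \<omega>D d a u * \<omega>D d b u)))" for a b
  proof -
    have "cov_along (vaidya M) (x d) (n_along M e P d) a u = cov_along (vaidya M) (x d) (nn d) a u"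
      by (rule cov_along_cong_open[OF open_U u]) (rule n_along_near)
    then show ?thesis unfolding pd_x[OF u] k_entry[symmetric] by simp
  qed
  then show ?thesis by (simp add: tr_k_def trace_of_def)
qed

lemma mean_curv_eq:
  "mean_curv M e P d u = trace_of (induced M e P d) (\<lambda>u. \<chi> a b.
    lam d u * \<sigma> u $ a $ b - q d u * (lam d u * \<beta> d u * inverse (1 + f d u) *
      (- (1/2) * (m1 d u + f d u) * (\<omega>D d a u * \<omega>D d b u) + f d u * (\<sigma> u $ a $ b - \<omega>D d a u * \<omega>D d b u)))) u"
proof -
  have "ip (slice_metric M d) (surf e P d u)
       (cov_along (slice_metric M d) (surf e P d) (outward_normal M e P d) a u) (pd b (surf e P d) u) =
    lam d u * \<sigma> u $ a $ b - q d u * (lam d u * \<beta> d u * inverse (1 + f d u) *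
      (- (1/2) * (m1 d u + f d u) * (\<omega>D d a u * \<omega>D d b u) + f d u * (\<sigma> u $ a $ b - \<omega>D d a u * \<omega>D d b u)))" for a b
  proof -
    have "cov_along (slice_metric M d) (surf e P d) (outward_normal M e P d) a u
        = cov_along (slice_metric M d) (surf e P d) (nu d) a u"
      by (rule cov_along_cong_open[OF open_U u]) (rule outward_near)
    then show ?thesis unfolding pd_surf[OF u] K_entry[symmetric] by simp
  qed
  then show ?thesis by (simp add: mean_curv_def trace_of_def)
qed

section \<open>The mean curvature vector and the connection of the normal bundle\<close>

lemma ip_normals:
  "ip (vaidya M) (x d u) (event 0 (nu d u)) (event 0 (nu d u)) = 1"
  "ip (vaidya M) (x d u) (event 0 (nu d u)) (nn d u) = 0"
  "ip (vaidya M) (x d u) (nn d u) (event 0 (nu d u)) = 0"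
proof -
  show "ip (vaidya M) (x d u) (event 0 (nu d u)) (event 0 (nu d u)) = 1"
    using ip_nu_nu[OF good u] by (simp add: ip_slice Surf_event)
  show 1: "ip (vaidya M) (x d u) (nn d u) (event 0 (nu d u)) = 0" by (rule ip_nn_event[OF good u])
  show "ip (vaidya M) (x d u) (event 0 (nu d u)) (nn d u) = 0"
    using metric_derivative.ip_sym[OF metric_at_x[OF d_gt_1 u]] 1 by metis
qed

lemma H_norm_eq:
  "H_norm M e P d u = sqrt (mean_curv M e P d u * mean_curv M e P d u - tr_k M e P d u * tr_k M e P d u)"
  unfolding H_norm_def H_vec_def \<nu>_along_eq[OF good u] n_along_near[OF u] ip_linear ip_normals ip_nn_nn[OF good u]
  by (simp add: algebra_simps)

end

text \<open>Derivatives of the constants <n, n>, <\<nu>, \<nu>> and <n, \<nu>>. They leave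
  \<open>kap\<close> as the only component of the normal connection in the frame n, \<nu>.\<close>

lemma cov_normals:
  assumes good: "good d" and u: "u \<in> U"
  shows "ip (vaidya M) (x d u) (cov_along (vaidya M) (x d) (nn d) a u) (nn d u) = 0"
    "ip (vaidya M) (x d u) (cov_along (vaidya M) (x d) (\<lambda>v. event 0 (nu d v)) a u) (event 0 (nu d u)) = 0"
    "ip (vaidya M) (x d u) (cov_along (vaidya M) (x d) (\<lambda>v. event 0 (nu d v)) a u) (nn d u) = - kap d u a"
proof -
  have d: "d > 1" using good by (simp add: good_def)
  interpret V: metric_derivative "vaidya M" "x d u" "dvaidya M (x d u)"
    by (rule metric_at_x[OF d u])
  note pd_ip = V.pd_ip_along[of "x d" u _ _ a, OF refl x_diff[OF u]]
  have "pd a (\<lambda>v. ip (vaidya M) (x d v) (nn d v) (nn d v)) u = pd a (\<lambda>v. -1) u"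
    by (rule pd_cong_open[OF open_U u]) (rule ip_nn_nn[OF good])
  then show "ip (vaidya M) (x d u) (cov_along (vaidya M) (x d) (nn d) a u) (nn d u) = 0"
    using pd_ip[OF nn_diff[OF good u] nn_diff[OF good u]] V.ip_sym[of "nn d u" "cov_along (vaidya M) (x d) (nn d) a u"] by (simp add: pd_const)
  have "pd a (\<lambda>v. ip (vaidya M) (x d v) (event 0 (nu d v)) (event 0 (nu d v))) u = pd a (\<lambda>v. 1) u"
    by (rule pd_cong_open[OF open_U u]) (rule ip_normals(1)[OF good])
  then show "ip (vaidya M) (x d u) (cov_along (vaidya M) (x d) (\<lambda>v. event 0 (nu d v)) a u) (event 0 (nu d u)) = 0"
    using pd_ip[OF event_nu_diff[OF good u] event_nu_diff[OF good u]] V.ip_sym[of "event 0 (nu d u)" "cov_along (vaidya M) (x d) (\<lambda>v. event 0 (nu d v)) a u"]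
    by (simp add: pd_const)
  have "pd a (\<lambda>v. ip (vaidya M) (x d v) (nn d v) (event 0 (nu d v))) u = pd a (\<lambda>v. 0) u"
    by (rule pd_cong_open[OF open_U u]) (rule ip_normals(3)[OF good])
  then show "ip (vaidya M) (x d u) (cov_along (vaidya M) (x d) (\<lambda>v. event 0 (nu d v)) a u) (nn d u) = - kap d u a"
    using pd_ip[OF nn_diff[OF good u] event_nu_diff[OF good u]] V.ip_sym[of "nn d u" "cov_along (vaidya M) (x d) (\<lambda>v. event 0 (nu d v)) a u"] kap_eq[OF good u, of a]
    by (simp add: pd_const)
qed

lemma alpha_H_eq:
  fixes d u defines "h \<equiv> mean_curv M e P d" and "k \<equiv> tr_k M e P d"
  assumes good: "good d" and u: "u \<in> U" and h: "h differentiable (at u)" and k: "k differentiable (at u)"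
    and pos: "h u * h u - k u * k u > 0"
  shows "alpha_H M e P d u $ a =
    (h u * pd a k u - k u * pd a h u) * inverse (h u * h u - k u * k u) - kap d u a"
proof -
  define c where "c v = inverse (sqrt (h v * h v - k v * k v))" for v
  have cd: "c differentiable (at u)"
    unfolding c_def[abs_def] using pos
    by (intro differentiable_inverse differentiable_sqrt pos
        differentiable_diff differentiable_mult h k) auto
  have cc: "c u * c u = inverse (h u * h u - k u * k u)"
    unfolding c_def using pos by (simp add: inverse_mult_distrib[symmetric] del: inverse_mult_distrib)
  note Hn = H_norm_eq[OF good, folded h_def k_def]
  have J: "J_vec M e P d v /\<^sub>R H_norm M e P d v = (c v * h v) *\<^sub>R nn d v - (c v * k v) *\<^sub>R event 0 (nu d v)"
    if "v \<in> U" for v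
    unfolding J_vec_def h_def[symmetric] k_def[symmetric] n_along_eq[OF good that] \<nu>_along_eq[OF good that] Hn[OF that]
    by (simp add: c_def scaleR_diff_right)
  have H: "H_vec M e P d u /\<^sub>R H_norm M e P d u = c u *\<^sub>R (- (h u *\<^sub>R event 0 (nu d u)) + k u *\<^sub>R nn d u)"
    unfolding H_vec_def h_def[symmetric] k_def[symmetric] n_along_eq[OF good u] \<nu>_along_eq[OF good u] Hn[OF u]
    by (simp add: c_def)
  have nd: "nn d differentiable (at u)" "(\<lambda>v. event 0 (nu d v)) differentiable (at u)"
    using nn_diff event_nu_diff good u by blast+
  have chd: "(\<lambda>v. c v * h v) differentiable (at u)" "(\<lambda>v. c v * k v) differentiable (at u)"
    by (rule differentiable_mult[OF cd h], rule differentiable_mult[OF cd k])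
  have "cov_along (vaidya M) (x d) (\<lambda>v. J_vec M e P d v /\<^sub>R H_norm M e P d v) a u
     = cov_along (vaidya M) (x d) (\<lambda>v. (c v * h v) *\<^sub>R nn d v - (c v * k v) *\<^sub>R event 0 (nu d v)) a u"
    by (rule cov_along_cong_open[OF open_U u J])
  also have "\<dots> = (pd a (\<lambda>v. c v * h v) u *\<^sub>R nn d u + (c u * h u) *\<^sub>R cov_along (vaidya M) (x d) (nn d) a u)
     - (pd a (\<lambda>v. c v * k v) u *\<^sub>R event 0 (nu d u)
       + (c u * k u) *\<^sub>R cov_along (vaidya M) (x d) (\<lambda>v. event 0 (nu d v)) a u)"
    by (simp only: cov_along_diff[OF differentiable_scaleR[OF chd(1) nd(1)] differentiable_scaleR[OF chd(2) nd(2)]]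
      cov_along_scaleR[OF chd(1) nd(1)] cov_along_scaleR[OF chd(2) nd(2)])
  finally have cov: "cov_along (vaidya M) (x d) (\<lambda>v. J_vec M e P d v /\<^sub>R H_norm M e P d v) a u = \<dots>" .
  have "alpha_H M e P d u $ a = c u * (h u * pd a (\<lambda>v. c v * k v) u - k u * pd a (\<lambda>v. c v * h v) u)
     - kap d u a * (c u * c u * (h u * h u - k u * k u))"
    unfolding alpha_H_def vec_lambda_beta cov H ip_linear ip_normals[OF good u] cov_normals[OF good u]
      kap_eq[OF good u] ip_nn_nn[OF good u]
    by (simp add: algebra_simps)
  \<comment> \<open>The derivative of c = 1 / |H| cancels by antisymmetry, so the boost is handled
    without its rapidity.\<close>
  also have "\<dots> = (c u * c u) * (h u * pd a k u - k u * pd a h u) - kap d u a * (c u * c u * (h u * h u - k u * k u))"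
    by (simp add: pd_mult cd h k algebra_simps)
  finally show ?thesis unfolding cc using pos by (simp add: mult.commute)
qed

subsection \<open>Expansions on \<open>\<Sigma>\<^sub>d\<close>\<close>

abbreviation "M1 \<equiv> deriv M"
abbreviation "M2 \<equiv> deriv M1"
abbreviation "M3 \<equiv> deriv M2"

lemma M_derivs:
  "(M has_real_derivative M1 y) (at y)" "(M1 has_real_derivative M2 y) (at y)"
  "(M2 has_real_derivative M3 y) (at y)" "(M3 has_real_derivative deriv M3 y) (at y)"
  by (intro smooth_on_has_deriv smooth_on_deriv smooth_M)+

lemma M_derivs_diff: "M2 differentiable (at y)" "M3 differentiable (at y)"
  using M_derivs real_differentiable_def by blast+

context
  fixes u assumes u: "u \<in> U"
begin

lemma jet_\<rho>: "jet0 u \<rho> (\<lambda>_. 1)"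
proof -
  have "jet0 u (\<lambda>d v. sqrt (1 + 2 * (1 / d) * Z v + 1 / d * (1 / d))) (\<lambda>v. sqrt (1 + 2 * 0 * Z v + 0 * 0))"
    by (intro jet0_sqrt jet0_add jet0_mult jet0_inverse_arg jet0_const differentiable_const Z_diff u) auto
  then show ?thesis unfolding \<rho>_def[abs_def] by (rule jet0_eq) simp
qed

lemma jet_inverse_\<rho>: "jet0 u (\<lambda>d v. inverse (\<rho> d v)) (\<lambda>_. 1)"
  using jet0_inverse[OF jet_\<rho>] by simp

lemma jet_q: "jet u q (\<lambda>_. 0) (\<lambda>_. 1)"
  using jet_mult_small[OF jet_inverse_arg jet_inverse_\<rho>] by (simp add: q_def[abs_def])

lemma jet_w: "jet0 u w (\<lambda>v. - Z v)"
proof -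
  have "jet0 u (\<lambda>d v. - (2 * Z v + 1 / d) * inverse (1 + \<rho> d v)) (\<lambda>v. - (2 * Z v + 0) * inverse (1 + 1))"
    by (intro jet0_mult jet0_uminus jet0_add jet0_inverse jet0_inverse_arg jet_\<rho> jet0_const
        differentiable_const Z_diff u) auto
  then show ?thesis unfolding w_def[abs_def] by (rule jet0_eq) simp
qed

text \<open>Consumes derivatives of M up to the fourth: M' is composed, and the chain rule for jets
  needs its second derivative to be differentiable.\<close>

lemma jet_m1: "jet0 u m1 (\<lambda>v. M1 (- Z v))"
  unfolding m1_def[abs_def]
  by (rule jet0_compose[OF jet_w open_UNIV UNIV_I M_derivs(2) M_derivs(3) M_derivs_diff(2)])

lemma jet_f: "jet u f (\<lambda>_. 0) (\<lambda>v. M (- Z v))"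
proof -
  have "jet0 u (\<lambda>d v. M (w d v)) (\<lambda>v. M (- Z v))"
    by (rule jet0_compose[OF jet_w open_UNIV UNIV_I M_derivs(1) M_derivs(2) M_derivs_diff(1)])
  from jet_mult_small[OF jet_q this] show ?thesis by (simp add: f_def[abs_def])
qed

lemmas jet0_f = jet_imp_jet0[OF jet_f]

lemma jet_s: "jet0 u s (\<lambda>_. 1)"
proof -
  have "jet0 u (\<lambda>d v. inverse (sqrt (1 + f d v))) (\<lambda>v. inverse (sqrt (1 + 0)))"
    by (intro jet0_inverse jet0_sqrt jet0_add jet0_f jet0_const differentiable_const) auto
  then show ?thesis by (simp add: s_def[abs_def])
qed

lemma jet_inverse_1f: "jet0 u (\<lambda>d v. inverse (1 + f d v)) (\<lambda>_. 1)"
proof -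
  have "jet0 u (\<lambda>d v. inverse (1 + f d v)) (\<lambda>v. inverse (1 + 0))"
    by (intro jet0_inverse jet0_add jet0_f jet0_const differentiable_const) auto
  then show ?thesis by simp
qed

lemma jet_\<omega>D: "jet0 u (\<lambda>d. \<omega>D d a) (dZ a)"
  using jet0_mult[OF jet_inverse_\<rho> jet0_const[OF dZ_diff[OF u]]] by (simp add: \<omega>D_def[abs_def])

lemma jet_\<beta>: "jet0 u \<beta> Z"
proof -
  have "jet0 u (\<lambda>d v. inverse (\<rho> d v) * (Z v + 1 / d)) (\<lambda>v. 1 * (Z v + 0))"
    by (intro jet0_mult jet0_add jet0_inverse_arg jet_inverse_\<rho> jet0_const Z_diff u)
  then show ?thesis by (simp add: \<beta>_def[abs_def])
qed

lemma jet_lam: "jet0 u lam (\<lambda>_. 1)"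
proof -
  have "jet0 u (\<lambda>d v. inverse (sqrt (1 - f d v * inverse (1 + f d v) * (\<beta> d v * \<beta> d v))))
      (\<lambda>v. inverse (sqrt (1 - 0 * 1 * (Z v * Z v))))"
    by (intro jet0_inverse jet0_sqrt jet0_diff jet0_mult jet0_f jet_inverse_1f jet_\<beta> jet0_const
        differentiable_const) auto
  then show ?thesis by (simp add: lam_def[abs_def])
qed

lemma \<sigma>_diff: "(\<lambda>v. \<sigma> v $ a $ b) differentiable (at u)"
  unfolding \<sigma>_nth by (intro differentiable_inner D_diff u)

lemma jet_induced: "jet u (\<lambda>d v. \<sigma> v $ a $ b + f d v * (\<omega>D d a v * \<omega>D d b v)) (\<lambda>v. \<sigma> v $ a $ b)
   (\<lambda>v. M (- Z v) * (dZ a v * dZ b v))"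
  using jet_add[OF jet_const[OF \<sigma>_diff] jet_mult_small[OF jet_f jet0_mult[OF jet_\<omega>D jet_\<omega>D]]] by simp

text \<open>Once \<open>q\<close> has been split off, every term with an undifferentiated f tends to
  zero, and M' alone determines the limit.\<close>

lemma jet_k_entry:
  "jet0 u (\<lambda>d v. s d v * (- (1/2) * (m1 d v + f d v * (2 + f d v)) * (\<omega>D d a v * \<omega>D d b v)
      + f d v * (\<sigma> v $ a $ b - \<omega>D d a v * \<omega>D d b v))) (\<lambda>v. - (1/2) * M1 (- Z v) * dZ a v * dZ b v)"
proof -
  have "jet0 u (\<lambda>d v. s d v * (- (1/2) * (m1 d v + f d v * (2 + f d v)) * (\<omega>D d a v * \<omega>D d b v)
      + f d v * (\<sigma> v $ a $ b - \<omega>D d a v * \<omega>D d b v)))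
     (\<lambda>v. 1 * (- (1/2) * (M1 (- Z v) + 0 * (2 + 0)) * (dZ a v * dZ b v) + 0 * (\<sigma> v $ a $ b - dZ a v * dZ b v)))"
    by (intro jet0_mult jet0_add jet0_diff jet_s jet_m1 jet0_f jet_\<omega>D jet0_const differentiable_const \<sigma>_diff)
  then show ?thesis by (rule jet0_eq) simp
qed

lemma jet_K_entry:
  "jet0 u (\<lambda>d v. lam d v * \<sigma> v $ a $ b - q d v * (lam d v * \<beta> d v * inverse (1 + f d v) *
      (- (1/2) * (m1 d v + f d v) * (\<omega>D d a v * \<omega>D d b v) + f d v * (\<sigma> v $ a $ b - \<omega>D d a v * \<omega>D d b v))))
    (\<lambda>v. \<sigma> v $ a $ b)"
proof -
  have "jet0 u (\<lambda>d v. lam d v * \<sigma> v $ a $ b - q d v * (lam d v * \<beta> d v * inverse (1 + f d v) *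
      (- (1/2) * (m1 d v + f d v) * (\<omega>D d a v * \<omega>D d b v) + f d v * (\<sigma> v $ a $ b - \<omega>D d a v * \<omega>D d b v))))
    (\<lambda>v. 1 * \<sigma> v $ a $ b - 0 * (1 * Z v * 1 * (- (1/2) * (M1 (- Z v) + 0) * (dZ a v * dZ b v)
      + 0 * (\<sigma> v $ a $ b - dZ a v * dZ b v))))"
    by (intro jet0_mult jet0_add jet0_diff jet_imp_jet0[OF jet_q] jet_lam jet_\<beta> jet_inverse_1f jet_m1 jet0_f
        jet_\<omega>D jet0_const differentiable_const \<sigma>_diff)
  then show ?thesis by (rule jet0_eq) simp
qed

lemma det2_\<sigma>: "det2 (\<sigma> u) \<noteq> 0"
proof -
  have "det2 (\<sigma> u) > 0"
    by (rule det2_pos) (use \<sigma>_sym \<sigma>_pos[OF u] in \<open>auto simp: ip_sum\<close>)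
  then show ?thesis by simp
qed

end

text \<open>Since F'(z) = - M1 (- z), this is 1/2 F'(Z) |dZ|^2, the leading coefficient of
  \<open>tr_k\<close>.\<close>

definition "\<tau> v = - (1/2) * M1 (- Z v) * (1 - (Z v)\<^sup>2)"

lemma jet_tr_k:
  assumes u: "u \<in> U" shows "jet u (tr_k M e P) (\<lambda>_. 0) \<tau>"
proof -
  let ?g = "\<lambda>d v a b. \<sigma> v $ a $ b + f d v * (\<omega>D d a v * \<omega>D d b v)"
  let ?S = "\<lambda>d v a b. s d v * (- (1/2) * (m1 d v + f d v * (2 + f d v)) * (\<omega>D d a v * \<omega>D d b v)
      + f d v * (\<sigma> v $ a $ b - \<omega>D d a v * \<omega>D d b v))"
  have "jet0 u (\<lambda>d v. tr2 (?g d v) (?S d v))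
     (\<lambda>v. tr2 (\<lambda>a b. \<sigma> v $ a $ b) (\<lambda>a b. - (1/2) * M1 (- Z v) * dZ a v * dZ b v))"
    using det2_\<sigma>[OF u]
    by (intro jet0_tr2 jet_imp_jet0[OF jet_induced] jet_k_entry u) (simp add: det2_def)
  from jet_mult_small[OF jet_q[OF u] this] have
    "jet u (\<lambda>d v. q d v * tr2 (?g d v) (?S d v)) (\<lambda>_. 0)
     (\<lambda>v. 1 * tr2 (\<lambda>a b. \<sigma> v $ a $ b) (\<lambda>a b. - (1/2) * M1 (- Z v) * dZ a v * dZ b v))" .
  then show ?thesis
  proof (rule jet_cong[OF _ open_U u])
    show "\<forall>\<^sub>F d in at_top. \<forall>v\<in>U. tr_k M e P d v = q d v * tr2 (?g d v) (?S d v)"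
      using eventually_good
    proof eventually_elim
      case (elim d)
      show ?case
      proof
        fix v assume v: "v \<in> U"
        have "det2 (induced M e P d v) \<noteq> 0" using det2_induced[OF elim v] by simp
        moreover have "induced M e P d v $ a $ b = ?g d v a b" for a b
          using elim by (simp add: induced_entry[OF _ v] good_def)
        ultimately show "tr_k M e P d v = q d v * tr2 (?g d v) (?S d v)"
          by (simp add: tr_k_eq[OF elim v] trace_of_eq_tr2 tr2_scale)
      qed
    qed
    fix v assume v: "v \<in> U"
    have "trace_of \<sigma> (\<lambda>v. \<chi> a b. - (1/2) * M1 (- Z v) * dZ a v * dZ b v) v = \<tau> v"
      unfolding \<tau>_def by (rule trace_gradient_square[OF v]) simp
    then show "\<tau> v = 1 * tr2 (\<lambda>a b. \<sigma> v $ a $ b) (\<lambda>a b. - (1/2) * M1 (- Z v) * dZ a v * dZ b v)"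
      using det2_\<sigma>[OF v] by (simp add: trace_of_eq_tr2)
  qed simp
qed

lemma jet_mean_curv:
  assumes u: "u \<in> U" shows "jet0 u (mean_curv M e P) (\<lambda>_. 2)"
proof -
  let ?g = "\<lambda>d v a b. \<sigma> v $ a $ b + f d v * (\<omega>D d a v * \<omega>D d b v)"
  let ?S = "\<lambda>d v a b. lam d v * \<sigma> v $ a $ b - q d v * (lam d v * \<beta> d v * inverse (1 + f d v) *
      (- (1/2) * (m1 d v + f d v) * (\<omega>D d a v * \<omega>D d b v) + f d v * (\<sigma> v $ a $ b - \<omega>D d a v * \<omega>D d b v)))"
  have "jet0 u (\<lambda>d v. tr2 (?g d v) (?S d v)) (\<lambda>v. tr2 (\<lambda>a b. \<sigma> v $ a $ b) (\<lambda>a b. \<sigma> v $ a $ b))"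
    using det2_\<sigma>[OF u]
    by (intro jet0_tr2 jet_imp_jet0[OF jet_induced] jet_K_entry u) (simp add: det2_def)
  then show ?thesis
  proof (rule jet0_cong[OF _ open_U u])
    show "\<forall>\<^sub>F d in at_top. \<forall>v\<in>U. mean_curv M e P d v = tr2 (?g d v) (?S d v)"
      using eventually_good
    proof eventually_elim
      case (elim d)
      show ?case
      proof
        fix v assume v: "v \<in> U"
        have "det2 (induced M e P d v) \<noteq> 0" using det2_induced[OF elim v] by simp
        moreover have "induced M e P d v $ a $ b = ?g d v a b" for a b
          using elim by (simp add: induced_entry[OF _ v] good_def)
        ultimately show "mean_curv M e P d v = tr2 (?g d v) (?S d v)"
          by (simp add: mean_curv_eq[OF elim v] trace_of_eq_tr2)
      qed
    qed
    fix v assume v: "v \<in> U"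
    show "2 = tr2 (\<lambda>a b. \<sigma> v $ a $ b) (\<lambda>a b. \<sigma> v $ a $ b)"
      using det2_\<sigma>[OF v] \<sigma>_sym[of v 1 2] by (simp add: tr2_def det2_def field_simps)
  qed
qed

lemma expands_kap:
  assumes u: "u \<in> U"
  shows "expands (\<lambda>d. kap d u a) 0 (- (1/2) * M1 (- Z u) * Z u * dZ a u)"
proof -
  let ?Y = "\<lambda>d u. - 1 * (s d u * \<omega>D d a u *
   (1/2 * (m1 d u + f d u * (2 + f d u)) * (lam d u * \<beta> d u * inverse (1 + f d u)) + f d u * lam d u * \<beta> d u))"
  have "jet0 u ?Y (\<lambda>v. - 1 * (1 * dZ a v * (1/2 * (M1 (- Z v) + 0 * (2 + 0)) * (1 * Z v * 1) + 0 * 1 * Z v)))"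
    by (intro jet0_mult jet0_add jet_s jet_\<omega>D jet_m1 jet0_f jet_lam jet_\<beta> jet_inverse_1f jet0_const
        differentiable_const u)
  from jet_mult_small[OF jet_q[OF u] this]
  have "expands (\<lambda>d. q d u * ?Y d u) 0 (1 * (- 1 * (1 * dZ a u * (1/2 * (M1 (- Z u) + 0 * (2 + 0)) * (1 * Z u * 1) + 0 * 1 * Z u))))"
    unfolding jet_def by blast
  moreover have "\<forall>\<^sub>F d in at_top. kap d u a = q d u * ?Y d u"
    using eventually_good by eventually_elim (simp add: kap_def u)
  ultimately show ?thesis using expands_cong by (fastforce simp: mult_ac)
qed

text \<open>The coefficient of dZ in \<open>alpha_1\<close>, with F'(z) = - M1 (- z) and F''(z) = M2
  (- z) inserted.\<close>

definition "p z = 1/4 * M2 (- z) * (1 - z\<^sup>2) + z * M1 (- z)"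

lemma expands_alpha_H:
  assumes u: "u \<in> U"
  shows "expands (\<lambda>d. alpha_H M e P d u $ a) 0 (p (Z u) * dZ a u)"
proof -
  let ?h = "mean_curv M e P" and ?k = "tr_k M e P"
  obtain h1 where h: "jet u ?h (\<lambda>_. 2) h1" using jet_mean_curv[OF u] by (auto simp: jet0_def)
  note k = jet_tr_k[OF u]
  have hE: "expands (\<lambda>d. ?h d u) 2 (h1 u)" "expands (\<lambda>d. pd a (?h d) u) 0 (pd a h1 u)"
    using h by (auto simp: jet_def pd_const)
  have kE: "expands (\<lambda>d. ?k d u) 0 (\<tau> u)" "expands (\<lambda>d. pd a (?k d) u) 0 (pd a \<tau> u)"
    using k by (auto simp: jet_def pd_const)
  have den: "expands (\<lambda>d. ?h d u * ?h d u - ?k d u * ?k d u) (2 * 2 - 0 * 0)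
      (2 * h1 u + h1 u * 2 - (0 * \<tau> u + \<tau> u * 0))"
    by (intro expands_diff expands_mult hE kE)
  \<comment> \<open>\<open>h1\<close> is multiplied only by zeros, because \<open>tr_k\<close> and
    the derivatives of both curvatures tend to zero. What remains is 2 d\<tau>, to be divided by the
    limit 4 of the denominator.\<close>
  have num: "expands (\<lambda>d. ?h d u * pd a (?k d) u - ?k d u * pd a (?h d) u) (2 * 0 - 0 * 0)
      (2 * pd a \<tau> u + h1 u * 0 - (0 * pd a h1 u + \<tau> u * 0))"
    by (intro expands_diff expands_mult hE kE)
  have E: "expands (\<lambda>d. (?h d u * pd a (?k d) u - ?k d u * pd a (?h d) u) * inverse (?h d u * ?h d u - ?k d u * ?k d u)
      - kap d u a) 0 (1/2 * pd a \<tau> u - - (1/2) * M1 (- Z u) * Z u * dZ a u)"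
    using expands_diff[OF expands_mult[OF num expands_inverse[OF den]] expands_kap[OF u, of a]] by simp
  have "pd a \<tau> u = (1/2 * M2 (- Z u) * (1 - (Z u)\<^sup>2) + Z u * M1 (- Z u)) * dZ a u"
  proof -
    have "((\<lambda>z. - (1/2) * M1 (- z) * (1 - z\<^sup>2)) has_real_derivative
       (1/2 * M2 (- z) * (1 - z\<^sup>2) + z * M1 (- z))) (at z)" for z
      by (auto intro!: derivative_eq_intros DERIV_chain2[OF M_derivs(2)] simp: field_simps)
    from compose_Z(2)[OF u this] show ?thesis by (simp add: \<tau>_def[abs_def])
  qed
  \<comment> \<open>The summand z M1 of p has two equal sources: one half from d\<tau> / 2, one half
    from -k(., \<nu>).\<close>
  then have "1/2 * pd a \<tau> u - - (1/2) * M1 (- Z u) * Z u * dZ a u = p (Z u) * dZ a u"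
    by (simp add: p_def field_simps)
  note E[unfolded this]
  moreover have "\<forall>\<^sub>F d in at_top. alpha_H M e P d u $ a =
     (?h d u * pd a (?k d) u - ?k d u * pd a (?h d) u) * inverse (?h d u * ?h d u - ?k d u * ?k d u) - kap d u a"
  proof -
    have "\<forall>\<^sub>F d in at_top. ?h d differentiable (at u)" "\<forall>\<^sub>F d in at_top. ?k d differentiable (at u)"
      using h k by (simp_all add: jet_def)
    moreover have "\<forall>\<^sub>F d in at_top. ?h d u * ?h d u - ?k d u * ?k d u > 0"
      using order_tendstoD(1)[OF expands_tendsto[OF den], of 0] by simp
    ultimately show ?thesis using eventually_good
      by eventually_elim (rule alpha_H_eq[OF _ u])
  qed
  ultimately show ?thesis by (rule expands_cong)
qed

lemma alpha_1_eq: "u \<in> U \<Longrightarrow> alpha_1 M e P u = (\<chi> a. p (Z u) * dZ a u)"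
  by (simp add: alpha_1_def vec_eq_iff the_expands[OF expands_alpha_H])

lemma expands_induced:
  assumes u: "u \<in> U"
  shows "expands (\<lambda>d. induced M e P d u $ a $ b) (\<sigma> u $ a $ b) (M (- Z u) * dZ a u * dZ b u)"
proof (rule expands_cong)
  show "expands (\<lambda>d. \<sigma> u $ a $ b + f d u * (\<omega>D d a u * \<omega>D d b u)) (\<sigma> u $ a $ b) (M (- Z u) * dZ a u * dZ b u)"
    using jet_induced[OF u, of a b] by (simp add: jet_def mult.assoc)
  show "\<forall>\<^sub>F d in at_top. induced M e P d u $ a $ b = \<sigma> u $ a $ b + f d u * (\<omega>D d a u * \<omega>D d b u)"
    using eventually_gt_at_top[of 1] by eventually_elim (rule induced_entry[OF _ u])
qed

lemma sigma_1_eq: "u \<in> U \<Longrightarrow> sigma_1 M e P u = (\<chi> a b. M (- Z u) * dZ a u * dZ b u)"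
  by (simp add: sigma_1_def vec_eq_iff the_expands[OF expands_induced])

section \<open>The two optimal embedding equations\<close>

context
  fixes G :: "real \<Rightarrow> real"
  assumes G: "\<And>z. z \<in> {-1..1} \<Longrightarrow> (G has_real_derivative M (- z)) (at z within {-1..1})"
begin

lemma G_Z: assumes "v \<in> U"
  shows "(\<lambda>v. G (Z v)) differentiable (at v)" "pd a (\<lambda>v. G (Z v)) v = M (- Z v) * dZ a v"
  using compose_Z_within[OF assms G[OF Z_bounds[OF assms]]] by auto

text \<open>The equation already holds before the divergence is taken: the differential of (\<Delta>
  + 2) X^0, written L below, is 2 p dZ, which is twice \<open>alpha_1\<close>.\<close>

lemma optimal_embedding_time:
  assumes u: "u \<in> U"
  shows "laplacian \<sigma> (\<lambda>v. laplacian \<sigma> (\<lambda>u. 1/2 * G (Z u)) v + 2 * (1/2 * G (Z v))) u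
    = 2 * div1 \<sigma> (alpha_1 M e P) u"
proof -
  have lap: "laplacian \<sigma> (\<lambda>u. 1/2 * G (Z u)) v = - (1/2) * M1 (- Z v) * (1 - (Z v)\<^sup>2) - Z v * M (- Z v)"
    if v: "v \<in> U" for v
  proof -
    have D: "((\<lambda>z. 1/2 * M (- z)) has_real_derivative - (1/2) * M1 (- z)) (at z)" for z
      by (auto intro!: derivative_eq_intros DERIV_chain2[OF M_derivs(1)])
    have "laplacian \<sigma> (\<lambda>u. 1/2 * G (Z u)) v = (- (1/2) * M1 (- Z v)) * (1 - (Z v)\<^sup>2) - 2 * Z v * (1/2 * M (- Z v))"
    proof (rule laplacian_gradient[OF v])
      show "pd a (\<lambda>u. 1/2 * G (Z u)) v' = 1/2 * M (- Z v') * dZ a v'" if "v' \<in> U" for v' a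
        unfolding pd_mult[OF differentiable_const G_Z(1)[OF that]] G_Z(2)[OF that] pd_const by simp
    qed (use compose_Z[OF v D] in auto)
    then show ?thesis by simp
  qed
  have p': "(p has_real_derivative (- (1/4) * M3 (- z) * (1 - z\<^sup>2) - 3/2 * z * M2 (- z) + M1 (- z))) (at z)" for z
    unfolding p_def[abs_def]
    by (auto intro!: derivative_eq_intros DERIV_chain2[OF M_derivs(2)] DERIV_chain2[OF M_derivs(3)] simp: add_divide_distrib diff_divide_distrib algebra_simps)
  let ?p' = "- (1/4) * M3 (- Z u) * (1 - (Z u)\<^sup>2) - 3/2 * Z u * M2 (- Z u) + M1 (- Z u)"
  define L where "L v = (- (1/2) * M1 (- Z v) * (1 - (Z v)\<^sup>2) - Z v * M (- Z v)) + G (Z v)" for v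
  have "laplacian \<sigma> (\<lambda>v. laplacian \<sigma> (\<lambda>u. 1/2 * G (Z u)) v + 2 * (1/2 * G (Z v))) u = laplacian \<sigma> L u"
    by (rule laplacian_cong[OF u]) (simp only: lap L_def)
  also have "\<dots> = (2 * ?p') * (1 - (Z u)\<^sup>2) - 2 * Z u * (2 * p (Z u))"
  proof (rule laplacian_gradient[OF u])
    show "pd a L v = 2 * p (Z v) * dZ a v" if v: "v \<in> U" for v a
    proof -
      \<comment> \<open>The surplus -M (- z) is cancelled by the derivative of the summand G(Z) of
        L.\<close>
      have D: "((\<lambda>z. - (1/2) * M1 (- z) * (1 - z\<^sup>2) - z * M (- z)) has_real_derivative
        2 * p z - M (- z)) (at z)" for z
        unfolding p_def
        by (auto intro!: derivative_eq_intros DERIV_chain2[OF M_derivs(1)] DERIV_chain2[OF M_derivs(2)] simp: field_simps)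
      show ?thesis
        unfolding L_def[abs_def] pd_add[OF compose_Z(1)[OF v D] G_Z(1)[OF v]] compose_Z(2)[OF v D] G_Z(2)[OF v]
        by (simp add: algebra_simps)
    qed
    have D: "((\<lambda>z. 2 * p z) has_real_derivative 2 * (- (1/4) * M3 (- z) * (1 - z\<^sup>2) - 3/2 * z * M2 (- z) + M1 (- z))) (at z)" for z
      by (intro DERIV_cmult p')
    show "(\<lambda>v. 2 * p (Z v)) differentiable (at u)" "pd b (\<lambda>v. 2 * p (Z v)) u = 2 * ?p' * dZ b u" for b
      using compose_Z[OF u D] by auto
  qed
  also have "\<dots> = 2 * (?p' * (1 - (Z u)\<^sup>2) - 2 * Z u * p (Z u))" by (simp add: field_simps)
  also have "?p' * (1 - (Z u)\<^sup>2) - 2 * Z u * p (Z u) = div1 \<sigma> (\<lambda>v. \<chi> a. p (Z v) * dZ a v) u"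
    by (rule div1_gradient[OF u, symmetric]) (use compose_Z[OF u p'] in auto)
  also have "\<dots> = div1 \<sigma> (alpha_1 M e P) u"
    by (rule div1_cong[OF u]) (simp add: alpha_1_eq)
  finally show ?thesis .
qed

text \<open>Z lies in the kernel of \<Delta> + 2, so on the left G survives only through its
  derivatives. On the right the M2 terms of the double divergence and of the Laplacian of the trace
  cancel. Both sides are then polynomials in Z, M (- Z) and M1 (- Z).\<close>

lemma optimal_embedding_radial:
  assumes u: "u \<in> U"
  shows "- (laplacian \<sigma> (\<lambda>u. 1/2 * Z u * G (Z u)) u + 2 * (1/2 * Z u * G (Z u)))
    = 1/2 * (div1 \<sigma> (div2 \<sigma> (sigma_1 M e P)) u - trace_of \<sigma> (sigma_1 M e P) u
       - laplacian \<sigma> (trace_of \<sigma> (sigma_1 M e P)) u)"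
proof -
  let ?z = "Z u"
  have lapN: "laplacian \<sigma> (\<lambda>u. 1/2 * Z u * G (Z u)) u
      = (M (- ?z) - 1/2 * ?z * M1 (- ?z)) * (1 - ?z\<^sup>2) - 2 * ?z * (1/2 * G ?z + 1/2 * ?z * M (- ?z))"
  proof (rule laplacian_gradient[OF u])
    have D: "((\<lambda>z. 1/2 * z) has_real_derivative 1/2) (at z)" for z :: real
      by (auto intro!: derivative_eq_intros)
    show "pd a (\<lambda>u. 1/2 * Z u * G (Z u)) v = (1/2 * G (Z v) + 1/2 * Z v * M (- Z v)) * dZ a v" if v: "v \<in> U" for v a
      unfolding pd_mult[OF compose_Z(1)[OF v D] G_Z(1)[OF v]] compose_Z(2)[OF v D] G_Z(2)[OF v]
      by (simp add: algebra_simps)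
    have D2: "((\<lambda>z. 1/2 * z * M (- z)) has_real_derivative 1/2 * M (- z) - 1/2 * z * M1 (- z)) (at z)" for z
      by (auto intro!: derivative_eq_intros DERIV_chain2[OF M_derivs(1)] simp: field_simps)
    have Gd: "(\<lambda>v. 1/2 * G (Z v)) differentiable (at u)" "pd b (\<lambda>v. 1/2 * G (Z v)) u = 1/2 * M (- ?z) * dZ b u" for b
      unfolding pd_mult[OF differentiable_const G_Z(1)[OF u]] G_Z(2)[OF u] pd_const
      by (rule differentiable_mult[OF differentiable_const G_Z(1)[OF u]]) simp
    show "(\<lambda>v. 1/2 * G (Z v) + 1/2 * Z v * M (- Z v)) differentiable (at u)"
      by (rule differentiable_add[OF Gd(1) compose_Z(1)[OF u D2]])
    show "pd b (\<lambda>v. 1/2 * G (Z v) + 1/2 * Z v * M (- Z v)) u = (M (- ?z) - 1/2 * ?z * M1 (- ?z)) * dZ b u" for b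
      unfolding pd_add[OF Gd(1) compose_Z(1)[OF u D2]] Gd(2) compose_Z(2)[OF u D2]
      by (simp add: algebra_simps)
  qed
  have DM: "((\<lambda>z. M (- z)) has_real_derivative - M1 (- z)) (at z)" for z
    using DERIV_chain2[OF M_derivs(1) DERIV_minus[OF DERIV_ident], of z] by simp
  have d2: "div2 \<sigma> (sigma_1 M e P) v = (\<chi> a. (- M1 (- Z v) * (1 - (Z v)\<^sup>2) - 3 * Z v * M (- Z v)) * dZ a v)"
    if v: "v \<in> U" for v
  proof -
    have "div2 \<sigma> (sigma_1 M e P) v = div2 \<sigma> (\<lambda>v. \<chi> a b. M (- Z v) * dZ a v * dZ b v) v"
      by (rule div2_cong[OF v]) (rule sigma_1_eq)
    then show ?thesis
      using div2_gradient_square[OF v compose_Z(1)[OF v DM] compose_Z(2)[OF v DM]] by (simp add: vec_eq_iff)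
  qed
  have Dk: "((\<lambda>z. - M1 (- z) * (1 - z\<^sup>2) - 3 * z * M (- z)) has_real_derivative
      M2 (- z) * (1 - z\<^sup>2) + 5 * z * M1 (- z) - 3 * M (- z)) (at z)" for z
    by (auto intro!: derivative_eq_intros DERIV_chain2[OF M_derivs(1)] DERIV_chain2[OF M_derivs(2)] simp: field_simps)
  have dd: "div1 \<sigma> (div2 \<sigma> (sigma_1 M e P)) u
    = (M2 (- ?z) * (1 - ?z\<^sup>2) + 5 * ?z * M1 (- ?z) - 3 * M (- ?z)) * (1 - ?z\<^sup>2)
      - 2 * ?z * (- M1 (- ?z) * (1 - ?z\<^sup>2) - 3 * ?z * M (- ?z))"
  proof -
    have "div1 \<sigma> (div2 \<sigma> (sigma_1 M e P)) u
      = div1 \<sigma> (\<lambda>v. \<chi> a. (- M1 (- Z v) * (1 - (Z v)\<^sup>2) - 3 * Z v * M (- Z v)) * dZ a v) u"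
      by (rule div1_cong[OF u]) (rule d2)
    then show ?thesis using div1_gradient[OF u compose_Z[OF u Dk]] by simp
  qed
  have tr: "trace_of \<sigma> (sigma_1 M e P) v = M (- Z v) * (1 - (Z v)\<^sup>2)" if v: "v \<in> U" for v
    by (rule trace_gradient_square[OF v]) (simp add: sigma_1_eq[OF v])
  have Dt: "((\<lambda>z. M (- z) * (1 - z\<^sup>2)) has_real_derivative - M1 (- z) * (1 - z\<^sup>2) - 2 * z * M (- z)) (at z)" for z
    by (auto intro!: derivative_eq_intros DERIV_chain2[OF M_derivs(1)] simp: field_simps)
  have Dt2: "((\<lambda>z. - M1 (- z) * (1 - z\<^sup>2) - 2 * z * M (- z)) has_real_derivative
      M2 (- z) * (1 - z\<^sup>2) + 4 * z * M1 (- z) - 2 * M (- z)) (at z)" for z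
    by (auto intro!: derivative_eq_intros DERIV_chain2[OF M_derivs(1)] DERIV_chain2[OF M_derivs(2)] simp: field_simps)
  have lt: "laplacian \<sigma> (trace_of \<sigma> (sigma_1 M e P)) u
    = (M2 (- ?z) * (1 - ?z\<^sup>2) + 4 * ?z * M1 (- ?z) - 2 * M (- ?z)) * (1 - ?z\<^sup>2)
      - 2 * ?z * (- M1 (- ?z) * (1 - ?z\<^sup>2) - 2 * ?z * M (- ?z))"
  proof -
    have "laplacian \<sigma> (trace_of \<sigma> (sigma_1 M e P)) u = laplacian \<sigma> (\<lambda>v. M (- Z v) * (1 - (Z v)\<^sup>2)) u"
      by (rule laplacian_cong[OF u]) (rule tr)
    then show ?thesis using laplacian_gradient[OF u compose_Z(2)[OF _ Dt] compose_Z[OF u Dt2]] by simp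
  qed
  show ?thesis unfolding lapN dd tr[OF u] lt by (simp add: field_simps power2_eq_square)
qed

end

end

text \<open>The first two conjuncts assert that the expansions exist, which is what gives the
  descriptions defining \<open>sigma_1\<close> and \<open>alpha_1\<close> their meaning. The chart
  is arbitrary, so the equations on \<open>U\<close> cover the whole sphere.\<close>

theorem lemma3p3:
  fixes M F G :: "real \<Rightarrow> real"
    and e :: "real^3"
    and U :: "(real^2) set"
    and P :: "real^2 \<Rightarrow> real^3"
    and Z N X0 :: "real^2 \<Rightarrow> real"
  assumes M: "smooth_on UNIV M"
    and e: "norm e = 1"
    and chart: "sphere_chart U P"
    and F: "\<forall>z\<in>{-1..1}. F z = M (- z)"
    and G: "\<forall>z\<in>{-1..1}. (G has_real_derivative F z) (at z within {-1..1})"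
    and Z: "Z = (\<lambda>u. e \<bullet> P u)"
    and N: "N = (\<lambda>u. 1/2 * Z u * G (Z u))"
    and X0: "X0 = (\<lambda>u. 1/2 * G (Z u))"
  shows "(\<forall>u\<in>U. \<forall>a b.
            expands (\<lambda>d. induced M e P d u $ a $ b) (round_metric P u $ a $ b) (sigma_1 M e P u $ a $ b))
       \<and> (\<forall>u\<in>U. \<forall>a. expands (\<lambda>d. alpha_H M e P d u $ a) 0 (alpha_1 M e P u $ a))
       \<and> (\<forall>u\<in>U.
            laplacian (round_metric P) (\<lambda>v. laplacian (round_metric P) X0 v + 2 * X0 v) u
              = 2 * div1 (round_metric P) (alpha_1 M e P) u)
       \<and> (\<forall>u\<in>U.
            - (laplacian (round_metric P) N u + 2 * N u)
              = 1/2 * (div1 (round_metric P) (div2 (round_metric P) (sigma_1 M e P)) u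
                       - trace_of (round_metric P) (sigma_1 M e P) u
                       - laplacian (round_metric P) (trace_of (round_metric P) (sigma_1 M e P)) u))"
proof -
  interpret vaidya_surfaces U P e M
    by unfold_locales (rule chart, rule e, rule M)
  have G': "(G has_real_derivative M (- z)) (at z within {-1..1})" if "z \<in> {-1..1}" for z
    using F G that by metis
  have "expands (\<lambda>d. induced M e P d u $ a $ b) (round_metric P u $ a $ b) (sigma_1 M e P u $ a $ b)"
    if "u \<in> U" for u a b
    using expands_induced[OF that] by (simp add: sigma_1_eq[OF that])
  moreover have "expands (\<lambda>d. alpha_H M e P d u $ a) 0 (alpha_1 M e P u $ a)" if "u \<in> U" for u a
    using expands_alpha_H[OF that] by (simp add: alpha_1_eq[OF that])
  ultimately show ?thesis
    unfolding N X0 unfolding Z using optimal_embedding_time[OF G'] optimal_embedding_radial[OF G'] by blast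
qed

end
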